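(* Let $K$ be an algebraically closed field, let $M=\mathbb{P}^1\times\mathbb{P}^1$ over $K$, and let $k\geq 2$ and $a\geq 1$ be integers. Let $L_1,\dots,L_{k-1}$ be pairwise different lines of type $(1,0)$ on $M$, and for $1\leq i\leq k-1$ let $D_i$ be a reduced effective divisor of degree $y_i$ on $L_i$, where $a\geq y_1\geq y_2\geq\dots\geq y_{k-1}\geq 0$. Let $\Gamma$ be an irreducible nodal curve of type $(k,a)$ on $M$ whose set of nodes is equal to $D_1+\dots+D_{k-1}$ (the union of the supports of the $D_i$). Let $n:C\to\Gamma$ be the normalization of $\Gamma$, and let $g^1_k$ be the base point free linear system of degree $k$ and dimension $1$ on $C$ induced by the pencil $\vert(0,1)\vert$ of lines of type $(0,1)$ on $M$. Then the scrollar invariants $e_1\leq e_2\leq\dots\leq e_{k-1}$ of $g^1_k$ are given by $$e_i=a-y_i-2\qquad\text{for } 1\leq i\leq k-1.$$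
   Context: Let $pr_1,pr_2:M=\mathbb{P}^1\times\mathbb{P}^1\to\mathbb{P}^1$ be the two projections. A line of type $(1,0)$ is a fiber $pr_1^{-1}(P)$ and a line of type $(0,1)$ is a fiber $pr_2^{-1}(P)$, with $P\in\mathbb{P}^1$. The classes $(1,0)$ and $(0,1)$ of these lines freely generate $\mathrm{Pic}(M)$; write $(a,b)=a\cdot(1,0)+b\cdot(0,1)$. The intersection number is $(a,b).(a',b')=ab'+ba'$. $\vert(a,b)\vert$ denotes the complete linear system of effective divisors of class $(a,b)$, and its elements are called curves of type $(a,b)$. A nodal curve is a reduced curve whose only singularities are ordinary nodes. Scrollar invariants: let $C$ be an irreducible smooth complete curve over $K$ with a base point free linear system $g^1_k$ (degree $k$, dimension $1$), and let $F$ be a divisor belonging to $g^1_k$. Write $h^0(C,ng^1_k)=\dim_K H^0(C,\mathcal{O}_C(nF))$ for $n\in\mathbb{Z}$. The scrollar invariants of $g^1_k$ are the integers $e_1\leq e_2\leq\dots\leq e_{k-1}$ defined as follows: $e_i+2$ is the smallest integer $n$ such that $h^0(C,ng^1_k)-h^0(C,(n-1)g^1_k)>i$. *)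

theory Defs
  imports "HOL-Computational_Algebra.Computational_Algebra"
begin

section \<open>The projective line\<close>

definition proj_rel :: "'a::field \<times> 'a \<Rightarrow> 'a \<times> 'a \<Rightarrow> bool" where
  "proj_rel p q \<longleftrightarrow> p \<noteq> (0, 0) \<and> q \<noteq> (0, 0) \<and> fst p * snd q = snd p * fst q"

text \<open>\<open>rep_P1 P\<close> is a chosen pair of homogeneous coordinates \<open>(x0, x1)\<close> of \<open>P\<close>. Everything
  defined below with the help of \<open>rep_P1\<close> is unchanged if the coordinates are rescaled.\<close>

quotient_type (overloaded) 'a P1 = "'a::field \<times> 'a" / partial: proj_rel
proof (rule part_equivpI)
  show "\<exists>p::'a \<times> 'a. proj_rel p p"
    by (rule exI[of _ "(1, 0)"]) (simp add: proj_rel_def)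
  show "symp (proj_rel :: 'a \<times> 'a \<Rightarrow> _)"
    by (auto simp: symp_def proj_rel_def mult.commute)
  show "transp (proj_rel :: 'a \<times> 'a \<Rightarrow> _)"
  proof (rule transpI)
    fix p q r :: "'a \<times> 'a"
    assume pq: "proj_rel p q" and qr: "proj_rel q r"
    obtain a b where p: "p = (a, b)" by (cases p)
    obtain c d where q: "q = (c, d)" by (cases q)
    obtain e f where r: "r = (e, f)" by (cases r)
    from pq qr have cd: "c \<noteq> 0 \<or> d \<noteq> 0" and 1: "a * d = b * c" and 2: "c * f = d * e"
      by (auto simp: proj_rel_def p q r)
    have "c * (a * f) = c * (b * e)" "d * (a * f) = d * (b * e)"
      using 1 2 by algebra+
    with cd have "a * f = b * e" by auto
    with pq qr show "proj_rel p r" by (simp add: proj_rel_def p q r)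
  qed
qed


section \<open>Curves on \<open>P1 \<times> P1\<close>\<close>

text \<open>A form of bidegree \<open>(m, n)\<close>,
    \<open>\<Sum>i\<le>m. \<Sum>j\<le>n. c i j * x0^(m-i) * x1^i * y0^(n-j) * y1^j\<close>,
  is stored as its dehomogenization at \<open>x0 = y0 = 1\<close>, that is, as the polynomial \<open>G\<close> with
  \<open>coeff (coeff G i) j = c i j\<close> (outer variable \<open>x1/x0\<close>, inner variable \<open>y1/y0\<close>), together with
  the bidegree. Dehomogenization identifies the forms of bidegree \<open>(m, n)\<close> with the polynomials
  satisfying \<open>biform m n\<close>; the degrees of \<open>G\<close> may be smaller than \<open>m\<close> and \<open>n\<close>, in which case the
  form is divisible by a power of \<open>x0\<close> or \<open>y0\<close>. The product of forms is the product of the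
  polynomials, and the bidegrees add up.\<close>

definition biform :: "nat \<Rightarrow> nat \<Rightarrow> 'a::field poly poly \<Rightarrow> bool" where
  "biform m n G \<longleftrightarrow> degree G \<le> m \<and> (\<forall>i. degree (coeff G i) \<le> n)"

definition eval_form ::
  "('a::field \<Rightarrow> 'c::comm_ring_1) \<Rightarrow> nat \<Rightarrow> nat \<Rightarrow> 'a poly poly \<Rightarrow> 'c \<times> 'c \<Rightarrow> 'c \<times> 'c \<Rightarrow> 'c" where
  "eval_form \<iota> m n G p q =
     (\<Sum>i\<le>m. \<Sum>j\<le>n. \<iota> (coeff (coeff G i) j)
        * fst p ^ (m - i) * snd p ^ i * fst q ^ (n - j) * snd q ^ j)"

text \<open>A curve of type \<open>(m, n)\<close>, i.e. an effective divisor in the class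
  \<open>m \<cdot> [fibre of pr1] + n \<cdot> [fibre of pr2]\<close>, is given by a nonzero form of bidegree \<open>(m, n)\<close>
  (unique up to a constant factor).\<close>

definition curve_of_type :: "nat \<Rightarrow> nat \<Rightarrow> 'a::field poly poly \<Rightarrow> bool" where
  "curve_of_type m n G \<longleftrightarrow> biform m n G \<and> G \<noteq> 0"

definition curve_support :: "nat \<Rightarrow> nat \<Rightarrow> 'a::field poly poly \<Rightarrow> ('a P1 \<times> 'a P1) set" where
  "curve_support m n G = {(P, Q). eval_form id m n G (rep_P1 P) (rep_P1 Q) = 0}"

text \<open>Irreducible as a divisor: a nonzero effective divisor that is not the sum of two nonzero
  effective divisors.\<close>

definition irreducible_curve :: "nat \<Rightarrow> nat \<Rightarrow> 'a::field poly poly \<Rightarrow> bool" where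
  "irreducible_curve m n F \<longleftrightarrow> curve_of_type m n F \<and> (m, n) \<noteq> (0, 0) \<and>
     (\<forall>m1 n1 m2 n2 G H. biform m1 n1 G \<and> biform m2 n2 H \<and>
        m = m1 + m2 \<and> n = n1 + n2 \<and> F = G * H \<longrightarrow> (m1, n1) = (0, 0) \<or> (m2, n2) = (0, 0))"

definition reduced_curve :: "nat \<Rightarrow> nat \<Rightarrow> 'a::field poly poly \<Rightarrow> bool" where
  "reduced_curve m n F \<longleftrightarrow> curve_of_type m n F \<and>
     (\<forall>m1 n1 m2 n2 G H. biform m1 n1 G \<and> biform m2 n2 H \<and>
        m = 2 * m1 + m2 \<and> n = 2 * n1 + n2 \<and> F = G ^ 2 * H \<longrightarrow> (m1, n1) = (0, 0))"

text \<open>Homogeneous coordinates of the points of an affine chart of \<open>P1\<close> containing \<open>p\<close>, with affine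
  coordinate \<open>t\<close> vanishing at \<open>p\<close>.\<close>

definition affine_chart :: "('a::field \<Rightarrow> 'c::comm_ring_1) \<Rightarrow> 'a \<times> 'a \<Rightarrow> 'c \<Rightarrow> 'c \<times> 'c" where
  "affine_chart \<iota> p t = (if fst p \<noteq> 0 then (\<iota> (fst p), \<iota> (snd p) + t) else (t, \<iota> (snd p)))"

text \<open>Equation of a curve in such a chart around \<open>(P, Q)\<close>, a polynomial in the local coordinates
  \<open>s\<close> (outer variable) and \<open>t\<close> (inner variable).\<close>

definition local_equation ::
  "nat \<Rightarrow> nat \<Rightarrow> 'a::field poly poly \<Rightarrow> 'a P1 \<times> 'a P1 \<Rightarrow> 'a poly poly" where
  "local_equation m n F PQ =
     eval_form (\<lambda>c. [:[:c:]:]) m n F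
       (affine_chart (\<lambda>c. [:[:c:]:]) (rep_P1 (fst PQ)) [:0, 1:])
       (affine_chart (\<lambda>c. [:[:c:]:]) (rep_P1 (snd PQ)) [:[:0, 1:]:])"

definition is_singular_point ::
  "nat \<Rightarrow> nat \<Rightarrow> 'a::field poly poly \<Rightarrow> 'a P1 \<times> 'a P1 \<Rightarrow> bool" where
  "is_singular_point m n F PQ \<longleftrightarrow> (let f = local_equation m n F PQ in
     coeff (coeff f 0) 0 = 0 \<and> coeff (coeff f 1) 0 = 0 \<and> coeff (coeff f 0) 1 = 0)"

text \<open>A double point with two distinct tangents: the quadratic part of the local equation is
  \<open>(a s + b t) (c s + d t)\<close> with linearly independent factors.\<close>

definition is_node :: "nat \<Rightarrow> nat \<Rightarrow> 'a::field poly poly \<Rightarrow> 'a P1 \<times> 'a P1 \<Rightarrow> bool" where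
  "is_node m n F PQ \<longleftrightarrow> is_singular_point m n F PQ \<and>
     (let f = local_equation m n F PQ in
      \<exists>a b c d. a * d - b * c \<noteq> 0 \<and>
        coeff (coeff f 2) 0 = a * c \<and>
        coeff (coeff f 1) 1 = a * d + b * c \<and>
        coeff (coeff f 0) 2 = b * d)"

definition nodes :: "nat \<Rightarrow> nat \<Rightarrow> 'a::field poly poly \<Rightarrow> ('a P1 \<times> 'a P1) set" where
  "nodes m n F = {PQ \<in> curve_support m n F. is_node m n F PQ}"

definition nodal_curve :: "nat \<Rightarrow> nat \<Rightarrow> 'a::field poly poly \<Rightarrow> bool" where
  "nodal_curve m n F \<longleftrightarrow> reduced_curve m n F \<and>
     (\<forall>PQ \<in> curve_support m n F. is_singular_point m n F PQ \<longrightarrow> is_node m n F PQ)"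

text \<open>The fibres of the first projection.\<close>

definition lines_10 :: "('a::field P1 \<times> 'a P1) set set" where
  "lines_10 = {fst -` {P} | P. True}"


section \<open>The normalization\<close>

text \<open>The function field of an irreducible curve is realized inside an arbitrary extension
  \<open>\<iota> : 'a \<rightarrow> 'b\<close> of the ground field by means of a generic point: a \<open>'b\<close>-valued point \<open>(\<xi>, \<eta>)\<close> of
  \<open>P1 \<times> P1\<close> such that a form over \<open>'a\<close> vanishes at \<open>(\<xi>, \<eta>)\<close> iff it vanishes identically on the
  curve, i.e. is a multiple of the equation \<open>F\<close>. Up to isomorphism over \<open>'a\<close> the resulting field does
  not depend on the choice of the extension and of the generic point.\<close>

definition field_embedding :: "('a::field \<Rightarrow> 'b::field) \<Rightarrow> bool" where
  "field_embedding \<iota> \<longleftrightarrow> \<iota> 1 = 1 \<and>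
     (\<forall>x y. \<iota> (x + y) = \<iota> x + \<iota> y) \<and> (\<forall>x y. \<iota> (x * y) = \<iota> x * \<iota> y)"

definition form_dvd ::
  "nat \<Rightarrow> nat \<Rightarrow> 'a::field poly poly \<Rightarrow> nat \<Rightarrow> nat \<Rightarrow> 'a poly poly \<Rightarrow> bool" where
  "form_dvd m1 n1 F m n G \<longleftrightarrow>
     G = 0 \<or> (\<exists>m2 n2 H. biform m2 n2 H \<and> m = m1 + m2 \<and> n = n1 + n2 \<and> G = F * H)"

definition generic_point ::
  "('a::field \<Rightarrow> 'b::field) \<Rightarrow> nat \<Rightarrow> nat \<Rightarrow> 'a poly poly \<Rightarrow> 'b P1 \<Rightarrow> 'b P1 \<Rightarrow> bool" where
  "generic_point \<iota> k a F \<xi> \<eta> \<longleftrightarrow>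
     (\<forall>m n G. biform m n G \<longrightarrow>
        (eval_form \<iota> m n G (rep_P1 \<xi>) (rep_P1 \<eta>) = 0 \<longleftrightarrow> form_dvd k a F m n G))"

text \<open>Quotients of forms of the same bidegree, restricted to the curve.\<close>

definition function_field ::
  "('a::field \<Rightarrow> 'b::field) \<Rightarrow> 'b P1 \<Rightarrow> 'b P1 \<Rightarrow> 'b set" where
  "function_field \<iota> \<xi> \<eta> =
     {eval_form \<iota> m n G (rep_P1 \<xi>) (rep_P1 \<eta>) / eval_form \<iota> m n H (rep_P1 \<xi>) (rep_P1 \<eta>) | m n G H.
        biform m n G \<and> biform m n H \<and> eval_form \<iota> m n H (rep_P1 \<xi>) (rep_P1 \<eta>) \<noteq> 0}"

text \<open>The smooth complete curve with function field \<open>L\<close> over \<open>'a\<close>: its points are the normalized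
  discrete valuations of \<open>L\<close> that are trivial on the constants. The first condition fixes the
  (meaningless) value at \<open>0\<close> and outside \<open>L\<close>, so that each point is represented exactly once.\<close>

definition curve_points :: "('a::field \<Rightarrow> 'b::field) \<Rightarrow> 'b set \<Rightarrow> ('b \<Rightarrow> int) set" where
  "curve_points \<iota> L = {v.
     (\<forall>z. z \<notin> L - {0} \<longrightarrow> v z = 0) \<and>
     (\<forall>x \<in> L - {0}. \<forall>y \<in> L - {0}. v (x * y) = v x + v y) \<and>
     (\<forall>x \<in> L - {0}. \<forall>y \<in> L - {0}. x + y \<noteq> 0 \<longrightarrow> min (v x) (v y) \<le> v (x + y)) \<and>
     (\<forall>c. c \<noteq> 0 \<longrightarrow> v (\<iota> c) = 0) \<and>
     (\<exists>t \<in> L - {0}. v t = 1)}"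

type_synonym 'b divisor = "('b \<Rightarrow> int) \<Rightarrow> int"

definition sections :: "('a::field \<Rightarrow> 'b::field) \<Rightarrow> 'b set \<Rightarrow> 'b divisor \<Rightarrow> 'b set" where
  "sections \<iota> L D = {z \<in> L. z = 0 \<or> (\<forall>v \<in> curve_points \<iota> L. 0 \<le> v z + D v)}"

definition h0 :: "('a::field \<Rightarrow> 'b::field) \<Rightarrow> 'b set \<Rightarrow> 'b divisor \<Rightarrow> nat" where
  "h0 \<iota> L D = vector_space.dim (\<lambda>c z. \<iota> c * z) (sections \<iota> L D)"

text \<open>Pullback to the normalization of the line \<open>pr2 = Q\<close>, whose equation is \<open>q0 * y1 - q1 * y0\<close>.
  With \<open>y = y1/y0\<close> the second coordinate function, the order of the pullback at \<open>v\<close> is that of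
  \<open>(q0 * y1 - q1 * y0) / y0 = q0 * y - q1\<close> if \<open>v y \<ge> 0\<close>, and that of
  \<open>(q0 * y1 - q1 * y0) / y1 = (q0 * y - q1) / y\<close> if \<open>v y < 0\<close>.\<close>

definition line_pullback :: "('a::field \<Rightarrow> 'b::field) \<Rightarrow> 'b P1 \<Rightarrow> 'a P1 \<Rightarrow> 'b divisor" where
  "line_pullback \<iota> \<eta> Q = (\<lambda>v.
     let y = snd (rep_P1 \<eta>) / fst (rep_P1 \<eta>)
     in v (\<iota> (fst (rep_P1 Q)) * y - \<iota> (snd (rep_P1 Q))) - min 0 (v y))"

text \<open>The linear system on the normalization induced by the pencil of fibres of the second
  projection.\<close>

definition induced_pencil :: "('a::field \<Rightarrow> 'b::field) \<Rightarrow> 'b P1 \<Rightarrow> 'b divisor set" where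
  "induced_pencil \<iota> \<eta> = range (line_pullback \<iota> \<eta>)"


section \<open>Scrollar invariants\<close>

text \<open>\<open>e\<close> is the \<open>i\<close>-th scrollar invariant of the pencil containing the divisor \<open>F\<close>, on the curve
  with function field \<open>L\<close>.\<close>

definition is_scrollar_invariant ::
  "('a::field \<Rightarrow> 'b::field) \<Rightarrow> 'b set \<Rightarrow> 'b divisor \<Rightarrow> nat \<Rightarrow> int \<Rightarrow> bool" where
  "is_scrollar_invariant \<iota> L F i e \<longleftrightarrow>
     (let jump = (\<lambda>n::int. int (h0 \<iota> L (\<lambda>v. n * F v)) - int (h0 \<iota> L (\<lambda>v. (n - 1) * F v)) > int i)
      in jump (e + 2) \<and> (\<forall>n. jump n \<longrightarrow> e + 2 \<le> n))"

end

theory Submission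
  imports Defs
begin

text \<open>
  Let \<open>x, y\<close> be the two coordinate functions on the curve \<open>C\<close>, let \<open>f(x, y) = 0\<close> be its equation, of degree
  \<open>k\<close> in \<open>x\<close> and \<open>a\<close> in \<open>y\<close>, and suppose that the member \<open>F\<close> of the pencil is the fibre \<open>y = \<infinity>\<close>. Let
  \<open>x = x\<^sub>i\<close> be the lines with nodes, \<open>p\<^sub>i(y)\<close> the polynomial whose simple roots are the nodes on the \<open>i\<close>-th
  line, and \<open>d\<^sub>i = a - y\<^sub>i\<close>. The scrollar invariants are read off from an explicit basis of the functions on
  \<open>C\<close> with poles over \<open>y = \<infinity>\<close> only, as a module over \<open>K[y]\<close>: it consists of \<open>\<phi>\<^sub>0 = 1\<close> and
    \<open>\<phi>\<^sub>i = f(x\<^sub>i, y) / (p\<^sub>i(y) (x - x\<^sub>i))\<close>,  \<open>1 \<le> i \<le> k - 1\<close>.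

  As \<open>f(x, y) = 0\<close> on \<open>C\<close>, the quotient \<open>f(x\<^sub>i, y) / (x - x\<^sub>i)\<close> is a polynomial in \<open>x\<close> and \<open>y\<close>.
  Dividing it by \<open>p\<^sub>i(y)\<close> creates no poles. Off the line this is so because \<open>p\<^sub>i(y)\<close> divides
  \<open>f(x\<^sub>i, y)\<close>. At a node, with local coordinates \<open>s, t\<close>, the function
  \<open>w = f(x\<^sub>i, y) / (s t)\<close> satisfies a monic quadratic equation with regular coefficients. The pole of \<open>\<phi>\<^sub>i\<close> over
  \<open>y = \<infinity>\<close> is at most \<open>d\<^sub>i F\<close>, for the same reasons applied in the coordinate \<open>1 / y\<close> (\<open>psi_regular\<close>).

  These functions are independent on every single fibre. Suppose that \<open>b\<^sub>0 + \<Sum> b\<^sub>i \<phi>\<^sub>i\<close> with constant \<open>b\<^sub>i\<close>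
  vanishes on a whole fibre of \<open>y\<close>, multiplicities included. At a node the two branches give \<open>w\<close> two different residues; this forces
  \<open>b\<^sub>i = 0\<close> and still leaves a zero of order \<open>m - 1\<close> in \<open>x\<close>, where \<open>m\<close> is the multiplicity of the
  point in the fibre. Every other point of the fibre gives a zero of order \<open>m\<close>. The multiplicities add up to
  \<open>k\<close>, which is too much for a rational function of \<open>x\<close> of the degree at hand, so all \<open>b\<^sub>i\<close> vanish
  (\<open>psi_independent\<close>).

  The \<open>\<phi>\<^sub>i\<close> are a basis of the function field over \<open>K(y)\<close>, by Lagrange interpolation at the \<open>x\<^sub>i\<close>.
  If a section of \<open>n F\<close> is written with a denominator \<open>C(y)\<close> of least degree, independence over a root of \<open>C\<close>
  would allow a cancellation; so the coefficients are polynomials in \<open>y\<close>, and independence over \<open>y = \<infinity>\<close>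
  bounds their degrees by \<open>n - d\<^sub>i\<close> (\<open>sect_expansion\<close>). Hence \<open>h\<^sup>0(n F)\<close> is the sum of the numbers
  \<open>max 0 (n - d\<^sub>i + 1)\<close> over \<open>0 \<le> i < k\<close>, with \<open>d\<^sub>0 = 0\<close> (\<open>h0_multiple\<close>). It jumps from \<open>n - 1\<close> to \<open>n\<close>
  by the number of \<open>i\<close> with \<open>d\<^sub>i \<le> n\<close>, and as \<open>d\<^sub>1 \<le> d\<^sub>2 \<le> \<dots>\<close> the jump exceeds \<open>i\<close> if and only if
  \<open>n \<ge> d\<^sub>i = e\<^sub>i + 2\<close>.

  This independence needs enough discrete valuations of the function field. They are orders of vanishing
  along power series solutions of the equation, which Hensel's lemma provides: one at each smooth point
  (\<open>smooth_place\<close>), and one for each of the two branches at a node (\<open>node_places\<close>). Points at infinity on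
  either factor are treated like all others, by writing the equation in a suitable basis of \<open>K\<^sup>2\<close>.
\<close>

section \<open>Evaluation of polynomials and forms\<close>

text \<open>Ring homomorphisms as plain functions. Evaluating polynomials with coefficients mapped along a
  homomorphism covers all the rings that occur: constants, the function field, power series, and
  polynomials in two variables.\<close>

definition rhom :: "('a::comm_ring_1 \<Rightarrow> 'c::comm_ring_1) \<Rightarrow> bool" where
  "rhom h \<longleftrightarrow> h 1 = 1 \<and> (\<forall>x y. h (x + y) = h x + h y) \<and> (\<forall>x y. h (x * y) = h x * h y)"

lemma rhom_1: "rhom h \<Longrightarrow> h 1 = 1"
  and rhom_add: "rhom h \<Longrightarrow> h (x + y) = h x + h y"
  and rhom_mult: "rhom h \<Longrightarrow> h (x * y) = h x * h y"
  by (auto simp: rhom_def)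

lemma rhom_0: assumes "rhom h" shows "h 0 = 0"
  using rhom_add[OF assms, of 0 0] by simp

lemma rhom_minus: assumes "rhom h" shows "h (- x) = - h x"
  using rhom_add[OF assms, of x "- x"] rhom_0[OF assms] by (simp add: eq_neg_iff_add_eq_0 add.commute)

lemma rhom_diff: assumes "rhom h" shows "h (x - y) = h x - h y"
  using rhom_add[OF assms, of x "- y"] rhom_minus[OF assms] by simp

lemma rhom_power: assumes "rhom h" shows "h (x ^ n) = h x ^ n"
  by (induction n) (simp_all add: rhom_1[OF assms] rhom_mult[OF assms])

lemma rhom_sum: assumes "rhom h" shows "h (sum f A) = (\<Sum>x\<in>A. h (f x))"
  by (induction A rule: infinite_finite_induct) (simp_all add: rhom_0[OF assms] rhom_add[OF assms])

lemma rhom_prod: assumes "rhom h" shows "h (prod f A) = (\<Prod>x\<in>A. h (f x))"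
  by (induction A rule: infinite_finite_induct) (simp_all add: rhom_1[OF assms] rhom_mult[OF assms])

lemmas rhom_simps = rhom_1 rhom_0 rhom_add rhom_mult rhom_minus rhom_diff rhom_power rhom_sum rhom_prod

lemma rhom_eq_0_iff:
  fixes h :: "'a::field \<Rightarrow> 'c::comm_ring_1"
  assumes "rhom h" shows "h c = 0 \<longleftrightarrow> c = 0"
proof
  assume "h c = 0"
  show "c = 0"
  proof (rule ccontr)
    assume "c \<noteq> 0"
    then have "h c * h (inverse c) = 1" using rhom_mult[OF assms, of c "inverse c"] rhom_1[OF assms] by simp
    with \<open>h c = 0\<close> show False by simp
  qed
qed (simp add: rhom_0[OF assms])

lemma rhom_comp: "rhom h \<Longrightarrow> rhom g \<Longrightarrow> rhom (\<lambda>x. h (g x))"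
  by (simp add: rhom_def)

lemma rhom_id: "rhom id" "rhom (\<lambda>x. x)"
  by (simp_all add: rhom_def)

lemma rhom_fps_const: "rhom (fps_const :: 'a::comm_ring_1 \<Rightarrow> 'a fps)"
  by (simp add: rhom_def)

lemma rhom_const_poly: "rhom (\<lambda>c. [:c:])"
  by (simp add: rhom_def one_pCons)

lemma rhom_map_poly: assumes "rhom h" shows "rhom (map_poly h)"
  unfolding rhom_def
proof (intro conjI allI)
  note h = rhom_simps[OF assms]
  show "map_poly h 1 = 1" by (simp add: map_poly_1' h)
  fix p q
  show "map_poly h (p + q) = map_poly h p + map_poly h q"
    by (rule poly_eqI) (simp add: coeff_map_poly h)
  show "map_poly h (p * q) = map_poly h p * map_poly h q"
    by (rule poly_eqI) (simp add: coeff_map_poly coeff_mult h)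
qed

definition pev :: "('a::comm_ring_1 \<Rightarrow> 'c::comm_ring_1) \<Rightarrow> 'c \<Rightarrow> 'a poly \<Rightarrow> 'c" where
  "pev h y p = poly (map_poly h p) y"

definition ev :: "('a::comm_ring_1 \<Rightarrow> 'c::comm_ring_1) \<Rightarrow> 'c \<Rightarrow> 'c \<Rightarrow> 'a poly poly \<Rightarrow> 'c" where
  "ev h x y = pev (pev h y) x"

lemma rhom_pev: assumes "rhom h" shows "rhom (pev h y)"
  using rhom_map_poly[OF assms] by (simp add: rhom_def pev_def)

lemma rhom_ev: "rhom h \<Longrightarrow> rhom (ev h x y)"
  by (simp add: ev_def rhom_pev)

lemma pev_pCons [simp]: assumes "rhom h" shows "pev h y (pCons c p) = h c + y * pev h y p"
  by (simp add: pev_def rhom_0[OF assms] map_poly_pCons)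

lemma pev_0 [simp]: "rhom h \<Longrightarrow> pev h y 0 = 0"
  by (simp add: pev_def)

lemma ev_pCons [simp]: assumes "rhom h" shows "ev h x y (pCons c p) = pev h y c + x * ev h x y p"
  by (simp add: ev_def rhom_pev[OF assms])

lemma ev_0 [simp]: "rhom h \<Longrightarrow> ev h x y 0 = 0"
  by (simp add: ev_def rhom_pev)

lemma pev_altdef: 
  assumes "rhom h" "degree p \<le> n"
  shows "pev h y p = (\<Sum>j\<le>n. h (coeff p j) * y ^ j)"
proof -
  have "degree (map_poly h p) \<le> n"
    using assms(2) by (intro degree_le) (auto simp: coeff_map_poly rhom_0[OF assms(1)] coeff_eq_0)
  then have "poly (map_poly h p) y = (\<Sum>j\<le>n. coeff (map_poly h p) j * y ^ j)"
    unfolding poly_altdef by (intro sum.mono_neutral_left) (auto simp: coeff_eq_0)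
  then show ?thesis by (simp add: pev_def coeff_map_poly rhom_0[OF assms(1)])
qed

lemma pev_id: "pev id y p = poly p y" "pev (\<lambda>c. c) y p = poly p y"
  by (simp_all add: pev_def)

lemma pev_smult: assumes "rhom h" shows "pev h y (smult c p) = h c * pev h y p"
  using rhom_mult[OF rhom_pev[OF assms], of y "[:c:]" p] by (simp add: assms)

lemma ev_smult: assumes "rhom h" shows "ev h x y (smult c p) = pev h y c * ev h x y p"
  using rhom_mult[OF rhom_ev[OF assms], of x y "[:c:]" p] by (simp add: assms)

lemma rhom_pev_comp:
  assumes "rhom h" "rhom g"
  shows "h (pev g y p) = pev (\<lambda>c. h (g c)) (h y) p"
proof -
  note c = rhom_comp[OF assms]
  show ?thesis by (induction p) (simp_all add: assms c rhom_simps[OF assms(1)])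
qed

lemma rhom_ev_comp:
  assumes "rhom h" "rhom g"
  shows "h (ev g x y p) = ev (\<lambda>c. h (g c)) (h x) (h y) p"
proof -
  note c = rhom_comp[OF assms]
  show ?thesis
    by (induction p) (simp_all add: assms c rhom_simps[OF assms(1)] rhom_pev_comp)
qed

lemma rhom_eval_form:
  assumes "rhom h"
  shows "h (eval_form g m n G p q) = eval_form (\<lambda>c. h (g c)) m n G (map_prod h h p) (map_prod h h q)"
  by (simp add: eval_form_def rhom_simps[OF assms] map_prod_def split_beta)

text \<open>Homogeneity: only the proportionality class of the coordinates matters for zeros and quotients.\<close>

lemma eval_form_scale:
  "eval_form h m n G (c * p0, c * p1) (d * q0, d * q1) = c ^ m * d ^ n * eval_form h m n G (p0, p1) (q0, q1)"
proof -
  have "h (coeff (coeff G i) j) * (c * p0) ^ (m - i) * (c * p1) ^ i * (d * q0) ^ (n - j) * (d * q1) ^ j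
     = c ^ m * d ^ n * (h (coeff (coeff G i) j) * p0 ^ (m - i) * p1 ^ i * q0 ^ (n - j) * q1 ^ j)"
    if "i \<le> m" "j \<le> n" for i j
  proof -
    have "c ^ m = c ^ (m - i) * c ^ i" "d ^ n = d ^ (n - j) * d ^ j"
      using that by (simp_all flip: power_add)
    then show ?thesis by (simp add: power_mult_distrib algebra_simps)
  qed
  then show ?thesis by (simp add: eval_form_def sum_distrib_left)
qed

lemma eval_form_affine:
  assumes "rhom h" "biform m n G"
  shows "eval_form h m n G (1, x) (1, y) = ev h x y G"
proof -
  have "ev h x y G = (\<Sum>i\<le>m. pev h y (coeff G i) * x ^ i)"
    unfolding ev_def using assms by (intro pev_altdef) (auto simp: rhom_pev biform_def)
  also have "\<dots> = (\<Sum>i\<le>m. (\<Sum>j\<le>n. h (coeff (coeff G i) j) * y ^ j) * x ^ i)"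
    using assms by (intro sum.cong refl arg_cong2[of _ _ _ _ "(*)"] pev_altdef) (auto simp: biform_def)
  also have "\<dots> = eval_form h m n G (1, x) (1, y)"
    by (simp add: eval_form_def sum_distrib_right sum_distrib_left mult_ac)
  finally show ?thesis by simp
qed

lemma biform_0 [simp]: "biform m n 0"
  by (simp add: biform_def)

lemma biform_mono: "biform m n G \<Longrightarrow> m \<le> m' \<Longrightarrow> n \<le> n' \<Longrightarrow> biform m' n' G"
  by (auto simp: biform_def intro: order.trans)

lemma biform_add: "biform m n G \<Longrightarrow> biform m n H \<Longrightarrow> biform m n (G + H)"
  by (auto simp: biform_def intro!: degree_add_le)

lemma biform_sum: "(\<And>i. i \<in> A \<Longrightarrow> biform m n (f i)) \<Longrightarrow> biform m n (sum f A)"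
  by (induction A rule: infinite_finite_induct) (auto intro: biform_add)

lemma biform_mult:
  assumes "biform m n G" "biform m' n' H" shows "biform (m + m') (n + n') (G * H)"
  unfolding biform_def
proof (intro conjI allI)
  show "degree (G * H) \<le> m + m'"
    using assms degree_mult_le[of G H] by (simp add: biform_def)
  fix i
  show "degree (coeff (G * H) i) \<le> n + n'"
    unfolding coeff_mult
  proof (rule degree_sum_le)
    fix j assume "j \<in> {..i}"
    have "degree (coeff G j) \<le> n" "degree (coeff H (i - j)) \<le> n'" using assms by (auto simp: biform_def)
    then show "degree (coeff G j * coeff H (i - j)) \<le> n + n'"
      using degree_mult_le[of "coeff G j" "coeff H (i - j)"] by linarith
  qed simp
qed

lemma biform_1 [simp]: "biform 0 0 1"
  by (simp add: biform_def one_pCons coeff_pCons split: nat.splits)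

lemma biform_power: assumes "biform m n G" shows "biform (i * m) (i * n) (G ^ i)"
  by (induction i) (auto intro: biform_mult[OF assms])

lemma biform_ex: "\<exists>n. biform (degree G) n G"
proof -
  have "degree (coeff G i) \<le> (\<Sum>i\<le>degree G. degree (coeff G i))" for i
  proof (cases "i \<le> degree G")
    case True then show ?thesis by (intro member_le_sum) auto
  qed (simp add: coeff_eq_0)
  then show ?thesis by (auto simp: biform_def)
qed

lemma biform_const [simp]: "biform m n [:p:] \<longleftrightarrow> degree p \<le> n"
  by (auto simp: biform_def coeff_pCons split: nat.splits dest: spec[of _ 0])

lemma alg_closed_infinite: "infinite (UNIV :: 'a::alg_closed_field set)"
proof
  assume fin: "finite (UNIV :: 'a set)"
  define p :: "'a poly" where "p = (\<Prod>c\<in>UNIV. [:- c, 1:]) + 1"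
  have "degree (\<Prod>c\<in>(UNIV::'a set). [:- c, 1:]) = card (UNIV::'a set)"
    by (subst degree_prod_eq_sum_degree) auto
  moreover have "card (UNIV::'a set) > 0" using fin by (simp add: card_gt_0_iff)
  ultimately have "degree p > 0"
    unfolding p_def by (subst degree_add_eq_left) auto
  then obtain z where "poly p z = 0" using alg_closed_imp_poly_has_root by blast
  moreover have "poly p z = 1" using fin by (auto simp: p_def poly_prod intro!: prod_zero)
  ultimately show False by simp
qed

lemma poly_zero_if_cofinite:
  fixes p :: "'a::alg_closed_field poly"
  assumes "finite S" "\<And>x. x \<notin> S \<Longrightarrow> poly p x = 0"
  shows "p = 0"
proof (rule ccontr)
  assume "p \<noteq> 0"
  then have "finite {x. poly p x = 0}" by (rule poly_roots_finite)
  moreover have "UNIV \<subseteq> S \<union> {x. poly p x = 0}" using assms(2) by auto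
  ultimately show False using alg_closed_infinite assms(1) by (metis finite_Un finite_subset)
qed

lemma ev_id: "ev id x y G = poly (poly G [:x:]) y"
  by (induction G) (simp_all add: rhom_id pev_id)

lemma ev_conv_poly: assumes "rhom h" shows "ev h (h x) y G = pev h y (poly G [:x:])"
  by (induction G) (simp_all add: assms rhom_simps[OF rhom_pev[OF assms]] pev_smult)

text \<open>Identities in two variables are verified by comparing values; the finitely many arguments at which a change of
  coordinates is undefined can be left out.\<close>

lemma polypoly_zero_if_cofinite:
  fixes G :: "'a::alg_closed_field poly poly"
  assumes "finite S" "finite T" "\<And>x y. x \<notin> S \<Longrightarrow> y \<notin> T \<Longrightarrow> ev id x y G = 0"
  shows "G = 0"
proof -
  have 1: "poly G [:x:] = 0" if "x \<notin> S" for x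
    using assms(2,3) that by (intro poly_zero_if_cofinite[of T]) (auto simp: ev_id)
  show ?thesis
  proof (rule ccontr)
    assume "G \<noteq> 0"
    then have "finite {x. poly G x = 0}" by (rule poly_roots_finite)
    then have "finite ((\<lambda>x. [:x:]) -` {x. poly G x = 0})" by (rule finite_vimageI) (auto intro: injI)
    moreover have "UNIV \<subseteq> S \<union> ((\<lambda>x. [:x:]) -` {x. poly G x = 0})" using 1 by auto
    ultimately show False using alg_closed_infinite assms(1) by (metis finite_Un finite_subset)
  qed
qed

lemma polypoly_eq_if_cofinite:
  fixes G H :: "'a::alg_closed_field poly poly"
  assumes "finite S" "finite T" "\<And>x y. x \<notin> S \<Longrightarrow> y \<notin> T \<Longrightarrow> ev id x y G = ev id x y H"
  shows "G = H"
proof -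
  have "G - H = 0" using assms
    by (intro polypoly_zero_if_cofinite[of S T]) (auto simp: rhom_diff[OF rhom_ev[OF rhom_id(1)]])
  then show ?thesis by simp
qed

section \<open>Points of the projective line and coordinate frames\<close>

lemma rep_P1_nonzero: "rep_P1 P \<noteq> (0, 0)"
  using Quotient3_rep_reflp[OF Quotient3_P1, of P] by (simp add: proj_rel_def)

lemma rep_P1_inject_prop:
  assumes "fst (rep_P1 P) * snd (rep_P1 Q) = snd (rep_P1 P) * fst (rep_P1 Q)"
  shows "P = Q"
proof -
  have "proj_rel (rep_P1 P) (rep_P1 Q)"
    using assms by (simp add: proj_rel_def rep_P1_nonzero)
  then show ?thesis by (simp add: Quotient3_rel_rep[OF Quotient3_P1])
qed

lemma rep_P1_surj:
  assumes "u \<noteq> (0, 0)"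
  obtains P c where "c \<noteq> 0" "u = (c * fst (rep_P1 P), c * snd (rep_P1 P))"
proof -
  define p where "p = rep_P1 (abs_P1 u)"
  have "proj_rel u u" using assms by (simp add: proj_rel_def)
  then have "proj_rel p u"
    unfolding p_def by (rule rep_abs_rsp_left[OF Quotient3_P1])
  then have p: "p \<noteq> (0, 0)" "fst p * snd u = snd p * fst u" by (auto simp: proj_rel_def)
  define c where "c = (if fst p \<noteq> 0 then fst u / fst p else snd u / snd p)"
  obtain p0 p1 where pp: "p = (p0, p1)" by (cases p)
  obtain u0 u1 where uu: "u = (u0, u1)" by (cases u)
  have "u = (c * p0, c * p1) \<and> c \<noteq> 0"
    using p assms by (cases "p0 = 0") (auto simp: pp uu c_def field_simps)
  then show thesis using that[of c "abs_P1 u"] unfolding p_def[symmetric] pp by simp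
qed

text \<open>A frame is a basis \<open>(u, e)\<close> of \<open>K\<^sup>2\<close>; it parametrizes the projective line minus the point
  \<open>e\<close> by \<open>X \<mapsto> u + X e\<close>.\<close>

type_synonym 'a frame = "('a \<times> 'a) \<times> ('a \<times> 'a)"

definition frm :: "('a \<Rightarrow> 'c::comm_ring_1) \<Rightarrow> 'a frame \<Rightarrow> 'c \<Rightarrow> 'c \<times> 'c" where
  "frm h A X = (h (fst (fst A)) + X * h (fst (snd A)), h (snd (fst A)) + X * h (snd (snd A)))"

definition fdet :: "'a::field frame \<Rightarrow> 'a" where
  "fdet A = fst (fst A) * snd (snd A) - snd (fst A) * fst (snd A)"

definition proportional :: "'c::field \<times> 'c \<Rightarrow> 'c \<times> 'c \<Rightarrow> bool" where
  "proportional p q \<longleftrightarrow> (\<exists>c. c \<noteq> 0 \<and> p = (c * fst q, c * snd q))"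

abbreviation cst :: "'a::comm_ring_1 \<Rightarrow> 'a poly poly" where
  "cst \<equiv> (\<lambda>c. [:[:c:]:])"

lemma rhom_cst: "rhom (cst :: 'a::comm_ring_1 \<Rightarrow> _)"
  by (simp add: rhom_def one_pCons)

definition frame_equation :: "nat \<Rightarrow> nat \<Rightarrow> 'a::field poly poly \<Rightarrow> 'a frame \<Rightarrow> 'a frame \<Rightarrow> 'a poly poly" where
  "frame_equation k a G A B = eval_form cst k a G (frm cst A [:0, 1:]) (frm cst B [:[:0, 1:]:])"

lemma ev_eval_form:
  fixes G :: "'a::field poly poly"
  assumes "rhom h"
  shows "ev h x y (eval_form cst m n G p q)
    = eval_form h m n G (map_prod (ev h x y) (ev h x y) p) (map_prod (ev h x y) (ev h x y) q)"
proof -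
  have "ev h x y (cst c) = h c" for c :: 'a using assms by (simp add: rhom_0)
  then show ?thesis using rhom_eval_form[OF rhom_ev[OF assms], of x y cst m n G p q] by simp
qed

lemma map_prod_frm:
  assumes "rhom h" shows "map_prod h h (frm g A X) = frm (\<lambda>c. h (g c)) A (h X)"
  by (simp add: frm_def rhom_simps[OF assms])

lemma ev_frame_equation:
  fixes G :: "'a::field poly poly"
  assumes "rhom h"
  shows "ev h x y (frame_equation k a G A B) = eval_form h k a G (frm h A x) (frm h B y)"
proof -
  have "(\<lambda>c. ev h x y (cst c)) = h" using assms by (simp add: rhom_0)
  moreover have "ev h x y [:0, 1:] = x" "ev h x y [:[:0, 1:]:] = y"
    using assms by (simp_all add: rhom_1 rhom_0 rhom_1[OF rhom_ev[OF assms]] rhom_1[OF rhom_pev[OF assms]])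
  ultimately show ?thesis
    by (simp add: frame_equation_def ev_eval_form[OF assms] map_prod_frm[OF rhom_ev[OF assms]])
qed

lemma biform_eval_form:
  assumes "biform 1 0 p0" "biform 1 0 p1" "biform 0 1 q0" "biform 0 1 q1"
  shows "biform m n (eval_form cst m n G (p0, p1) (q0, q1))"
proof -
  have "biform m n ([:[:coeff (coeff G i) j:]:] * p0 ^ (m - i) * p1 ^ i * q0 ^ (n - j) * q1 ^ j)"
    if "i \<le> m" "j \<le> n" for i j
  proof -
    have "biform (0 + (m - i) * 1 + i * 1 + (n - j) * 0 + j * 0) (0 + (m - i) * 0 + i * 0 + (n - j) * 1 + j * 1)
       ([:[:coeff (coeff G i) j:]:] * p0 ^ (m - i) * p1 ^ i * q0 ^ (n - j) * q1 ^ j)"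
      by (intro biform_mult biform_power assms) simp
    then show ?thesis using that by simp
  qed
  then show ?thesis by (auto simp: eval_form_def intro!: biform_sum)
qed

lemma biform_frame_equation: "biform k a (frame_equation k a G A B)"
  unfolding frame_equation_def frm_def
  by (intro biform_eval_form) (auto simp: biform_def coeff_pCons split: nat.splits)

text \<open>Every point other than \<open>e\<close>, with coordinates in any extension field, has a parameter in the frame
  \<open>(u, e)\<close>, by Cramer's rule.\<close>

lemma frm_param:
  assumes "fdet A \<noteq> 0" "rhom h" "fst z * h (snd (snd A)) - snd z * h (fst (snd A)) \<noteq> (0 :: 'c :: field)"
  obtains x where "proportional z (frm h A x)"
proof -
  obtain u0 u1 e0 e1 where A: "A = ((u0, u1), (e0, e1))" by (metis surj_pair)
  obtain z0 z1 where z: "z = (z0, z1)" by (cases z)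
  define d where "d = h (u0 * e1 - u1 * e0)"
  have d: "d \<noteq> 0" "d = h u0 * h e1 - h u1 * h e0"
    using assms(1,2) rhom_eq_0_iff[OF assms(2), of "u0 * e1 - u1 * e0"]
    by (simp_all add: d_def fdet_def A rhom_simps)
  define c where "c = z0 * h e1 - z1 * h e0"
  have c: "c \<noteq> 0" using assms(3) by (simp add: A z c_def)
  define x where "x = (h u0 * z1 - h u1 * z0) / c"
  have "z0 * d = c * (h u0 + x * h e0)" "z1 * d = c * (h u1 + x * h e1)"
    using c by (simp_all add: x_def d(2) distrib_left) (simp_all add: c_def algebra_simps)
  then have "z0 = (c / d) * (h u0 + x * h e0)" "z1 = (c / d) * (h u1 + x * h e1)"
    using d(1) by (simp_all only: times_divide_eq_left eq_divide_eq if_False if_True simp_thms)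
  then have "proportional z (frm h A x)"
    unfolding proportional_def using c d(1) by (intro exI[of _ "c / d"]) (simp add: A z frm_def)
  then show thesis by (rule that)
qed

section \<open>Affine models of the curve\<close>

text \<open>An affine description of the function field: it is generated by \<open>x, y\<close>, which satisfy the equation \<open>\<gamma>\<close>
  and no equation of a smaller degree in \<open>x\<close> or in \<open>y\<close>. The same field has such a description for every
  choice of frames.\<close>

locale plane_model =
  fixes \<iota> :: "'a::alg_closed_field \<Rightarrow> 'b::field" and L :: "'b set" and k a :: nat
    and \<gamma> :: "'a poly poly" and x y :: 'b
  assumes hom: "rhom \<iota>"
    and biform: "biform k a \<gamma>"
    and nz: "\<gamma> \<noteq> 0"
    and zero: "ev \<iota> x y \<gamma> = 0"
    and indep: "\<And>m n G. biform m n G \<Longrightarrow> m < k \<or> n < a \<Longrightarrow> ev \<iota> x y G = 0 \<Longrightarrow> G = 0"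
    and L: "L = {ev \<iota> x y G / ev \<iota> x y H | G H. ev \<iota> x y H \<noteq> 0}"
    and kpos: "k > 0" and apos: "a > 0"

text \<open>A change of coordinates loses no information: off finitely many arguments the values of \<open>G\<close> are
  nonzero multiples of values of its equation in the frames.\<close>

lemma frame_equation_zero:
  fixes G :: "'a::alg_closed_field poly poly"
  assumes G: "biform m n G" and det: "fdet A \<noteq> 0" "fdet B \<noteq> 0" and 0: "frame_equation m n G A B = 0"
  shows "G = 0"
proof (rule polypoly_zero_if_cofinite)
  obtain u0 u1 e0 e1 where A: "A = ((u0, u1), (e0, e1))" by (metis surj_pair)
  obtain v0 v1 f0 f1 where B: "B = ((v0, v1), (f0, f1))" by (metis surj_pair)
  define dA where "dA = u0 * e1 - u1 * e0"
  define dB where "dB = v0 * f1 - v1 * f0"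
  have dnz: "dA \<noteq> 0" "dB \<noteq> 0" using det by (auto simp: fdet_def A B dA_def dB_def)
  show "finite {X. snd (snd A) - X * fst (snd A) = 0}" "finite {Y. snd (snd B) - Y * fst (snd B) = 0}"
    using dnz poly_roots_finite[of "[:e1, -e0:]"] poly_roots_finite[of "[:f1, -f0:]"]
    by (fastforce simp: dA_def dB_def A B)+
  fix X Y assume "X \<notin> {X. snd (snd A) - X * fst (snd A) = 0}" "Y \<notin> {Y. snd (snd B) - Y * fst (snd B) = 0}"
  then have X: "e1 - X * e0 \<noteq> 0" and Y: "f1 - Y * f0 \<noteq> 0" by (auto simp: A B)
  define al where "al = (X * u0 - u1) / (e1 - X * e0)"
  define be where "be = (Y * v0 - v1) / (f1 - Y * f0)"
  have xx: "u0 + al * e0 = (dA / (e1 - X * e0)) * 1" "u1 + al * e1 = (dA / (e1 - X * e0)) * X"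
    using X by (simp_all add: divide_simps al_def) (simp_all add: dA_def algebra_simps)
  have yy: "v0 + be * f0 = (dB / (f1 - Y * f0)) * 1" "v1 + be * f1 = (dB / (f1 - Y * f0)) * Y"
    using Y by (simp_all add: divide_simps be_def) (simp_all add: dB_def algebra_simps)
  have "0 = ev id al be (frame_equation m n G A B)" using 0 by (simp add: rhom_id)
  also have "\<dots> = (dA / (e1 - X * e0)) ^ m * (dB / (f1 - Y * f0)) ^ n * ev id X Y G"
    unfolding ev_frame_equation[OF rhom_id(1)] frm_def A B fst_conv snd_conv id_apply xx yy eval_form_scale
    by (simp only: eval_form_affine[OF rhom_id(2) G])
  finally show "ev id X Y G = 0" using X Y dnz by simp
qed

text \<open>A polynomial relation between the affine coordinates \<open>x, y\<close> becomes a form that vanishes at the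
  generic point, hence a multiple of the equation of the curve; so it cannot have a smaller bidegree.\<close>

lemma generic_point_plane_model:
  fixes \<iota> :: "'a::alg_closed_field \<Rightarrow> 'b::field"
  assumes hom: "rhom \<iota>" and gp: "generic_point \<iota> k a \<Gamma> \<xi> \<eta>" and cu: "curve_of_type k a \<Gamma>"
    and ka: "k > 0" "a > 0" and det: "fdet A \<noteq> 0" "fdet B \<noteq> 0"
    and x: "proportional (rep_P1 \<xi>) (frm \<iota> A x)" and y: "proportional (rep_P1 \<eta>) (frm \<iota> B y)"
  shows "plane_model \<iota> (function_field \<iota> \<xi> \<eta>) k a (frame_equation k a \<Gamma> A B) x y"
proof -
  obtain u0 u1 e0 e1 where A: "A = ((u0, u1), (e0, e1))" by (metis surj_pair)
  obtain v0 v1 f0 f1 where B: "B = ((v0, v1), (f0, f1))" by (metis surj_pair)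
  define dA where "dA = u0 * e1 - u1 * e0"
  define dB where "dB = v0 * f1 - v1 * f0"
  have dnz: "dA \<noteq> 0" "dB \<noteq> 0" using det by (auto simp: fdet_def A B dA_def dB_def)
  have ge: "eval_form \<iota> m n G (rep_P1 \<xi>) (rep_P1 \<eta>) = 0 \<longleftrightarrow> form_dvd k a \<Gamma> m n G" if "biform m n G" for m n G
    using gp that by (simp add: generic_point_def)
  obtain \<xi>0 \<xi>1 where xi: "rep_P1 \<xi> = (\<xi>0, \<xi>1)" by (cases "rep_P1 \<xi>")
  obtain \<eta>0 \<eta>1 where eta: "rep_P1 \<eta> = (\<eta>0, \<eta>1)" by (cases "rep_P1 \<eta>")
  have xi0: "\<xi>0 \<noteq> 0"
  proof
    assume "\<xi>0 = 0"
    then have "form_dvd k a \<Gamma> 1 0 1"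
      using hom by (subst ge[symmetric]) (auto simp: biform_def one_pCons coeff_pCons eval_form_def xi rhom_simps split: nat.splits)
    then show False using ka by (auto simp: form_dvd_def)
  qed
  have eta0: "\<eta>0 \<noteq> 0"
  proof
    assume "\<eta>0 = 0"
    then have "form_dvd k a \<Gamma> 0 1 1"
      using hom by (subst ge[symmetric]) (auto simp: biform_def one_pCons coeff_pCons eval_form_def eta rhom_simps split: nat.splits)
    then show False using ka by (auto simp: form_dvd_def)
  qed
  obtain c where c: "c \<noteq> 0" "\<xi>0 = c * (\<iota> u0 + x * \<iota> e0)" "\<xi>1 = c * (\<iota> u1 + x * \<iota> e1)"
    using x by (auto simp: proportional_def xi frm_def A)
  obtain d where d: "d \<noteq> 0" "\<eta>0 = d * (\<iota> v0 + y * \<iota> f0)" "\<eta>1 = d * (\<iota> v1 + y * \<iota> f1)"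
    using y by (auto simp: proportional_def eta frm_def B)
  have to_frame: "eval_form \<iota> m n G (rep_P1 \<xi>) (rep_P1 \<eta>)
     = c ^ m * d ^ n * ev \<iota> x y (frame_equation m n G A B)" for m n G
    using eval_form_scale[of \<iota> m n G c "\<iota> u0 + x * \<iota> e0" "\<iota> u1 + x * \<iota> e1" d]
    by (simp add: ev_frame_equation[OF hom] frm_def A B xi eta c(2,3) d(2,3))
  \<comment> \<open>The inverse change of coordinates, up to constants: the equation in the dual frames.\<close>
  define A' where "A' = ((e1, - u1), (- e0, u0))"
  define B' where "B' = ((f1, - v1), (- f0, v0))"
  have det': "fdet A' \<noteq> 0" "fdet B' \<noteq> 0"
    using dnz by (simp_all add: fdet_def A'_def B'_def dA_def dB_def mult.commute)
  define bk where "bk m n G = frame_equation m n G A' B'" for m n G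
  have bk_biform: "biform m n (bk m n G)" for m n G
    unfolding bk_def by (rule biform_frame_equation)
  have bk_ev: "ev \<iota> X Y (bk m n G) = eval_form \<iota> m n G
     (\<iota> e1 - X * \<iota> e0, X * \<iota> u0 - \<iota> u1) (\<iota> f1 - Y * \<iota> f0, Y * \<iota> v0 - \<iota> v1)" for X Y m n G
    unfolding bk_def by (simp add: ev_frame_equation[OF hom] frm_def A'_def B'_def rhom_minus[OF hom])
  define s where "s m n = \<xi>0 ^ m * \<eta>0 ^ n * ((c * \<iota> dA / \<xi>0) ^ m * (d * \<iota> dB / \<eta>0) ^ n)" for m n
  have s: "s m n \<noteq> 0" for m n
    using xi0 eta0 c d dnz hom by (simp add: s_def rhom_eq_0_iff)
  have from_frame: "eval_form \<iota> m n (bk m n G) (rep_P1 \<xi>) (rep_P1 \<eta>) = s m n * ev \<iota> x y G"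
    if "biform m n G" for m n G
  proof -
    have xx: "\<iota> e1 - \<xi>1 / \<xi>0 * \<iota> e0 = (c * \<iota> dA / \<xi>0) * 1" "\<xi>1 / \<xi>0 * \<iota> u0 - \<iota> u1 = (c * \<iota> dA / \<xi>0) * x"
      using xi0 by (simp_all add: divide_simps) (simp_all add: c(2,3) dA_def rhom_simps[OF hom] algebra_simps)
    have yy: "\<iota> f1 - \<eta>1 / \<eta>0 * \<iota> f0 = (d * \<iota> dB / \<eta>0) * 1" "\<eta>1 / \<eta>0 * \<iota> v0 - \<iota> v1 = (d * \<iota> dB / \<eta>0) * y"
      using eta0 by (simp_all add: divide_simps) (simp_all add: d(2,3) dB_def rhom_simps[OF hom] algebra_simps)
    have "eval_form \<iota> m n (bk m n G) (rep_P1 \<xi>) (rep_P1 \<eta>)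
       = eval_form \<iota> m n (bk m n G) (\<xi>0 * 1, \<xi>0 * (\<xi>1 / \<xi>0)) (\<eta>0 * 1, \<eta>0 * (\<eta>1 / \<eta>0))"
      using xi0 eta0 by (simp add: xi eta)
    also have "\<dots> = \<xi>0 ^ m * \<eta>0 ^ n * ev \<iota> (\<xi>1 / \<xi>0) (\<eta>1 / \<eta>0) (bk m n G)"
      by (simp only: eval_form_scale eval_form_affine[OF hom bk_biform])
    also have "\<dots> = \<xi>0 ^ m * \<eta>0 ^ n * ((c * \<iota> dA / \<xi>0) ^ m * (d * \<iota> dB / \<eta>0) ^ n * ev \<iota> x y G)"
      by (simp only: bk_ev xx yy eval_form_scale eval_form_affine[OF hom that])
    finally show ?thesis by (simp add: s_def)
  qed
  have ind: "G = 0" if bi: "biform m n G" and mn: "m < k \<or> n < a" and 0: "ev \<iota> x y G = 0" for m n G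
  proof -
    have "form_dvd k a \<Gamma> m n (bk m n G)"
      using ge[OF bk_biform[of m n G]] from_frame[OF bi] 0 by simp
    then have "bk m n G = 0" using mn by (auto simp: form_dvd_def)
    then show ?thesis using frame_equation_zero[OF bi det'] by (simp add: bk_def)
  qed
  have zer: "ev \<iota> x y (frame_equation k a \<Gamma> A B) = 0"
  proof -
    have "form_dvd k a \<Gamma> k a \<Gamma>" using cu
      unfolding form_dvd_def curve_of_type_def by (intro disjI2 exI[of _ 0] exI[of _ 1]) auto
    then have "eval_form \<iota> k a \<Gamma> (rep_P1 \<xi>) (rep_P1 \<eta>) = 0" using ge cu by (simp add: curve_of_type_def)
    then show ?thesis using c d by (simp add: to_frame)
  qed
  have nzero: "frame_equation k a \<Gamma> A B \<noteq> 0"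
    using frame_equation_zero[OF _ det] cu by (auto simp: curve_of_type_def)
  have field: "function_field \<iota> \<xi> \<eta> = {ev \<iota> x y G / ev \<iota> x y H | G H. ev \<iota> x y H \<noteq> 0}"
  proof (intro equalityI subsetI)
    fix z assume "z \<in> function_field \<iota> \<xi> \<eta>"
    then obtain m n G H where z: "z = eval_form \<iota> m n G (rep_P1 \<xi>) (rep_P1 \<eta>) / eval_form \<iota> m n H (rep_P1 \<xi>) (rep_P1 \<eta>)"
      "eval_form \<iota> m n H (rep_P1 \<xi>) (rep_P1 \<eta>) \<noteq> 0"
      by (auto simp: function_field_def)
    then have "z = ev \<iota> x y (frame_equation m n G A B) / ev \<iota> x y (frame_equation m n H A B)"
      "ev \<iota> x y (frame_equation m n H A B) \<noteq> 0"
      using c d by (simp_all add: to_frame)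
    then show "z \<in> {ev \<iota> x y G / ev \<iota> x y H | G H. ev \<iota> x y H \<noteq> 0}" by blast
  next
    fix z assume "z \<in> {ev \<iota> x y G / ev \<iota> x y H | G H. ev \<iota> x y H \<noteq> 0}"
    then obtain G H where z: "z = ev \<iota> x y G / ev \<iota> x y H" "ev \<iota> x y H \<noteq> 0" by auto
    obtain n1 n2 where n: "biform (degree G) n1 G" "biform (degree H) n2 H" using biform_ex by metis
    define m n where "m = max (degree G) (degree H)" and "n = max n1 n2"
    have b: "biform m n G" "biform m n H" using n by (auto simp: m_def n_def intro: biform_mono)
    have "z = eval_form \<iota> m n (bk m n G) (rep_P1 \<xi>) (rep_P1 \<eta>) / eval_form \<iota> m n (bk m n H) (rep_P1 \<xi>) (rep_P1 \<eta>)"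
      "eval_form \<iota> m n (bk m n H) (rep_P1 \<xi>) (rep_P1 \<eta>) \<noteq> 0"
      using z s by (simp_all add: from_frame[OF b(1)] from_frame[OF b(2)])
    then show "z \<in> function_field \<iota> \<xi> \<eta>" unfolding function_field_def using bk_biform by blast
  qed
  show ?thesis
    by unfold_locales (use hom biform_frame_equation[of k a \<Gamma> A B] nzero zer ind field ka in auto)
qed

section \<open>Smooth points and nodes in arbitrary frames\<close>

lemma affine_chart_frm:
  assumes "rhom h"
  shows "affine_chart h p t = frm h (p, if fst p \<noteq> 0 then (0, 1) else (1, 0)) t"
  by (auto simp: affine_chart_def frm_def rhom_simps[OF assms])

text \<open>The charts that define the local equation are themselves frames, so that nodes can be
  transported to any other frame with the same base point.\<close>

lemma local_equation_frame:
  obtains e e' where "fdet (rep_P1 P, e) \<noteq> 0" "fdet (rep_P1 Q, e') \<noteq> 0"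
    "local_equation m n F (P, Q) = frame_equation m n F (rep_P1 P, e) (rep_P1 Q, e')"
proof -
  define e :: "'a P1 \<Rightarrow> 'a \<times> 'a" where "e P = (if fst (rep_P1 P) \<noteq> 0 then (0, 1) else (1, 0))" for P
  have "fdet (rep_P1 P, e P) \<noteq> 0" for P
    using rep_P1_nonzero[of P] by (cases "rep_P1 P") (auto simp: fdet_def e_def)
  moreover have "local_equation m n F (P, Q) = frame_equation m n F (rep_P1 P, e P) (rep_P1 Q, e Q)"
    by (simp add: local_equation_def frame_equation_def affine_chart_frm[OF rhom_cst] e_def)
  ultimately show thesis using that by blast
qed

text \<open>Two frames with the same base point differ by \<open>X \<mapsto> m X / (l + n X)\<close>. The identity is checked on
  values, where the denominators are nonzero.\<close>

lemma frame_change: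
  fixes G :: "'a::alg_closed_field poly poly"
  assumes lm: "l \<noteq> 0" "l' \<noteq> 0"
    and A': "A' = ((l * u0, l * u1), (m * e0 + n * u0, m * e1 + n * u1))"
    and B': "B' = ((l' * v0, l' * v1), (m' * f0 + n' * v0, m' * f1 + n' * v1))"
  shows "frame_equation k a G A' B' = eval_form cst k a
    (frame_equation k a G ((u0, u1), (e0, e1)) ((v0, v1), (f0, f1)))
    ([:[:l:], [:n:]:], [:0, [:m:]:]) ([:[:l', n':]:], [:[:0, m':]:])" (is "_ = eval_form cst k a ?f _ _")
proof (rule polypoly_eq_if_cofinite)
  show "finite {X. l + n * X = 0}" "finite {Y. l' + n' * Y = 0}"
    using lm poly_roots_finite[of "[:l, n:]"] poly_roots_finite[of "[:l', n':]"]
    by (fastforce simp: mult.commute)+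
  fix X Y assume "X \<notin> {X. l + n * X = 0}" "Y \<notin> {Y. l' + n' * Y = 0}"
  then have X: "l + n * X \<noteq> 0" and Y: "l' + n' * Y \<noteq> 0" by auto
  define x y where "x = m * X / (l + n * X)" and "y = m' * Y / (l' + n' * Y)"
  have xx: "m * X = (l + n * X) * x" "m' * Y = (l' + n' * Y) * y" using X Y by (simp_all add: x_def y_def)
  have "ev id X Y (frame_equation k a G A' B')
     = eval_form id k a G ((l + n * X) * (u0 + x * e0), (l + n * X) * (u1 + x * e1))
                          ((l' + n' * Y) * (v0 + y * f0), (l' + n' * Y) * (v1 + y * f1))"
  proof -
    have "l * u0 + X * (m * e0 + n * u0) = (l + n * X) * (u0 + x * e0)"
         "l * u1 + X * (m * e1 + n * u1) = (l + n * X) * (u1 + x * e1)"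
         "l' * v0 + Y * (m' * f0 + n' * v0) = (l' + n' * Y) * (v0 + y * f0)"
         "l' * v1 + Y * (m' * f1 + n' * v1) = (l' + n' * Y) * (v1 + y * f1)"
      using xx by algebra+
    then show ?thesis by (simp add: ev_frame_equation[OF rhom_id(1)] frm_def A' B')
  qed
  also have "\<dots> = (l + n * X) ^ k * (l' + n' * Y) ^ a * ev id x y ?f"
    by (simp add: eval_form_scale ev_frame_equation[OF rhom_id(1)] frm_def)
  also have "\<dots> = eval_form id k a ?f ((l + n * X) * 1, (l + n * X) * x) ((l' + n' * Y) * 1, (l' + n' * Y) * y)"
    by (simp only: eval_form_scale eval_form_affine[OF rhom_id(1) biform_frame_equation])
  also have "\<dots> = ev id X Y (eval_form cst k a ?f ([:[:l:], [:n:]:], [:0, [:m:]:]) ([:[:l', n':]:], [:[:0, m':]:]))"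
    by (simp add: ev_eval_form[OF rhom_id(1)] rhom_id pev_id mult.commute[of X] mult.commute[of Y] xx)
  finally show "ev id X Y (frame_equation k a G A' B') = 
    ev id X Y (eval_form cst k a ?f ([:[:l:], [:n:]:], [:0, [:m:]:]) ([:[:l', n':]:], [:[:0, m':]:]))" .
qed

definition cf :: "'a::zero poly poly \<Rightarrow> nat \<Rightarrow> nat \<Rightarrow> 'a" where
  "cf f i j = coeff (coeff f i) j"

lemma cf_separated:
  fixes P Q :: "'a::comm_ring_1 poly"
  shows "cf (map_poly (\<lambda>c. [:c:]) P * [:Q:]) p q = coeff P p * coeff Q q"
  by (simp add: cf_def coeff_map_poly mult.commute)

lemma coeff_lin_power:
  "coeff ([:l, n:] ^ r * [:0, m:] ^ i) p = (if p < i then 0 else m ^ i * coeff ([:l, n:] ^ r) (p - i))"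
  for l n m :: "'a::comm_ring_1"
proof -
  have "[:0, m:] ^ i = monom (m ^ i) i"
    using monom_power[of m "Suc 0" i] by (simp add: monom_Suc monom_0)
  then show ?thesis by (simp add: coeff_monom_mult mult.commute[of "_ ^ r"])
qed

text \<open>Under such a substitution the coefficient at \<open>X\<^sup>p Y\<^sup>q\<close> depends only on the coefficients of the old equation
  at monomials that divide \<open>X\<^sup>p Y\<^sup>q\<close>; so the lowest terms are only rescaled.\<close>

lemma cf_substitution:
  fixes f :: "'a::field poly poly"
  shows "cf (eval_form cst k a f ([:[:l:], [:n:]:], [:0, [:m:]:]) ([:[:l', n':]:], [:[:0, m':]:])) p q
    = (\<Sum>i\<le>min k p. \<Sum>j\<le>min a q. cf f i j * (m ^ i * coeff ([:l, n:] ^ (k - i)) (p - i))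
                                    * (m' ^ j * coeff ([:l', n':] ^ (a - j)) (q - j)))"
proof -
  let ?e = "map_poly (\<lambda>c::'a. [:c:])"
  note e = rhom_simps[OF rhom_map_poly[OF rhom_const_poly]]
  have lin: "[:[:l:], [:n:]:] = ?e [:l, n:]" "[:0, [:m:]:] = ?e [:0, m:]"
    by (simp_all add: map_poly_pCons)
  have trm: "cf ([:[:c:]:] * [:[:l:], [:n:]:] ^ (k - i) * [:0, [:m:]:] ^ i * [:[:l', n':]:] ^ (a - j) * [:[:0, m':]:] ^ j) p q
     = c * coeff ([:l, n:] ^ (k - i) * [:0, m:] ^ i) p * coeff ([:l', n':] ^ (a - j) * [:0, m':] ^ j) q" for c i j
  proof -
    have "[:[:c:]:] * [:[:l:], [:n:]:] ^ (k - i) * [:0, [:m:]:] ^ i * [:[:l', n':]:] ^ (a - j) * [:[:0, m':]:] ^ j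
      = ?e ([:c:] * ([:l, n:] ^ (k - i) * [:0, m:] ^ i)) * [:[:l', n':] ^ (a - j) * [:0, m':] ^ j:]"
      unfolding lin by (simp only: e rhom_simps[OF rhom_const_poly]) (simp add: map_poly_pCons mult_ac)
    then show ?thesis by (simp only: cf_separated) simp
  qed
  have "cf (eval_form cst k a f ([:[:l:], [:n:]:], [:0, [:m:]:]) ([:[:l', n':]:], [:[:0, m':]:])) p q
    = (\<Sum>i\<le>k. \<Sum>j\<le>a. cf f i j * coeff ([:l, n:] ^ (k - i) * [:0, m:] ^ i) p * coeff ([:l', n':] ^ (a - j) * [:0, m':] ^ j) q)"
    unfolding eval_form_def fst_conv snd_conv trm[symmetric] by (simp add: cf_def coeff_sum)
  also have "\<dots> = (\<Sum>i\<le>min k p. \<Sum>j\<le>a. cf f i j * coeff ([:l, n:] ^ (k - i) * [:0, m:] ^ i) p * coeff ([:l', n':] ^ (a - j) * [:0, m':] ^ j) q)"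
    by (intro sum.mono_neutral_right) (auto simp: coeff_lin_power)
  also have "\<dots> = (\<Sum>i\<le>min k p. \<Sum>j\<le>min a q. cf f i j * coeff ([:l, n:] ^ (k - i) * [:0, m:] ^ i) p * coeff ([:l', n':] ^ (a - j) * [:0, m':] ^ j) q)"
    by (rule sum.cong[OF refl], rule sum.mono_neutral_right) (auto simp: coeff_lin_power)
  also have "\<dots> = (\<Sum>i\<le>min k p. \<Sum>j\<le>min a q. cf f i j * (m ^ i * coeff ([:l, n:] ^ (k - i)) (p - i))
                                    * (m' ^ j * coeff ([:l', n':] ^ (a - j)) (q - j)))"
    by (intro sum.cong refl) (auto simp: coeff_lin_power)
  finally show ?thesis .
qed

definition singular_origin :: "'a::field poly poly \<Rightarrow> bool" where
  "singular_origin f \<longleftrightarrow> cf f 0 0 = 0 \<and> cf f 1 0 = 0 \<and> cf f 0 1 = 0"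

text \<open>The discriminant of the quadratic part detects distinct tangents in every characteristic: for
  \<open>(a s + b t) (c s + d t)\<close> it is \<open>(a d - b c)\<^sup>2\<close>.\<close>

definition node_origin :: "'a::field poly poly \<Rightarrow> bool" where
  "node_origin f \<longleftrightarrow> singular_origin f \<and> (cf f 1 1)^2 - 4 * cf f 2 0 * cf f 0 2 \<noteq> 0"

lemma atMost_small: "{..0::nat} = {0}" "{..Suc 0} = {0, 1}" "{..2::nat} = {0, 1, 2}" by auto

lemma origin_substitution:
  fixes f :: "'a::field poly poly"
  assumes f: "biform k a f" and k: "k \<ge> 2" and a: "a \<ge> 1"
    and nz: "l \<noteq> 0" "m \<noteq> 0" "l' \<noteq> 0" "m' \<noteq> 0"
    and f': "f' = eval_form cst k a f ([:[:l:], [:n:]:], [:0, [:m:]:]) ([:[:l', n':]:], [:[:0, m':]:])"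
  shows "cf f' 0 0 = 0 \<longleftrightarrow> cf f 0 0 = 0"
    and "singular_origin f' \<longleftrightarrow> singular_origin f"
    and "node_origin f \<Longrightarrow> node_origin f'"
proof -
  note s = cf_substitution[of k a f l n m l' n' m', folded f']
  have c00: "cf f' 0 0 = cf f 0 0 * l ^ k * l' ^ a"
    by (simp add: s coeff_0_power)
  then show 00: "cf f' 0 0 = 0 \<longleftrightarrow> cf f 0 0 = 0" using nz by simp
  have c10: "cf f' 1 0 = cf f 1 0 * (m * l ^ (k - 1)) * l' ^ a" if "cf f 0 0 = 0"
    using k that by (simp add: s coeff_0_power min_def atMost_small)
  have c01: "cf f' 0 1 = cf f 0 1 * (m' * l' ^ (a - 1)) * l ^ k" if "cf f 0 0 = 0"
    using a that by (simp add: s coeff_0_power min_def atMost_small mult_ac)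
  show sing: "singular_origin f' \<longleftrightarrow> singular_origin f"
    unfolding singular_origin_def using 00 c10 c01 nz by auto
  assume node: "node_origin f"
  then have z: "cf f 0 0 = 0" "cf f 1 0 = 0" "cf f 0 1 = 0"
    and d: "(cf f 1 1)^2 - 4 * cf f 2 0 * cf f 0 2 \<noteq> 0" by (auto simp: node_origin_def singular_origin_def)
  have c20: "cf f' 2 0 = cf f 2 0 * (m ^ 2 * l ^ (k - 2)) * l' ^ a"
    using k z by (simp add: s coeff_0_power min_def atMost_small)
  have c11: "cf f' 1 1 = cf f 1 1 * (m * l ^ (k - 1)) * (m' * l' ^ (a - 1))"
    using k a z by (simp add: s coeff_0_power min_def atMost_small)
  have c02: "cf f' 0 2 = cf f 0 2 * l ^ k * (m' ^ 2 * l' ^ (a - 2))"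
  proof (cases "a = 1")
    case True
    have "degree (coeff f 0) \<le> 1" using f True by (simp add: biform_def)
    then have "cf f 0 2 = 0" by (simp add: cf_def coeff_eq_0)
    then show ?thesis using z True by (simp add: s min_def atMost_small)
  next
    case False
    then have "min a 2 = 2" using a by simp
    then show ?thesis using z by (simp add: s coeff_0_power atMost_small)
  qed
  have "(cf f' 1 1)^2 - 4 * cf f' 2 0 * cf f' 0 2
     = (m * l ^ (k - 1) * m' * l' ^ (a - 1))^2 * ((cf f 1 1)^2 - 4 * cf f 2 0 * cf f 0 2)"
  proof (cases "a = 1")
    case True
    have "degree (coeff f 0) \<le> 1" using f True by (simp add: biform_def)
    then have "cf f 0 2 = 0" by (simp add: cf_def coeff_eq_0)
    then show ?thesis unfolding c20 c11 c02 by (simp add: power_mult_distrib mult_ac)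
  next
    case False
    obtain k2 where k2: "k = Suc (Suc k2)" using k by (metis Suc_le_D numeral_2_eq_2 Suc_le_mono)
    obtain a2 where a2: "a = Suc (Suc a2)" using a False by (metis Suc_le_D One_nat_def not0_implies_Suc)
    show ?thesis unfolding c20 c11 c02 k2 a2 by (simp add: power2_eq_square algebra_simps)
  qed
  then show "node_origin f'" using d nz sing node by (auto simp: node_origin_def)
qed

lemma cf_00_support:
  fixes F :: "'a::field poly poly"
  shows "cf (local_equation m n F (P, Q)) 0 0 = 0 \<longleftrightarrow> (P, Q) \<in> curve_support m n F"
proof -
  obtain e e' where *: "local_equation m n F (P, Q) = frame_equation m n F (rep_P1 P, e) (rep_P1 Q, e')"
    by (rule local_equation_frame)
  have "cf f 0 0 = ev id 0 0 f" for f :: "'a poly poly" by (simp add: ev_id cf_def poly_0_coeff_0)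
  then show ?thesis unfolding * by (simp add: ev_frame_equation[OF rhom_id(1)] frm_def curve_support_def)
qed

lemma node_local:
  assumes "is_node m n F PQ" shows "node_origin (local_equation m n F PQ)"
proof -
  let ?f = "local_equation m n F PQ"
  from assms obtain a b c d where n: "a * d - b * c \<noteq> 0" "cf ?f 2 0 = a * c" "cf ?f 1 1 = a * d + b * c" "cf ?f 0 2 = b * d"
    and s: "singular_origin ?f"
    unfolding is_node_def is_singular_point_def Let_def cf_def singular_origin_def by blast
  have "(cf ?f 1 1)^2 - 4 * cf ?f 2 0 * cf ?f 0 2 = (a * d - b * c)^2"
    unfolding n by algebra
  then show ?thesis using n(1) s by (simp add: node_origin_def)
qed

lemma frame_rebase:
  assumes "fdet A \<noteq> 0" "fdet A' \<noteq> 0" "fst A' = (l * fst (fst A), l * snd (fst A))"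
  obtains m n where "m \<noteq> 0"
    "A' = ((l * fst (fst A), l * snd (fst A)), (m * fst (snd A) + n * fst (fst A), m * snd (snd A) + n * snd (fst A)))"
proof -
  obtain u0 u1 e0 e1 where A: "A = ((u0, u1), (e0, e1))" by (metis surj_pair)
  obtain g0 g1 where A': "A' = ((l * u0, l * u1), (g0, g1))" using assms(3) by (metis A fst_conv snd_conv surj_pair)
  define d where "d = u0 * e1 - u1 * e0"
  have d: "d \<noteq> 0" using assms(1) by (simp add: d_def fdet_def A)
  define m n where "m = (u0 * g1 - u1 * g0) / d" and "n = (g0 * e1 - g1 * e0) / d"
  have "l * (u0 * g1 - u1 * g0) \<noteq> 0" using assms(2) by (simp add: fdet_def A' algebra_simps)
  then have "m \<noteq> 0" using d by (simp add: m_def)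
  moreover have "d * g0 = d * (m * e0 + n * u0)" "d * g1 = d * (m * e1 + n * u1)"
  proof -
    have "d * m = u0 * g1 - u1 * g0" "d * n = g0 * e1 - g1 * e0" using d by (simp_all add: m_def n_def)
    then show "d * g0 = d * (m * e0 + n * u0)" "d * g1 = d * (m * e1 + n * u1)"
      unfolding d_def by algebra+
  qed
  then have "g0 = m * e0 + n * u0" "g1 = m * e1 + n * u1" using d by simp_all
  ultimately show thesis using that[of m n] by (simp add: A A')
qed

text \<open>The form in which the hypotheses on the singularities are used: they hold in every frame.\<close>

lemma point_in_frame:
  fixes \<Gamma> :: "'a::alg_closed_field poly poly"
  assumes det: "fdet A \<noteq> 0" "fdet B \<noteq> 0" and k: "k \<ge> 2" and a: "a \<ge> 1" and nodal: "nodal_curve k a \<Gamma>"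
    and P: "proportional (fst A) (rep_P1 P)" and Q: "proportional (fst B) (rep_P1 Q)"
    and f: "f = frame_equation k a \<Gamma> A B"
  shows "cf f 0 0 = 0 \<Longrightarrow> (P, Q) \<notin> nodes k a \<Gamma> \<Longrightarrow> \<not> singular_origin f"
    and "(P, Q) \<in> nodes k a \<Gamma> \<Longrightarrow> node_origin f"
proof -
  obtain e e' where fd: "fdet (rep_P1 P, e) \<noteq> 0" "fdet (rep_P1 Q, e') \<noteq> 0"
    and le: "local_equation k a \<Gamma> (P, Q) = frame_equation k a \<Gamma> (rep_P1 P, e) (rep_P1 Q, e')"
    by (rule local_equation_frame)
  define f0 where "f0 = local_equation k a \<Gamma> (P, Q)"
  obtain l l' where l: "l \<noteq> 0" "fst A = (l * fst (rep_P1 P), l * snd (rep_P1 P))"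
    and l': "l' \<noteq> 0" "fst B = (l' * fst (rep_P1 Q), l' * snd (rep_P1 Q))"
    using P Q by (auto simp: proportional_def)
  obtain m n where mn: "m \<noteq> 0" "A = ((l * fst (rep_P1 P), l * snd (rep_P1 P)),
      (m * fst e + n * fst (rep_P1 P), m * snd e + n * snd (rep_P1 P)))"
    using frame_rebase[OF fd(1) det(1)] l by auto
  obtain m' n' where mn': "m' \<noteq> 0" "B = ((l' * fst (rep_P1 Q), l' * snd (rep_P1 Q)),
      (m' * fst e' + n' * fst (rep_P1 Q), m' * snd e' + n' * snd (rep_P1 Q)))"
    using frame_rebase[OF fd(2) det(2)] l' by auto
  have f': "f = eval_form cst k a f0 ([:[:l:], [:n:]:], [:0, [:m:]:]) ([:[:l', n':]:], [:[:0, m':]:])"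
    using frame_change[OF l(1) l'(1) mn(2) mn'(2)] by (simp add: f f0_def le)
  note t = origin_substitution[OF _ k a l(1) mn(1) l'(1) mn'(1) f', unfolded f0_def le, OF biform_frame_equation, folded le]
  have sup: "cf (local_equation k a \<Gamma> (P, Q)) 0 0 = 0 \<longleftrightarrow> (P, Q) \<in> curve_support k a \<Gamma>"
    by (rule cf_00_support)
  have sing: "is_singular_point k a \<Gamma> (P, Q) \<longleftrightarrow> singular_origin (local_equation k a \<Gamma> (P, Q))"
    by (simp add: is_singular_point_def singular_origin_def cf_def Let_def)
  show "\<not> singular_origin f" if "cf f 0 0 = 0" "(P, Q) \<notin> nodes k a \<Gamma>"
    using that nodal sup sing t(1,2) by (auto simp: nodes_def nodal_curve_def)
  show "node_origin f" if "(P, Q) \<in> nodes k a \<Gamma>"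
    using that by (intro t(3) node_local) (auto simp: nodes_def)
qed

section \<open>Hensel's lemma for power series\<close>

lemma poly_diff_multiple:
  fixes h :: "'c::comm_ring_1 poly"
  obtains r where "poly h x - poly h y = (x - y) * r"
proof -
  have "\<exists>r. poly h x - poly h y = (x - y) * r"
  proof (induction h)
    case (pCons c h)
    then obtain r where r: "poly h x - poly h y = (x - y) * r" by auto
    have "poly (pCons c h) x - poly (pCons c h) y = (x - y) * poly h x + y * (poly h x - poly h y)"
      by (simp add: algebra_simps)
    also have "\<dots> = (x - y) * (poly h x + y * r)" unfolding r by (simp add: algebra_simps)
    finally show ?case by blast
  qed (auto intro: exI[of _ 0])
  then show thesis using that by blast
qed

lemma poly_taylor2:
  fixes h :: "'c::idom poly"
  obtains r where "poly h (x + q) = poly h x + q * poly (pderiv h) x + q ^ 2 * r"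
proof -
  have "\<exists>r. poly h (x + q) = poly h x + q * poly (pderiv h) x + q ^ 2 * r"
  proof (induction h)
    case (pCons c h)
    then obtain r where r: "poly h (x + q) = poly h x + q * poly (pderiv h) x + q ^ 2 * r" by auto
    have "poly (pCons c h) (x + q) = poly (pCons c h) x + q * poly (pderiv (pCons c h)) x
        + q ^ 2 * (poly (pderiv h) x + x * r + q * r)"
      unfolding poly_pCons pderiv_pCons poly_add r by (simp add: power2_eq_square algebra_simps)
    then show ?case by blast
  qed (auto intro: exI[of _ 0])
  then show thesis using that by blast
qed

text \<open>Newton approximation, one coefficient at a time: changing \<open>s\<close> by \<open>c X\<^sup>n\<close> changes the coefficient of
  \<open>h(s)\<close> at \<open>X\<^sup>n\<close> by \<open>c\<close> times the nonzero constant term of the derivative.\<close>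

lemma fps_hensel:
  fixes h :: "'a::field fps poly"
  assumes root: "poly h (fps_const c) $ 0 = 0" and simple: "poly (pderiv h) (fps_const c) $ 0 \<noteq> 0"
  obtains s where "poly h s = 0" "s $ 0 = c"
proof -
  define d where "d = poly (pderiv h) (fps_const c) $ 0"
  define S where "S = rec_nat (fps_const c)
    (\<lambda>n s. s + fps_const (- (poly h s $ Suc n) / d) * fps_X ^ Suc n)"
  have S0: "S 0 = fps_const c" by (simp add: S_def)
  have SS: "S (Suc n) = S n + fps_const (- (poly h (S n) $ Suc n) / d) * fps_X ^ Suc n" for n
    by (simp add: S_def)
  have SS_nth: "S (Suc n) $ j = S n $ j" if "j \<le> n" for n j
    using that by (simp add: SS fps_X_power_mult_right_nth del: power_Suc)
  have S_nth: "S n $ j = S j $ j" if "j \<le> n" for n j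
    using that by (induction n rule: dec_induct) (simp_all add: SS_nth)
  have S_0: "S n $ 0 = c" for n using S_nth[of 0 n] by (simp add: S0)
  have deriv: "poly (pderiv h) (S n) $ 0 = d" for n
  proof -
    obtain r where "poly (pderiv h) (S n) - poly (pderiv h) (fps_const c) = (S n - fps_const c) * r"
      by (rule poly_diff_multiple)
    then have "(poly (pderiv h) (S n) - poly (pderiv h) (fps_const c)) $ 0 = ((S n - fps_const c) * r) $ 0" by simp
    then show ?thesis by (simp add: S_0 d_def)
  qed
  have approx: "poly h (S n) $ j = 0" if "j \<le> n" for n j
    using that
  proof (induction n arbitrary: j)
    case 0
    then show ?case using root by (simp add: S0)
  next
    case (Suc n)
    define q where "q = fps_const (- (poly h (S n) $ Suc n) / d) * fps_X ^ Suc n"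
    have q_nth: "q $ i = (if i = Suc n then - (poly h (S n) $ Suc n) / d else 0)" for i
      by (simp add: q_def fps_X_power_mult_right_nth del: power_Suc)
    obtain r where r: "poly h (S n + q) = poly h (S n) + q * poly (pderiv h) (S n) + q ^ 2 * r"
      by (rule poly_taylor2)
    have "(q * (q * r)) $ j = 0"
    proof -
      have "(q * r) $ 0 = 0" by (simp add: q_nth)
      then show ?thesis using Suc.prems
        unfolding fps_mult_nth by (intro sum.neutral) (auto simp: q_nth)
    qed
    moreover have "(q * poly (pderiv h) (S n)) $ j = (if j = Suc n then - (poly h (S n) $ Suc n) else 0)"
    proof -
      have "(q * poly (pderiv h) (S n)) $ j = (\<Sum>i=0..j. if i = Suc n then - (poly h (S n) $ Suc n) / d * poly (pderiv h) (S n) $ (j - i) else 0)"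
        unfolding fps_mult_nth by (intro sum.cong) (auto simp: q_nth)
      also have "\<dots> = (if j = Suc n then - (poly h (S n) $ Suc n) else 0)"
        using Suc.prems simple by (auto simp: deriv d_def[symmetric] le_Suc_eq intro!: sum.neutral)
      finally show ?thesis .
    qed
    ultimately have "poly h (S (Suc n)) $ j = poly h (S n) $ j + (if j = Suc n then - (poly h (S n) $ Suc n) else 0)"
      unfolding SS q_def[symmetric] r by (simp add: power2_eq_square mult.assoc)
    then show ?case using Suc by (cases "j = Suc n") auto
  qed
  define s where "s = Abs_fps (\<lambda>n. S n $ n)"
  have "poly h s $ n = 0" for n
  proof -
    obtain r where r: "poly h s - poly h (S n) = (s - S n) * r" by (rule poly_diff_multiple)
    have "(poly h s - poly h (S n)) $ n = 0"
      unfolding r fps_mult_nth by (intro sum.neutral) (auto simp: s_def S_nth[of _ n])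
    then show ?thesis by (simp add: approx)
  qed
  then have "poly h s = 0" by (simp add: fps_eq_iff)
  moreover have "s $ 0 = c" by (simp add: s_def S0)
  ultimately show thesis by (rule that)
qed

section \<open>Places of the function field from power series solutions\<close>

lemma rhom_fps_nth_0: "rhom (\<lambda>f :: 'a::comm_ring_1 fps. f $ 0)"
  by (simp add: rhom_def)

lemma pev_fps_nth_0: "pev fps_const T p $ 0 = poly p (T $ 0)" for T :: "'a::comm_ring_1 fps"
  using rhom_pev_comp[OF rhom_fps_nth_0 rhom_fps_const, of T p] by (simp add: pev_id)

lemma ev_fps_nth_0: "ev fps_const X T G $ 0 = ev id (X $ 0) (T $ 0) G" for T :: "'a::comm_ring_1 fps"
  using rhom_ev_comp[OF rhom_fps_nth_0 rhom_fps_const, of X T G] by (simp add: id_def)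

lemma pev_fps_nonzero:
  fixes T :: "'a::field fps"
  assumes "T \<noteq> 0" "T $ 0 = 0" "p \<noteq> 0"
  shows "pev fps_const T p \<noteq> 0"
proof -
  obtain q where q: "p = [:- 0, 1:] ^ order 0 p * q" "\<not> [:- 0, 1:] dvd q"
    using order_decomp[OF assms(3), of 0] by blast
  have "poly q 0 \<noteq> 0" using q(2) by (simp add: poly_eq_0_iff_dvd)
  then have "pev fps_const T q $ 0 \<noteq> 0" using assms(2) by (simp add: pev_fps_nth_0)
  then have 1: "pev fps_const T q \<noteq> 0" by auto
  note h = rhom_simps[OF rhom_pev[OF rhom_fps_const]]
  have "pev fps_const T p = T ^ order 0 p * pev fps_const T q"
    by (subst q(1)) (simp add: h rhom_fps_const)
  then show ?thesis using 1 assms(1) by simp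
qed

text \<open>Valuations take the default value \<open>0\<close> at \<open>0\<close>; the relation \<open>vge\<close> treats \<open>0\<close> as having infinite order, so that
  it is preserved by sums.\<close>

definition vge :: "('b::field \<Rightarrow> int) \<Rightarrow> 'b \<Rightarrow> int \<Rightarrow> bool" where
  "vge v z n \<longleftrightarrow> z = 0 \<or> n \<le> v z"

context plane_model
begin

lemma pev_nonzero: "p \<noteq> 0 \<Longrightarrow> pev \<iota> y p \<noteq> 0"
  using indep[of 0 "degree p" "[:p:]"] kpos hom by auto

lemma ev_low_degree_nonzero: "degree G < k \<Longrightarrow> G \<noteq> 0 \<Longrightarrow> ev \<iota> x y G \<noteq> 0"
  using biform_ex[of G] indep by blast

lemma x_nonzero: "x \<noteq> 0" and y_nonzero: "y \<noteq> 0"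
proof -
  have "biform 1 0 ([:0, 1:] :: 'a poly poly)" by (auto simp: biform_def coeff_pCons split: nat.splits)
  then have "ev \<iota> x y [:0, 1:] \<noteq> 0" using indep[of 1 0 "[:0, 1:]"] apos by auto
  then show "x \<noteq> 0" using hom by auto
  show "y \<noteq> 0" using pev_nonzero[of "[:0, 1:]"] hom by (auto simp: rhom_0)
qed

lemma reduce:
  obtains A q r where "A \<noteq> 0" "smult A G = \<gamma> * q + r" "degree r < k"
proof -
  obtain A q where *: "A \<noteq> 0" "smult A G = \<gamma> * q + pseudo_mod G \<gamma>"
    and d: "pseudo_mod G \<gamma> = 0 \<or> degree (pseudo_mod G \<gamma>) < degree \<gamma>"
    using pseudo_mod[OF nz, of G] by blast
  have "degree (pseudo_mod G \<gamma>) < k" using d kpos biform by (auto simp: biform_def)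
  then show thesis using that * by blast
qed

text \<open>Elimination of \<open>x\<close>. An element \<open>D\<close> of least \<open>x\<close>-degree in the ideal of \<open>H\<close> and \<open>\<gamma>\<close> pseudo-divides
  both. If \<open>D\<close> involved \<open>x\<close>, the cofactor of \<open>D\<close> in \<open>\<gamma>\<close> would have a degree less than \<open>k\<close>, so it would
  not vanish at \<open>(x, y)\<close>; then \<open>D\<close>, and with it \<open>H\<close>, would vanish there.\<close>

lemma elimination:
  assumes H: "ev \<iota> x y H \<noteq> 0"
  obtains U V C where "C \<noteq> 0" "U * H + V * \<gamma> = [:C:]"
proof -
  note e = rhom_simps[OF rhom_ev[OF hom, of x y]]
  define I where "I = {U * H + V * \<gamma> | U V. True}"
  have "\<gamma> = 0 * H + 1 * \<gamma>" "H = 1 * H + 0 * \<gamma>" by simp_all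
  then have HI: "\<gamma> \<in> I" "H \<in> I" unfolding I_def by blast+
  then have "\<gamma> \<in> I - {0}" using nz by blast
  then obtain D where D: "D \<in> I - {0}" "\<And>E. E \<in> I - {0} \<Longrightarrow> degree D \<le> degree E"
    using arg_min_nat_lemma[of "\<lambda>D. D \<in> I - {0}" \<gamma> degree] by blast
  have D0: "D \<noteq> 0" using D by blast
  obtain U V where UV: "D = U * H + V * \<gamma>" using D(1) by (auto simp: I_def)
  have dvd: "\<exists>A q. A \<noteq> 0 \<and> smult A E = D * q" if "E \<in> I" for E
  proof -
    obtain A q where *: "A \<noteq> 0" "smult A E = D * q + pseudo_mod E D"
      and d: "pseudo_mod E D = 0 \<or> degree (pseudo_mod E D) < degree D"
      using pseudo_mod[OF D0, of E] by blast
    obtain U' V' where E: "E = U' * H + V' * \<gamma>"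
      using \<open>E \<in> I\<close> unfolding I_def by blast
    have "pseudo_mod E D = smult A E - D * q" using * by simp
    also have "\<dots> = (smult A U' - U * q) * H + (smult A V' - V * q) * \<gamma>"
      by (simp add: E UV algebra_simps smult_add_right)
    finally have "pseudo_mod E D \<in> I" unfolding I_def by blast
    then have "pseudo_mod E D = 0" using D(2)[of "pseudo_mod E D"] d by force
    then show ?thesis using * by auto
  qed
  have "degree D = 0"
  proof (rule ccontr)
    assume deg: "degree D \<noteq> 0"
    from HI obtain A q B r where q: "A \<noteq> 0" "smult A \<gamma> = D * q" and r: "B \<noteq> 0" "smult B H = D * r"
      using dvd by metis
    have "q \<noteq> 0" using q nz by auto
    then have "degree \<gamma> = degree D + degree q"
      using q D0 by (metis degree_mult_eq degree_smult_eq)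
    then have "degree q < k" using deg biform by (simp add: biform_def)
    then have "ev \<iota> x y q \<noteq> 0" using \<open>q \<noteq> 0\<close> by (rule ev_low_degree_nonzero)
    moreover have "ev \<iota> x y D * ev \<iota> x y q = 0"
      using arg_cong[OF q(2), of "ev \<iota> x y"] zero by (simp add: e ev_smult[OF hom])
    ultimately have "ev \<iota> x y D = 0" by simp
    then have "pev \<iota> y B * ev \<iota> x y H = 0"
      using arg_cong[OF r(2), of "ev \<iota> x y"] by (simp add: e ev_smult[OF hom])
    then show False using H pev_nonzero[OF r(1)] by simp
  qed
  then obtain C where C: "D = [:C:]" by (rule degree_eq_zeroE)
  then show thesis using that[of C U V] UV D0 by auto
qed

text \<open>A nonconstant power series solution is again a generic point: a polynomial that vanishes at the
  solution but not on the curve would give, by elimination of \<open>x\<close>, a polynomial in \<open>T\<close> alone that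
  vanishes.\<close>

lemma series_zero_iff:
  assumes sol: "ev fps_const X T \<gamma> = 0" and T: "T \<noteq> 0" "T $ 0 = 0"
  shows "ev fps_const X T G = 0 \<longleftrightarrow> ev \<iota> x y G = 0"
proof
  note e = rhom_simps[OF rhom_ev[OF hom, of x y]]
  note s = rhom_simps[OF rhom_ev[OF rhom_fps_const, of X T]]
  assume 0: "ev fps_const X T G = 0"
  show "ev \<iota> x y G = 0"
  proof (rule ccontr)
    assume "ev \<iota> x y G \<noteq> 0"
    then obtain U V C where C: "C \<noteq> 0" "U * G + V * \<gamma> = [:C:]" by (rule elimination)
    have "pev fps_const T C = 0" using arg_cong[OF C(2), of "ev fps_const X T"] 0 sol
      by (simp add: s rhom_fps_const)
    then show False using pev_fps_nonzero[OF T C(1)] by simp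
  qed
next
  note e = rhom_simps[OF rhom_ev[OF hom, of x y]]
  note s = rhom_simps[OF rhom_ev[OF rhom_fps_const, of X T]]
  assume 0: "ev \<iota> x y G = 0"
  obtain A q r where r: "A \<noteq> 0" "smult A G = \<gamma> * q + r" "degree r < k" by (rule reduce)
  have "ev \<iota> x y r = 0" using arg_cong[OF r(2), of "ev \<iota> x y"] 0 zero by (simp add: e ev_smult[OF hom])
  then have "r = 0" using r(3) ev_low_degree_nonzero by blast
  then have "pev fps_const T A * ev fps_const X T G = 0"
    using arg_cong[OF r(2), of "ev fps_const X T"] sol by (simp add: s ev_smult[OF rhom_fps_const])
  then show "ev fps_const X T G = 0" using pev_fps_nonzero[OF T r(1)] by simp
qed

text \<open>So the function field embeds into the Laurent series, and the order of Laurent series restricts to a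
  place, normalized if some function has order one. The last conclusion transfers residues that
  are visible in the power series.\<close>

lemma series_valuation:
  assumes sol: "ev fps_const X T \<gamma> = 0" and T: "T \<noteq> 0" "T $ 0 = 0"
    and unif: "subdegree (ev fps_const X T G1) = 1"
  obtains v where "v \<in> curve_points \<iota> L"
    "\<And>G H. ev \<iota> x y G \<noteq> 0 \<Longrightarrow> ev \<iota> x y H \<noteq> 0 \<Longrightarrow>
       v (ev \<iota> x y G / ev \<iota> x y H) = int (subdegree (ev fps_const X T G)) - int (subdegree (ev fps_const X T H))"
    "\<And>G H r. ev \<iota> x y H \<noteq> 0 \<Longrightarrow> ev fps_const X T G = r * ev fps_const X T H \<Longrightarrow> r $ 0 = 0 \<Longrightarrow>
       vge v (ev \<iota> x y G / ev \<iota> x y H) 1"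
proof -
  let ?e = "ev \<iota> x y" and ?s = "ev fps_const X T"
  note e = rhom_simps[OF rhom_ev[OF hom, of x y]]
  note s = rhom_simps[OF rhom_ev[OF rhom_fps_const, of X T]]
  note iff = series_zero_iff[OF sol T]
  define v where "v z = (if z \<in> L - {0} then
    (THE n. \<exists>G H. ?e G \<noteq> 0 \<and> ?e H \<noteq> 0 \<and> z = ?e G / ?e H \<and> n = int (subdegree (?s G)) - int (subdegree (?s H))) else 0)" for z
  have v: "v (?e G / ?e H) = int (subdegree (?s G)) - int (subdegree (?s H))"
    if nz: "?e G \<noteq> 0" "?e H \<noteq> 0" for G H
  proof -
    have uniq: "int (subdegree (?s G')) - int (subdegree (?s H')) = int (subdegree (?s G)) - int (subdegree (?s H))"
      if "?e G' \<noteq> 0" "?e H' \<noteq> 0" "?e G / ?e H = ?e G' / ?e H'" for G' H'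
    proof -
      have "?e (G * H' - G' * H) = 0" using that nz by (simp add: e field_simps)
      then have "?s G * ?s H' = ?s G' * ?s H" unfolding iff[symmetric] by (simp add: s)
      then have "subdegree (?s G * ?s H') = subdegree (?s G' * ?s H)" by simp
      then have "subdegree (?s G) + subdegree (?s H') = subdegree (?s G') + subdegree (?s H)"
        using that nz by (simp add: iff)
      then show ?thesis by simp
    qed
    have "?e G / ?e H \<in> L - {0}" using nz by (auto simp: L)
    then show ?thesis unfolding v_def if_P[OF \<open>?e G / ?e H \<in> L - {0}\<close>]
      by (intro the_equality) (use nz uniq in blast)+
  qed
  have rep: "\<exists>G H. ?e G \<noteq> 0 \<and> ?e H \<noteq> 0 \<and> z = ?e G / ?e H" if "z \<in> L - {0}" for z
    using that by (auto simp: L)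
  have "v \<in> curve_points \<iota> L"
    unfolding curve_points_def mem_Collect_eq
  proof (intro conjI ballI allI impI)
    show "v z = 0" if "z \<notin> L - {0}" for z using that unfolding v_def by (rule if_not_P)
    fix z z' assume "z \<in> L - {0}" "z' \<in> L - {0}"
    then obtain G H G' H' where z: "?e G \<noteq> 0" "?e H \<noteq> 0" "z = ?e G / ?e H"
      and z': "?e G' \<noteq> 0" "?e H' \<noteq> 0" "z' = ?e G' / ?e H'" using rep by metis
    have sn: "?s G \<noteq> 0" "?s H \<noteq> 0" "?s G' \<noteq> 0" "?s H' \<noteq> 0" using z z' by (simp_all add: iff)
    have "v (z * z') = v (?e (G * G') / ?e (H * H'))" by (simp add: z z' e)
    also have "\<dots> = v z + v z'" using z z' sn by (subst v) (simp_all add: e s v)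
    finally show "v (z * z') = v z + v z'" .
    show "min (v z) (v z') \<le> v (z + z')" if "z + z' \<noteq> 0"
    proof -
      have sum: "z + z' = ?e (G * H' + G' * H) / ?e (H * H')"
        unfolding z(3) z'(3) using z z' by (simp add: e add_frac_eq)
      then have nz: "?e (G * H' + G' * H) \<noteq> 0" using that by auto
      then have "?s (G * H' + G' * H) \<noteq> 0" by (simp only: iff) simp
      then have "min (subdegree (?s G * ?s H')) (subdegree (?s G' * ?s H)) \<le> subdegree (?s (G * H' + G' * H))"
        unfolding s by (rule subdegree_add_ge')
      moreover have "v (z + z') = int (subdegree (?s (G * H' + G' * H))) - int (subdegree (?s (H * H')))"
        unfolding sum using nz z z' by (intro v) (simp_all add: e)
      ultimately show ?thesis using sn v[OF z(1,2)] v[OF z'(1,2)] by (simp add: z z' s)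
    qed
  next
    fix c :: 'a assume c: "c \<noteq> 0"
    have "\<iota> c = ?e [:[:c:]:] / ?e 1" using hom by (simp add: rhom_0 e)
    moreover have "?e [:[:c:]:] \<noteq> 0" using c hom by (simp add: rhom_0 rhom_eq_0_iff)
    moreover from this have "v (?e [:[:c:]:] / ?e 1) = 0"
      by (subst v) (simp_all add: e s rhom_fps_const)
    ultimately show "v (\<iota> c) = 0" by simp
  next
    have "?s G1 \<noteq> 0" using unif by auto
    then have G1: "?e G1 \<noteq> 0" by (simp add: iff)
    have "v (?e G1 / ?e 1) = 1" using G1 by (subst v) (simp_all add: e s unif)
    moreover have "?e 1 \<noteq> 0" by (simp add: e)
    then have "?e G1 / ?e 1 \<in> L" unfolding L by blast
    then have "?e G1 / ?e 1 \<in> L - {0}" using G1 \<open>?e 1 \<noteq> 0\<close> by simp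
    ultimately show "\<exists>t\<in>L - {0}. v t = 1" by blast
  qed
  moreover have "vge v (?e G / ?e H) 1" if "?e H \<noteq> 0" "?s G = r * ?s H" "r $ 0 = 0" for G H r
  proof (cases "?e G = 0")
    case False
    have sn: "?s G \<noteq> 0" "?s H \<noteq> 0" using that(1) False by (simp_all add: iff)
    have "r \<noteq> 0" using sn(1) that(2) by (metis mult_zero_left)
    then have "subdegree r > 0" using that(3) by (simp add: subdegree_eq_0_iff neq0_conv[symmetric])
    moreover have "subdegree (?s G) = subdegree r + subdegree (?s H)" using that(2) sn \<open>r \<noteq> 0\<close> by simp
    ultimately show ?thesis using v[OF False that(1)] by (simp add: vge_def)
  qed (simp add: vge_def)
  ultimately show thesis using that v by blast
qed

end

section \<open>The places over smooth points and over nodes\<close>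

text \<open>\<open>fibre G\<close> is the restriction of \<open>G\<close> to the line \<open>y = 0\<close>.\<close>

definition fibre :: "'a::comm_ring_1 poly poly \<Rightarrow> 'a poly" where
  "fibre = map_poly (\<lambda>p. poly p 0)"

lemma coeff_fibre: "coeff (fibre G) i = cf G i 0"
  by (simp add: fibre_def coeff_map_poly cf_def poly_0_coeff_0)

lemma fibre_0 [simp]: "fibre 0 = 0"
  by (simp add: fibre_def)

lemma fibre_pCons [simp]: "fibre (pCons p G) = pCons (poly p 0) (fibre G)"
  by (simp add: fibre_def map_poly_pCons)

lemma fibre_remainder:
  fixes G :: "'a::comm_ring_1 poly poly"
  obtains G1 where "cf G1 0 0 = cf G 0 1"
    "\<And>(h :: 'a \<Rightarrow> 'c::comm_ring_1) x y. rhom h \<Longrightarrow> ev h x y G = pev h x (fibre G) + y * ev h x y G1"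
proof -
  have "\<exists>G1. cf G1 0 0 = cf G 0 1 \<and>
    (\<forall>(h :: 'a \<Rightarrow> 'c) x y. rhom h \<longrightarrow> ev h x y G = pev h x (fibre G) + y * ev h x y G1)"
  proof (induction G)
    case 0
    show ?case by (intro exI[of _ 0]) (auto simp: cf_def)
  next
    case (pCons p G)
    then obtain G1 where G1: "\<And>(h :: 'a \<Rightarrow> 'c) x y. rhom h \<Longrightarrow> ev h x y G = pev h x (fibre G) + y * ev h x y G1"
      by auto
    obtain c q where p: "p = pCons c q" by (cases p)
    show ?case
    proof (intro exI[of _ "pCons q G1"] conjI allI impI)
      show "cf (pCons q G1) 0 0 = cf (pCons p G) 0 1" by (simp add: cf_def p)
      fix h :: "'a \<Rightarrow> 'c" and x y assume h: "rhom h"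
      show "ev h x y (pCons p G) = pev h x (fibre (pCons p G)) + y * ev h x y (pCons q G1)"
        using h by (simp add: p G1 algebra_simps)
    qed
  qed
  then show thesis using that by blast
qed

text \<open>Polynomials are stored as polynomials in the first variable; this exchanges the roles of the
  variables when the implicit equation has to be solved for the second one.\<close>

lemma ev_as_poly_in_y:
  fixes G :: "'a::idom poly poly" and h :: "'a \<Rightarrow> 'c::idom"
  assumes h: "rhom h"
  obtains H where "\<And>y. poly H y = ev h x y G"
    "poly (pderiv H) 0 = pev h x (map_poly (\<lambda>p. coeff p 1) G)"
proof -
  have "\<exists>H. (\<forall>y. poly H y = ev h x y G) \<and> poly (pderiv H) 0 = pev h x (map_poly (\<lambda>p. coeff p 1) G)"
  proof (induction G)
    case (pCons p G)
    then obtain H where H: "\<And>y. poly H y = ev h x y G" "poly (pderiv H) 0 = pev h x (map_poly (\<lambda>p. coeff p 1) G)" by auto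
    show ?case
    proof (intro exI[of _ "map_poly h p + smult x H"] conjI allI)
      show "poly (map_poly h p + smult x H) y = ev h x y (pCons p G)" for y
        using h by (simp add: H pev_def)
      have "poly (pderiv (map_poly h p)) 0 = h (coeff p 1)"
        using h by (simp add: poly_0_coeff_0 coeff_pderiv coeff_map_poly rhom_0)
      then show "poly (pderiv (map_poly h p + smult x H)) 0 = pev h x (map_poly (\<lambda>p. coeff p 1) (pCons p G))"
        using h by (simp add: pderiv_add pderiv_smult H map_poly_pCons)
    qed
  qed (use h in \<open>auto intro!: exI[of _ 0]\<close>)
  then show thesis using that by blast
qed

lemma ev_as_poly_in_x: "poly (map_poly (pev h y) G) x = ev h x y G"
  by (simp add: ev_def pev_def)

context plane_model
begin

text \<open>If \<open>m\<close> is the multiplicity of the origin in the fibre \<open>y = 0\<close>, then \<open>y\<close> vanishes there to order \<open>m\<close> and \<open>x\<close>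
  to order \<open>1\<close>, except that for \<open>m = 1\<close> the order of \<open>x\<close> is arbitrary and that of \<open>y\<close> is \<open>1\<close>. The
  inequality covers both cases; it says that a power of \<open>x\<close> has at least the order of \<open>y\<close> only if its exponent
  is at least \<open>m\<close>.\<close>

lemma smooth_place:
  assumes on: "cf \<gamma> 0 0 = 0" and smooth: "\<not> singular_origin \<gamma>"
    and fib: "fibre \<gamma> = [:0, 1:] ^ m * h" "poly h 0 \<noteq> 0"
  obtains v where "v \<in> curve_points \<iota> L" "v x > 0" "v y > 0" "(int m - 1) * v x < v y"
proof -
  note e = rhom_simps[OF rhom_ev[OF hom, of x y]]
  note c = rhom_fps_const
  have m: "m > 0"
    using on fib coeff_fibre[of \<gamma> 0] by (cases m) (simp_all add: poly_0_coeff_0)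
  have xy: "x = ev \<iota> x y [:0, 1:] / ev \<iota> x y 1" "y = ev \<iota> x y [:[:0, 1:]:] / ev \<iota> x y 1"
    "ev \<iota> x y [:0, 1:] \<noteq> 0" "ev \<iota> x y [:[:0, 1:]:] \<noteq> 0" "ev \<iota> x y 1 \<noteq> 0"
    using hom x_nonzero y_nonzero by (simp_all add: e rhom_simps rhom_simps[OF rhom_pev[OF hom]])
  have sxy: "ev fps_const X T [:0, 1:] = X" "ev fps_const X T [:[:0, 1:]:] = T" "ev fps_const X T 1 = 1" for X T :: "'a fps"
    using rhom_simps[OF rhom_ev[OF c, of X T]] by (simp_all add: c rhom_simps[OF rhom_pev[OF c]])
  show thesis
  proof (cases "cf \<gamma> 1 0 = 0")
    case False
    define H where "H = map_poly (pev fps_const fps_X) \<gamma>"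
    have 0: "poly H (fps_const 0) $ 0 = 0"
      using on unfolding H_def ev_as_poly_in_x ev_fps_nth_0 by (simp add: ev_id poly_0_coeff_0 cf_def)
    have 1: "poly (pderiv H) (fps_const 0) $ 0 \<noteq> 0"
      using False unfolding H_def
      by (simp add: poly_0_coeff_0 coeff_pderiv coeff_map_poly pev_fps_nth_0 c cf_def)
    obtain s where s: "poly H s = 0" "s $ 0 = 0" by (rule fps_hensel[OF 0 1])
    have sol: "ev fps_const s fps_X \<gamma> = 0" using s by (simp add: H_def ev_as_poly_in_x)
    have X: "(fps_X :: 'a fps) \<noteq> 0" "fps_X $ 0 = (0::'a)" by auto
    have sn: "s \<noteq> 0" using series_zero_iff[OF sol X, of "[:0, 1:]"] xy(3) by (auto simp: sxy)
    have un: "subdegree (ev fps_const s fps_X [:[:0, 1:]:]) = 1" by (simp add: sxy)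
    obtain v where v: "v \<in> curve_points \<iota> L"
      "\<And>G H. ev \<iota> x y G \<noteq> 0 \<Longrightarrow> ev \<iota> x y H \<noteq> 0 \<Longrightarrow>
         v (ev \<iota> x y G / ev \<iota> x y H) = int (subdegree (ev fps_const s fps_X G)) - int (subdegree (ev fps_const s fps_X H))"
      by (rule series_valuation[OF sol X un]) blast
    have vx: "v x = int (subdegree s)" using v(2)[OF xy(3) xy(5), folded xy(1)] by (simp add: sxy)
    have vy: "v y = 1" using v(2)[OF xy(4) xy(5), folded xy(2)] by (simp add: sxy)
    have "m = 1"
    proof (rule ccontr)
      assume "m \<noteq> 1"
      then have "m = Suc (Suc (m - 2))" using m by simp
      then obtain j where j: "m = Suc (Suc j)" ..
      have "coeff (fibre \<gamma>) 1 = 0" unfolding fib j by simp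
      then show False using False by (simp add: coeff_fibre)
    qed
    moreover have "subdegree s > 0" using sn s(2) by (simp add: subdegree_eq_0_iff neq0_conv[symmetric])
    ultimately show thesis using that[OF v(1)] vx vy by simp
  next
    case True
    then have c01: "cf \<gamma> 0 1 \<noteq> 0" using smooth on by (simp add: singular_origin_def)
    obtain H where H: "\<And>y. poly H y = ev fps_const fps_X y \<gamma>"
      "poly (pderiv H) 0 = pev fps_const fps_X (map_poly (\<lambda>p. coeff p 1) \<gamma>)"
      using ev_as_poly_in_y[OF c] by blast
    have 0: "poly H (fps_const 0) $ 0 = 0"
      using on unfolding H ev_fps_nth_0 by (simp add: ev_id poly_0_coeff_0 cf_def)
    have 1: "poly (pderiv H) (fps_const 0) $ 0 \<noteq> 0"
      using c01 unfolding fps_const_0_eq_0 H(2) pev_fps_nth_0 by (simp add: poly_0_coeff_0 coeff_map_poly cf_def)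
    obtain t where t: "poly H t = 0" "t $ 0 = 0" by (rule fps_hensel[OF 0 1])
    have sol: "ev fps_const fps_X t \<gamma> = 0" using t by (simp add: H)
    obtain G1 where G1: "cf G1 0 0 = cf \<gamma> 0 1"
      "\<And>(h :: 'a \<Rightarrow> 'a fps) x y. rhom h \<Longrightarrow> ev h x y \<gamma> = pev h x (fibre \<gamma>) + y * ev h x y G1"
      using fibre_remainder[of \<gamma>] by metis
    define u where "u = pev fps_const fps_X h"
    have u: "u $ 0 \<noteq> 0" using fib by (simp add: u_def pev_fps_nth_0)
    have fibs: "pev fps_const fps_X (fibre \<gamma>) = fps_X ^ m * u"
      unfolding fib u_def by (simp add: rhom_simps[OF rhom_pev[OF c]] c)
    have eq: "t * ev fps_const fps_X t G1 = - (fps_X ^ m * u)"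
      using sol G1(2)[OF c, of fps_X t] unfolding fibs by (simp add: eq_neg_iff_add_eq_0 add.commute)
    have u1: "ev fps_const fps_X t G1 $ 0 \<noteq> 0"
      using c01 G1(1) t(2) by (simp add: ev_fps_nth_0 ev_id poly_0_coeff_0 cf_def)
    have "u \<noteq> 0" "ev fps_const fps_X t G1 \<noteq> 0" using u u1 by auto
    then have tn: "t \<noteq> 0" using eq by auto
    have "subdegree (t * ev fps_const fps_X t G1) = subdegree (fps_X ^ m * u)" unfolding eq by simp
    then have st: "subdegree t = m"
      using tn \<open>u \<noteq> 0\<close> \<open>ev fps_const fps_X t G1 \<noteq> 0\<close> u u1 by (simp add: subdegree_eq_0)
    have un: "subdegree (ev fps_const fps_X t [:0, 1:]) = 1" by (simp add: sxy)
    obtain v where v: "v \<in> curve_points \<iota> L"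
      "\<And>G H. ev \<iota> x y G \<noteq> 0 \<Longrightarrow> ev \<iota> x y H \<noteq> 0 \<Longrightarrow>
         v (ev \<iota> x y G / ev \<iota> x y H) = int (subdegree (ev fps_const fps_X t G)) - int (subdegree (ev fps_const fps_X t H))"
      by (rule series_valuation[OF sol tn t(2) un]) blast
    have vx: "v x = 1" using v(2)[OF xy(3) xy(5), folded xy(1)] by (simp add: sxy)
    have vy: "v y = int m" using v(2)[OF xy(4) xy(5), folded xy(2)] by (simp add: sxy st)
    show thesis using that[OF v(1)] vx vy m by simp
  qed
qed

text \<open>The common part of the two kinds of branches through a node: a branch along which
  \<open>w = \<gamma>(0, y) / (x y)\<close> has residue \<open>c\<close>.\<close>

definition node_branch :: "('b \<Rightarrow> int) \<Rightarrow> 'a \<Rightarrow> bool" where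
  "node_branch v c \<longleftrightarrow> v \<in> curve_points \<iota> L \<and> v x > 0 \<and> v y > 0 \<and>
     vge v (pev \<iota> y (coeff \<gamma> 0) / (x * y) - \<iota> c) 1"

lemma node_branchI:
  assumes sol: "ev fps_const X T \<gamma> = 0" and T: "T \<noteq> 0" "T $ 0 = 0" "X $ 0 = 0"
    and unif: "subdegree X = 1 \<or> subdegree T = 1"
    and r: "pev fps_const T (coeff \<gamma> 0) - fps_const c * (X * T) = r * (X * T)" "r $ 0 = 0"
  obtains v where "node_branch v c" "v x = int (subdegree X)" "v y = int (subdegree T)"
proof -
  note e = rhom_simps[OF rhom_ev[OF hom, of x y]]
  note cc = rhom_fps_const
  note s = rhom_simps[OF rhom_ev[OF cc, of X T]]
  have xy: "x = ev \<iota> x y [:0, 1:] / ev \<iota> x y 1" "y = ev \<iota> x y [:[:0, 1:]:] / ev \<iota> x y 1"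
    "ev \<iota> x y [:0, 1:] \<noteq> 0" "ev \<iota> x y [:[:0, 1:]:] \<noteq> 0" "ev \<iota> x y 1 \<noteq> 0"
    using hom x_nonzero y_nonzero by (simp_all add: e rhom_simps rhom_simps[OF rhom_pev[OF hom]])
  have sxy: "ev fps_const X T [:0, 1:] = X" "ev fps_const X T [:[:0, 1:]:] = T" "ev fps_const X T 1 = 1"
    by (simp_all add: s cc rhom_simps[OF rhom_pev[OF cc]])
  have "X \<noteq> 0" using series_zero_iff[OF sol T(1,2), of "[:0, 1:]"] xy(3) by (auto simp: sxy)
  obtain G1 where G1: "subdegree (ev fps_const X T G1) = 1" using unif sxy(1,2) by metis
  obtain v where v: "v \<in> curve_points \<iota> L"
      "\<And>G H. ev \<iota> x y G \<noteq> 0 \<Longrightarrow> ev \<iota> x y H \<noteq> 0 \<Longrightarrow>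
         v (ev \<iota> x y G / ev \<iota> x y H) = int (subdegree (ev fps_const X T G)) - int (subdegree (ev fps_const X T H))"
      "\<And>G H r. ev \<iota> x y H \<noteq> 0 \<Longrightarrow> ev fps_const X T G = r * ev fps_const X T H \<Longrightarrow> r $ 0 = 0 \<Longrightarrow>
       vge v (ev \<iota> x y G / ev \<iota> x y H) 1"
    by (rule series_valuation[OF sol T(1,2) G1]) blast
  have vx: "v x = int (subdegree X)" using v(2)[OF xy(3) xy(5), folded xy(1)] by (simp add: sxy)
  have vy: "v y = int (subdegree T)" using v(2)[OF xy(4) xy(5), folded xy(2)] by (simp add: sxy)
  define H where "H = [:0, 1:] * [:[:0, 1 :: 'a:]:]"
  define G where "G = [:coeff \<gamma> 0:] - [:[:c:]:] * H"
  have eH: "ev \<iota> x y H = x * y"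
    unfolding H_def e using xy by (simp only: e(1) div_by_1)
  have eG: "ev \<iota> x y G = pev \<iota> y (coeff \<gamma> 0) - \<iota> c * (x * y)"
    unfolding G_def e eH using hom by simp
  have sH: "ev fps_const X T H = X * T" unfolding H_def s sxy by simp
  have sG: "ev fps_const X T G = pev fps_const T (coeff \<gamma> 0) - fps_const c * (X * T)"
    unfolding G_def s sH by (simp add: cc)
  have "vge v (ev \<iota> x y G / ev \<iota> x y H) 1"
    by (rule v(3)[of H G r]) (use r x_nonzero y_nonzero in \<open>simp_all add: eH sG sH\<close>)
  also have "ev \<iota> x y G / ev \<iota> x y H = pev \<iota> y (coeff \<gamma> 0) / (x * y) - \<iota> c"
    using x_nonzero y_nonzero by (simp add: eG eH diff_divide_distrib)
  finally have "vge v (pev \<iota> y (coeff \<gamma> 0) / (x * y) - \<iota> c) 1" .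
  moreover have "subdegree X > 0" "subdegree T > 0"
    using T \<open>X \<noteq> 0\<close> by (simp_all add: subdegree_eq_0_iff neq0_conv[symmetric])
  ultimately have "node_branch v c" unfolding node_branch_def using v(1) vx vy by simp
  then show thesis using that vx vy by blast
qed

text \<open>The equation is \<open>y\<^sup>2 A0 + x y A1 + x\<^sup>2 R = 0\<close>, so \<open>w = y A0 / x = - (A1 + (x / y) R)\<close>. For a root \<open>s0\<close> of the
  quadratic part in \<open>x / y\<close> the residue of \<open>w\<close> is \<open>- (A1(0) + s0 R(0, 0))\<close>, which distinguishes the two
  roots. A branch tangent to the line \<open>y = 0\<close> corresponds to the root at infinity and has residue \<open>0\<close>; it meets
  that line with multiplicity \<open>m - 1\<close>.\<close>

lemma node_places:
  assumes node: "node_origin \<gamma>"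
    and fib: "fibre \<gamma> = [:0, 1:] ^ m * h" "poly h 0 \<noteq> 0"
  obtains v1 v2 c1 c2 where "node_branch v1 c1" "node_branch v2 c2" "c1 \<noteq> c2" "(int m - 2) * v2 x < v2 y"
proof -
  note c = rhom_fps_const
  define al be de where "al = cf \<gamma> 2 0" and "be = cf \<gamma> 1 1" and "de = cf \<gamma> 0 2"
  have z: "cf \<gamma> 0 0 = 0" "cf \<gamma> 1 0 = 0" "cf \<gamma> 0 1 = 0" and disc: "be^2 - 4 * al * de \<noteq> 0"
    using node by (auto simp: node_origin_def singular_origin_def al_def be_def de_def)
  obtain C0 C1 R where g: "\<gamma> = pCons C0 (pCons C1 R)" by (metis pCons_cases)
  obtain A1 where C1: "C1 = pCons 0 A1" using z(2) by (cases C1) (simp add: g cf_def)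
  obtain A0 where C0: "C0 = pCons 0 (pCons 0 A0)"
  proof -
    obtain c0 C0' where 1: "C0 = pCons c0 C0'" by (cases C0)
    obtain c1 C0'' where 2: "C0' = pCons c1 C0''" by (cases C0')
    show thesis using that[of C0''] z(1,3) by (simp add: g cf_def 1 2)
  qed
  have coeffs: "poly A0 0 = de" "poly A1 0 = be" "cf R 0 0 = al" 
    by (simp_all add: al_def be_def de_def g C0 C1 cf_def poly_0_coeff_0 numeral_2_eq_2)
  let ?p = "pev fps_const"
  have evg: "ev fps_const X T \<gamma> = T\<^sup>2 * ?p T A0 + X * T * ?p T A1 + X\<^sup>2 * ev fps_const X T R" for X T :: "'a fps"
    by (simp add: g C0 C1 c power2_eq_square algebra_simps)
  have pc0: "?p T (coeff \<gamma> 0) = T\<^sup>2 * ?p T A0" for T :: "'a fps"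
    by (simp add: g C0 c power2_eq_square algebra_simps)
  have ev_0: "ev fps_const X T R $ 0 = al" if "X $ 0 = 0" "T $ 0 = 0" for X T :: "'a fps"
    using that coeffs(3) by (simp add: ev_fps_nth_0 ev_id poly_0_coeff_0 cf_def)
  have m2: "m \<ge> 2"
  proof (rule ccontr)
    assume "\<not> m \<ge> 2"
    then have "m = 0 \<or> m = 1" by auto
    then have "coeff (fibre \<gamma>) 0 \<noteq> 0 \<or> coeff (fibre \<gamma>) 1 \<noteq> 0" unfolding fib using fib(2) by (auto simp: poly_0_coeff_0)
    then show False using z by (simp add: coeff_fibre)
  qed
  then have "m = Suc (Suc (m - 2))" by simp
  then obtain j where j: "m = Suc (Suc j)" ..
  \<comment> \<open>The substitution \<open>x = s y\<close>: a simple root of the quadratic form gives a branch.\<close>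
  have transversal: "\<exists>v. node_branch v (- (be + s0 * al)) \<and> v y = 1"
    if root: "de + s0 * be + s0\<^sup>2 * al = 0" and simple: "be + 2 * s0 * al \<noteq> 0" for s0
  proof -
    define HR where "HR = pcompose (map_poly (?p fps_X) R) [:0, fps_X:]"
    have HR: "poly HR s = ev fps_const (s * fps_X) fps_X R" for s
      by (simp add: HR_def poly_pcompose ev_as_poly_in_x)
    have HR': "poly (pderiv HR) s $ 0 = 0" for s
      by (simp add: HR_def pderiv_pcompose pderiv_pCons)
    define H where "H = pCons (?p fps_X A0) (pCons (?p fps_X A1) HR)"
    have 0: "poly H (fps_const s0) $ 0 = 0"
      using root by (simp add: H_def pev_fps_nth_0 coeffs HR ev_0 power2_eq_square algebra_simps)
    have 1: "poly (pderiv H) (fps_const s0) $ 0 \<noteq> 0"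
      using simple by (simp add: H_def pderiv_pCons pev_fps_nth_0 coeffs HR HR' ev_0 algebra_simps)
    obtain s where s: "poly H s = 0" "s $ 0 = s0" by (rule fps_hensel[OF 0 1])
    let ?R = "ev fps_const (s * fps_X) fps_X R"
    have eq: "?p fps_X A0 = - (s * (?p fps_X A1 + s * ?R))"
      using s(1) by (simp add: H_def HR eq_neg_iff_add_eq_0)
    have "ev fps_const (s * fps_X) fps_X \<gamma> = fps_X\<^sup>2 * (?p fps_X A0 + s * (?p fps_X A1 + s * ?R))"
      by (simp add: evg power2_eq_square algebra_simps)
    then have sol: "ev fps_const (s * fps_X) fps_X \<gamma> = 0" by (simp add: eq)
    define c0 where "c0 = - (be + s0 * al)"
    define r where "r = - (?p fps_X A1 + s * ?R) - fps_const c0"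
    have X: "(fps_X :: 'a fps) \<noteq> 0" "fps_X $ 0 = (0 :: 'a)" "(s * fps_X) $ 0 = 0"
      "subdegree (s * fps_X) = 1 \<or> subdegree (fps_X :: 'a fps) = 1" by simp_all
    have r0: "r $ 0 = 0" by (simp add: r_def c0_def pev_fps_nth_0 coeffs s ev_0)
    have "t\<^sup>2 * - (s * (A + s * B)) - d * (s * t * t) = (- (A + s * B) - d) * (s * t * t)"
      for t A B d :: "'a fps" by algebra
    then have r1: "?p fps_X (coeff \<gamma> 0) - fps_const c0 * (s * fps_X * fps_X) = r * (s * fps_X * fps_X)"
      unfolding pc0 eq r_def .
    obtain v where "node_branch v c0" "v x = int (subdegree (s * fps_X))" "v y = int (subdegree (fps_X :: 'a fps))"
      by (rule node_branchI[OF sol X r1 r0])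
    then show ?thesis by (auto simp: c0_def)
  qed
  show thesis
  proof (cases "al = 0")
    case False
    then have "degree [:de, be, al:] > 0" by simp
    then obtain s1 where "poly [:de, be, al:] s1 = 0" using alg_closed_imp_poly_has_root by blast
    then have s1: "de + s1 * be + s1\<^sup>2 * al = 0" by (simp add: power2_eq_square algebra_simps)
    define s2 where "s2 = - be / al - s1"
    have al2: "al * s2 = - be - al * s1" using False by (simp add: s2_def field_simps)
    have "al * (de + s2 * be + s2\<^sup>2 * al) = al * de + (al * s2) * be + (al * s2)\<^sup>2"
      by (simp add: power2_eq_square algebra_simps)
    also have "\<dots> = al * (de + s1 * be + s1\<^sup>2 * al)" unfolding al2 by (simp add: power2_eq_square algebra_simps)
    finally have s2: "de + s2 * be + s2\<^sup>2 * al = 0" using s1 False by simp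
    have "(be + 2 * s1 * al)\<^sup>2 = be\<^sup>2 - 4 * al * de + 4 * al * (de + s1 * be + s1\<^sup>2 * al)" by algebra
    then have d1: "be + 2 * s1 * al \<noteq> 0" using disc s1 by auto
    have "(be + 2 * s2 * al)\<^sup>2 = be\<^sup>2 - 4 * al * de + 4 * al * (de + s2 * be + s2\<^sup>2 * al)" by algebra
    then have d2: "be + 2 * s2 * al \<noteq> 0" using disc s2 by auto
    obtain v1 where v1: "node_branch v1 (- (be + s1 * al))" using transversal[OF s1 d1] by blast
    obtain v2 where v2: "node_branch v2 (- (be + s2 * al))" "v2 y = 1" using transversal[OF s2 d2] by blast
    have "m = 2"
    proof (rule ccontr)
      assume "m \<noteq> 2"
      then have "m = Suc (Suc (Suc (m - 3)))" using m2 by simp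
      then obtain i where i: "m = Suc (Suc (Suc i))" ..
      have "coeff (fibre \<gamma>) 2 = 0" unfolding fib i by (simp add: numeral_2_eq_2)
      then show False using False by (simp add: coeff_fibre al_def)
    qed
    moreover have "be + s1 * al \<noteq> be + s2 * al"
    proof
      assume "be + s1 * al = be + s2 * al"
      then have "be + 2 * s1 * al = be + s1 * al + s2 * al" by simp
      also have "\<dots> = 0" using al2 by (simp add: algebra_simps)
      finally show False using d1 by simp
    qed
    ultimately show thesis using that[OF v1 v2(1)] v2(2) by simp
  next
    case True
    then have be: "be \<noteq> 0" using disc by auto
    have t1: "de + (- de / be) * be + (- de / be)\<^sup>2 * al = 0" "be + 2 * (- de / be) * al \<noteq> 0"
      using be True by simp_all
    obtain v1 where v1: "node_branch v1 (- be)" using transversal[OF t1] True by auto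
    \<comment> \<open>The branch tangent to the line \<open>y = 0\<close>, by the substitution \<open>y = x t\<close>.\<close>
    obtain Q where Q: "\<And>y. poly Q y = ev fps_const fps_X y R"
      using ev_as_poly_in_y[OF c] by blast
    define PR where "PR = pcompose Q [:0, fps_X:]"
    define PA where "PA A = pcompose (map_poly fps_const A) [:0, fps_X:]" for A :: "'a poly"
    have PR: "poly PR t = ev fps_const fps_X (t * fps_X) R" for t by (simp add: PR_def poly_pcompose Q)
    have PA: "poly (PA A) t = ?p (t * fps_X) A" for A t by (simp add: PA_def poly_pcompose pev_def)
    have PR': "poly (pderiv PR) t $ 0 = 0" for t by (simp add: PR_def pderiv_pcompose pderiv_pCons)
    define H where "H = PR + pCons 0 (PA A1) + pCons 0 (pCons 0 (PA A0))"
    have 0: "poly H (fps_const 0) $ 0 = 0" using True by (simp add: H_def PR ev_0)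
    have 1: "poly (pderiv H) (fps_const 0) $ 0 \<noteq> 0"
      using be by (simp add: H_def pderiv_add pderiv_pCons PR' PA pev_fps_nth_0 coeffs)
    obtain t where t: "poly H t = 0" "t $ 0 = 0" by (rule fps_hensel[OF 0 1])
    define T where "T = t * fps_X"
    have T0: "T $ 0 = 0" by (simp add: T_def)
    have eq: "ev fps_const fps_X T R + t * ?p T A1 + t * (t * ?p T A0) = 0"
      using t(1) by (simp add: H_def PR PA T_def)
    have "ev fps_const fps_X T \<gamma> = fps_X\<^sup>2 * (ev fps_const fps_X T R + t * ?p T A1 + t * (t * ?p T A0))"
      by (simp add: evg T_def power2_eq_square algebra_simps)
    then have sol: "ev fps_const fps_X T \<gamma> = 0" by (simp add: eq)
    \<comment> \<open>The order of contact of this branch with the line.\<close>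
    obtain G1 where G1: "\<And>(h :: 'a \<Rightarrow> 'a fps) x y. rhom h \<Longrightarrow> ev h x y R = pev h x (fibre R) + y * ev h x y G1"
      using fibre_remainder[of R] by metis
    have "[:0, 1:]\<^sup>2 * fibre R = fibre \<gamma>" using z by (simp add: g C0 C1 power2_eq_square)
    also have "\<dots> = [:0, 1:]\<^sup>2 * ([:0, 1:] ^ j * h)" by (simp add: fib j power2_eq_square)
    finally have fibR: "fibre R = [:0, 1:] ^ j * h" by (subst (asm) mult_cancel_left) auto
    define u where "u = ?p fps_X h"
    have u: "u $ 0 \<noteq> 0" using fib by (simp add: u_def pev_fps_nth_0)
    have fibs: "?p fps_X (fibre R) = fps_X ^ j * u"
      unfolding fibR u_def by (simp add: rhom_simps[OF rhom_pev[OF c]] c)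
    define w where "w = t * ?p T A0 + ?p T A1 + fps_X * ev fps_const fps_X T G1"
    have w: "w $ 0 \<noteq> 0" using be by (simp add: w_def pev_fps_nth_0 T0 t coeffs)
    have tw: "t * w = - (fps_X ^ j * u)"
      using eq G1[OF c, of fps_X T] unfolding fibs w_def eq_neg_iff_add_eq_0
      by (simp add: T_def algebra_simps)
    have "u \<noteq> 0" "w \<noteq> 0" using u w by auto
    then have tn: "t \<noteq> 0" using tw by auto
    have "subdegree (t * w) = subdegree (fps_X ^ j * u)" unfolding tw by simp
    then have st: "subdegree t = j" using tn \<open>u \<noteq> 0\<close> \<open>w \<noteq> 0\<close> u w by (simp add: subdegree_eq_0)
    have Tn: "T \<noteq> 0" using tn by (simp add: T_def)
    have sT: "subdegree T = Suc j" using tn by (simp add: T_def st)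
    have X: "fps_X $ 0 = (0 :: 'a)" "subdegree (fps_X :: 'a fps) = 1 \<or> subdegree T = 1" by simp_all
    have r1: "?p T (coeff \<gamma> 0) - fps_const 0 * (fps_X * T) = (t * ?p T A0) * (fps_X * T)"
      by (simp add: pc0 T_def power2_eq_square algebra_simps)
    have r0: "(t * ?p T A0) $ 0 = 0" using t by simp
    obtain v2 where v2: "node_branch v2 0" "v2 x = int (subdegree (fps_X :: 'a fps))" "v2 y = int (subdegree T)"
      by (rule node_branchI[OF sol Tn T0 X r1 r0])
    show thesis using that[OF v1 v2(1)] be v2(2,3) by (simp add: sT j)
  qed
qed

end

section \<open>Calculus of orders at a place\<close>

locale function_field_over =
  fixes \<iota> :: "'a::alg_closed_field \<Rightarrow> 'b::field" and L :: "'b set"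
  assumes hom: "rhom \<iota>" and const_in: "\<iota> c \<in> L"
    and add_in: "z \<in> L \<Longrightarrow> w \<in> L \<Longrightarrow> z + w \<in> L"
    and mult_in: "z \<in> L \<Longrightarrow> w \<in> L \<Longrightarrow> z * w \<in> L"
    and inverse_in: "z \<in> L \<Longrightarrow> inverse z \<in> L"
begin

lemma zero_in: "0 \<in> L" and one_in: "1 \<in> L"
  using const_in[of 0] const_in[of 1] by (simp_all add: rhom_simps[OF hom])

lemma minus_in: "z \<in> L \<Longrightarrow> - z \<in> L"
  using mult_in[OF const_in[of "-1"], of z] by (simp add: rhom_simps[OF hom])

lemma diff_in: "z \<in> L \<Longrightarrow> w \<in> L \<Longrightarrow> z - w \<in> L"
  using add_in[OF _ minus_in, of z w] by simp

lemma divide_in: "z \<in> L \<Longrightarrow> w \<in> L \<Longrightarrow> z / w \<in> L"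
  by (simp add: divide_inverse mult_in inverse_in)

lemma sum_in: "(\<And>i. i \<in> A \<Longrightarrow> f i \<in> L) \<Longrightarrow> sum f A \<in> L"
  by (induction A rule: infinite_finite_induct) (auto simp: zero_in add_in)

lemma power_in: "z \<in> L \<Longrightarrow> z ^ n \<in> L"
  by (induction n) (auto simp: one_in mult_in)

lemma pev_in: "z \<in> L \<Longrightarrow> pev \<iota> z p \<in> L"
  by (induction p) (auto simp: hom zero_in const_in add_in mult_in)

lemma ev_in: "z \<in> L \<Longrightarrow> w \<in> L \<Longrightarrow> ev \<iota> z w G \<in> L"
  by (induction G) (auto simp: hom zero_in pev_in add_in mult_in)

lemmas in_L = zero_in one_in minus_in diff_in divide_in sum_in power_in pev_in ev_in const_in add_in mult_in inverse_in

end

locale place = function_field_over +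
  fixes v :: "'b::field \<Rightarrow> int"
  assumes point: "v \<in> curve_points \<iota> L"
begin

lemma v_mult: "z \<in> L \<Longrightarrow> w \<in> L \<Longrightarrow> z \<noteq> 0 \<Longrightarrow> w \<noteq> 0 \<Longrightarrow> v (z * w) = v z + v w"
  and v_add: "z \<in> L \<Longrightarrow> w \<in> L \<Longrightarrow> z \<noteq> 0 \<Longrightarrow> w \<noteq> 0 \<Longrightarrow> z + w \<noteq> 0 \<Longrightarrow> min (v z) (v w) \<le> v (z + w)"
  and v_const: "v (\<iota> c) = 0"
  and v_0: "v 0 = 0"
proof -
  show "v (\<iota> c) = 0"
    using point rhom_0[OF hom] unfolding curve_points_def by (cases "c = 0") auto
qed (use point in \<open>auto simp: curve_points_def\<close>)

lemma v_1: "v 1 = 0"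
  using v_const[of 1] by (simp add: rhom_1[OF hom])

lemma v_inverse: assumes "z \<in> L" shows "v (inverse z) = - v z"
proof (cases "z = 0")
  case False
  then have "v (z * inverse z) = v z + v (inverse z)" using assms by (intro v_mult) (auto simp: in_L)
  then show ?thesis using False by (simp add: v_1)
qed (simp add: v_0)

lemma v_divide: "z \<in> L \<Longrightarrow> w \<in> L \<Longrightarrow> z \<noteq> 0 \<Longrightarrow> w \<noteq> 0 \<Longrightarrow> v (z / w) = v z - v w"
  by (simp add: divide_inverse v_mult v_inverse in_L)

lemma v_power: assumes "z \<in> L" "z \<noteq> 0" shows "v (z ^ n) = int n * v z"
  by (induction n) (simp_all add: v_1 v_mult in_L assms algebra_simps)

lemma vge_0 [simp]: "vge v 0 n"
  by (simp add: vge_def)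

lemma vge_self [simp]: "vge v z (v z)"
  by (simp add: vge_def)

lemma vge_mono: "vge v z n \<Longrightarrow> m \<le> n \<Longrightarrow> vge v z m"
  by (auto simp: vge_def)

lemma vge_mult: "z \<in> L \<Longrightarrow> w \<in> L \<Longrightarrow> vge v z n \<Longrightarrow> vge v w m \<Longrightarrow> vge v (z * w) (n + m)"
  by (cases "z = 0"; cases "w = 0") (auto simp: vge_def v_mult)

lemma vge_mult0: "z \<in> L \<Longrightarrow> w \<in> L \<Longrightarrow> vge v z 0 \<Longrightarrow> vge v w m \<Longrightarrow> vge v (z * w) m"
  using vge_mult[of z w 0 m] by simp

lemma vge_add: "z \<in> L \<Longrightarrow> w \<in> L \<Longrightarrow> vge v z n \<Longrightarrow> vge v w n \<Longrightarrow> vge v (z + w) n"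
  using v_add[of z w] by (cases "z = 0"; cases "w = 0"; cases "z + w = 0") (auto simp: vge_def)

lemma vge_const: "vge v (\<iota> c) 0"
  by (simp add: vge_def v_const)

lemma vge_minus: "z \<in> L \<Longrightarrow> vge v z n \<Longrightarrow> vge v (- z) n"
  using vge_mult[OF const_in[of "-1"], of z 0 n] vge_const[of "-1"] by (simp add: rhom_simps[OF hom])

lemma vge_diff: "z \<in> L \<Longrightarrow> w \<in> L \<Longrightarrow> vge v z n \<Longrightarrow> vge v w n \<Longrightarrow> vge v (z - w) n"
  using vge_add[of z "- w" n] vge_minus[of w n] by (simp add: in_L)

lemma vge_sum: "(\<And>i. i \<in> A \<Longrightarrow> f i \<in> L) \<Longrightarrow> (\<And>i. i \<in> A \<Longrightarrow> vge v (f i) n) \<Longrightarrow> vge v (sum f A) n"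
  by (induction A rule: infinite_finite_induct) (auto intro!: vge_add simp: in_L)

lemma vge_pev: assumes "z \<in> L" "vge v z 0" shows "vge v (pev \<iota> z p) 0"
  by (induction p) (use assms in \<open>auto simp: hom in_L intro!: vge_add vge_const vge_mult0\<close>)

lemma vge_ev: assumes "z \<in> L" "w \<in> L" "vge v z 0" "vge v w 0" shows "vge v (ev \<iota> z w G) 0"
  by (induction G) (use assms in \<open>auto simp: hom in_L intro!: vge_add vge_pev vge_mult0\<close>)

lemma vge_const_pos: "vge v (\<iota> c) 1 \<Longrightarrow> c = 0"
  using v_const[of c] by (auto simp: vge_def rhom_eq_0_iff[OF hom])

lemma vge_divide: "z \<in> L \<Longrightarrow> w \<in> L \<Longrightarrow> w \<noteq> 0 \<Longrightarrow> vge v z n \<Longrightarrow> vge v (z / w) (n - v w)"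
  by (cases "z = 0") (auto simp: vge_def v_divide)

lemma vge_divide_unit: "z \<in> L \<Longrightarrow> w \<in> L \<Longrightarrow> w \<noteq> 0 \<Longrightarrow> v w = 0 \<Longrightarrow> vge v z n \<Longrightarrow> vge v (z / w) n"
  using vge_divide[of z w n] by simp

lemma vge_pos: "v z > 0 \<Longrightarrow> vge v z 1" "v z > 0 \<Longrightarrow> vge v z 0"
  by (simp_all add: vge_def)

lemma unit_residue:
  assumes z: "z \<in> L" "vge v (z - \<iota> c) 1" "c \<noteq> 0" shows "z \<noteq> 0" "v z = 0"
proof -
  show nz: "z \<noteq> 0"
  proof
    assume "z = 0"
    then have "vge v (\<iota> (- c)) 1" using z by (simp add: rhom_simps[OF hom])
    then show False using vge_const_pos z by fastforce
  qed
  have "vge v ((z - \<iota> c) + \<iota> c) 0"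
    by (rule vge_add) (use z in \<open>auto simp: in_L vge_const intro: vge_mono\<close>)
  then have "v z \<ge> 0" using nz by (simp add: vge_def)
  moreover have "\<not> v z \<ge> 1"
  proof
    assume "v z \<ge> 1"
    then have "vge v z 1" by (simp add: vge_def)
    then have "vge v (z - (z - \<iota> c)) 1" by (rule vge_diff[OF z(1) diff_in[OF z(1) const_in] _ z(2)])
    moreover have "z - (z - \<iota> c) = \<iota> c" by simp
    ultimately show False using vge_const_pos[of c] z(3) by metis
  qed
  ultimately show "v z = 0" by simp
qed

lemma vge_residue: assumes "z \<in> L" "vge v (z - \<iota> c) 1" shows "vge v z 0"
  using vge_add[of "z - \<iota> c" "\<iota> c" 0] vge_mono[of "z - \<iota> c" 1 0] vge_const[of c] assms by (simp add: in_L)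

lemma pev_residue: assumes z: "z \<in> L" "vge v (z - \<iota> c) 1" shows "vge v (pev \<iota> z p - \<iota> (poly p c)) 1"
proof (induction p)
  case (pCons a p)
  have "pev \<iota> z (pCons a p) - \<iota> (poly (pCons a p) c) = z * (pev \<iota> z p - \<iota> (poly p c)) + \<iota> (poly p c) * (z - \<iota> c)"
    by (simp add: hom rhom_simps[OF hom] algebra_simps)
  also have "vge v \<dots> 1" using z pCons.IH vge_residue[OF z]
    by (intro vge_add vge_mult0) (auto simp: in_L vge_const)
  finally show ?case .
qed (simp add: hom rhom_0)

lemma pev_unit:
  assumes "z \<in> L" "vge v (z - \<iota> c) 1" "poly p c \<noteq> 0" shows "pev \<iota> z p \<noteq> 0" "v (pev \<iota> z p) = 0"
  using unit_residue[OF pev_in[OF assms(1)] pev_residue[OF assms(1,2)] assms(3)] by auto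

text \<open>Only the factor \<open>X - c\<close> of \<open>q\<close> vanishes at a place where \<open>z\<close> has the value \<open>c\<close>.\<close>

lemma pev_order:
  assumes z: "z \<in> L" "v (z - \<iota> c) > 0" and q: "q \<noteq> 0"
  shows "pev \<iota> z q \<noteq> 0 \<and> v (pev \<iota> z q) = int (order c q) * v (z - \<iota> c)"
proof -
  obtain h where h: "q = [:- c, 1:] ^ order c q * h" "\<not> [:- c, 1:] dvd h"
    using order_decomp[OF q, of c] by blast
  have "poly h c \<noteq> 0" using h(2) by (simp add: poly_eq_0_iff_dvd)
  then have u: "pev \<iota> z h \<noteq> 0" "v (pev \<iota> z h) = 0"
    using pev_unit[OF z(1)] vge_pos(1)[OF z(2)] by auto
  have zc: "z - \<iota> c \<noteq> 0" using z(2) v_0 by auto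
  note e = rhom_simps[OF rhom_pev[OF hom]]
  have "pev \<iota> z q = (z - \<iota> c) ^ order c q * pev \<iota> z h"
    by (subst h(1)) (simp add: e hom rhom_simps[OF hom])
  then show ?thesis using u zc z(1) by (simp add: v_mult v_power in_L)
qed

lemma pev_pole:
  assumes z: "z \<in> L" "v z < 0" and q: "q \<noteq> 0"
  shows "pev \<iota> z q \<noteq> 0 \<and> v (pev \<iota> z q) = int (degree q) * v z"
  using q
proof (induction q)
  case (pCons c q)
  show ?case
  proof (cases "q = 0")
    case True
    then show ?thesis using pCons hom by (simp add: rhom_0 rhom_eq_0_iff v_const)
  next
    case False
    then have IH: "pev \<iota> z q \<noteq> 0" "v (pev \<iota> z q) = int (degree q) * v z" using pCons.IH by auto
    define w where "w = z * pev \<iota> z q"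
    have zn: "z \<noteq> 0" using z v_0 by auto
    have w: "w \<in> L" "w \<noteq> 0" "v w = int (Suc (degree q)) * v z"
      using zn z IH by (auto simp: w_def in_L v_mult algebra_simps)
    have neg: "v w < 0" using w(3) z(2) by (simp add: mult_less_0_iff)
    have lo: "vge v (\<iota> c + w) (v w)"
      by (rule vge_add[OF const_in w(1) vge_mono[OF vge_const] vge_self]) (use neg in simp)
    have hi: "\<not> vge v (\<iota> c + w) (v w + 1)"
    proof
      assume "vge v (\<iota> c + w) (v w + 1)"
      then have "vge v ((\<iota> c + w) - \<iota> c) (v w + 1)"
        by (intro vge_diff) (use w neg vge_const[of c] in \<open>auto simp: in_L intro: vge_mono\<close>)
      then show False using w by (simp add: vge_def)
    qed
    have "\<iota> c + w \<noteq> 0" "v (\<iota> c + w) = v w" using lo hi by (auto simp: vge_def)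
    then show ?thesis using False w hom by (simp add: w_def)
  qed
qed simp

text \<open>This treats the places at which \<open>z\<close> is regular and its residue is not a root of \<open>q\<close>, without having to
  know that the residue is a constant: \<open>q\<close> splits into linear factors, which are all units.\<close>

lemma pev_unit_no_centre:
  assumes z: "z \<in> L" "vge v z 0" and q: "q \<noteq> 0" and nc: "\<And>c. poly q c = 0 \<Longrightarrow> \<not> vge v (z - \<iota> c) 1"
  shows "pev \<iota> z q \<noteq> 0 \<and> v (pev \<iota> z q) = 0"
  using q nc
proof (induction "degree q" arbitrary: q)
  case 0
  then obtain c where "q = [:c:]" "c \<noteq> 0" by (metis degree_eq_zeroE pCons_0_0)
  then show ?case using hom by (simp add: rhom_0 rhom_eq_0_iff v_const)
next
  case (Suc n)
  then obtain c where c: "poly q c = 0" using alg_closed_imp_poly_has_root[of q] by auto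
  then obtain h where h: "q = [:- c, 1:] * h" by (auto simp: poly_eq_0_iff_dvd elim: dvdE)
  have hn: "h \<noteq> 0" using h Suc.prems by auto
  have "degree q = 1 + degree h" unfolding h using hn by (subst degree_mult_eq) auto
  then have IH: "pev \<iota> z h \<noteq> 0 \<and> v (pev \<iota> z h) = 0" using Suc hn h by auto
  have "\<not> vge v (z - \<iota> c) 1" using Suc.prems(2) c by blast
  moreover have "vge v (z - \<iota> c) 0" using z by (intro vge_diff) (auto simp: in_L vge_const)
  ultimately have "z - \<iota> c \<noteq> 0" "v (z - \<iota> c) = 0" by (auto simp: vge_def)
  moreover have "pev \<iota> z q = (z - \<iota> c) * pev \<iota> z h"
    unfolding h rhom_mult[OF rhom_pev[OF hom]] by (simp add: hom rhom_simps[OF hom])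
  ultimately show ?case using IH z by (simp add: v_mult in_L)
qed

end

context plane_model
begin

lemma in_L_iff: "z \<in> L \<longleftrightarrow> (\<exists>G H. z = ev \<iota> x y G / ev \<iota> x y H \<and> ev \<iota> x y H \<noteq> 0)"
  by (auto simp: L)

lemma ev_in_L: "ev \<iota> x y G \<in> L"
  unfolding in_L_iff by (intro exI[of _ G] exI[of _ 1]) (simp add: rhom_1[OF rhom_ev[OF hom]])

lemma function_field_over: "function_field_over \<iota> L"
proof
  note e = rhom_simps[OF rhom_ev[OF hom, of x y]]
  show "rhom \<iota>" by (rule hom)
  show "\<iota> c \<in> L" for c using ev_in_L[of "[:[:c:]:]"] hom by (simp add: rhom_0)
  fix z w assume "z \<in> L" "w \<in> L"
  then obtain G H G' H' where z: "z = ev \<iota> x y G / ev \<iota> x y H" "ev \<iota> x y H \<noteq> 0"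
    and w: "w = ev \<iota> x y G' / ev \<iota> x y H'" "ev \<iota> x y H' \<noteq> 0"
    unfolding in_L_iff by blast
  have "z + w = ev \<iota> x y (G * H' + G' * H) / ev \<iota> x y (H * H')" "ev \<iota> x y (H * H') \<noteq> 0"
    unfolding z(1) w(1) using z(2) w(2) by (simp_all add: e add_frac_eq)
  then show "z + w \<in> L" unfolding in_L_iff by blast
  have "z * w = ev \<iota> x y (G * G') / ev \<iota> x y (H * H')" "ev \<iota> x y (H * H') \<noteq> 0"
    unfolding z(1) w(1) using z(2) w(2) by (simp_all add: e)
  then show "z * w \<in> L" unfolding in_L_iff by blast
next
  fix z assume zL: "z \<in> L"
  then obtain G H where z: "z = ev \<iota> x y G / ev \<iota> x y H" "ev \<iota> x y H \<noteq> 0"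
    unfolding in_L_iff by blast
  show "inverse z \<in> L"
  proof (cases "z = 0")
    case False
    then have "inverse z = ev \<iota> x y H / ev \<iota> x y G" "ev \<iota> x y G \<noteq> 0" using z by auto
    then show ?thesis unfolding in_L_iff by blast
  qed (use zL in simp)
qed

lemma x_in: "x \<in> L" and y_in: "y \<in> L"
  using ev_in_L[of "[:0, 1:]"] ev_in_L[of "[:[:0, 1:]:]"] hom
  by (simp_all add: rhom_simps rhom_simps[OF rhom_pev[OF hom]])

end

section \<open>Local sections along a fibre\<close>

lemma dvd_if_order_le:
  fixes g P :: "'a::alg_closed_field poly"
  assumes "g \<noteq> 0" "P \<noteq> 0" "\<And>c. poly g c = 0 \<Longrightarrow> order c g \<le> order c P"
  shows "g dvd P"
  using assms
proof (induction "degree g" arbitrary: g P)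
  case 0
  then obtain c where "g = [:c:]" "c \<noteq> 0" by (metis degree_eq_zeroE pCons_0_0)
  then have "P = g * smult (inverse c) P" by simp
  then show ?case by (rule dvdI)
next
  case (Suc n)
  then obtain c where c: "poly g c = 0" using alg_closed_imp_poly_has_root[of g] by auto
  then have "order c g \<noteq> 0" using Suc.prems by (simp add: order_root)
  then have "order c P \<noteq> 0" using Suc.prems(3)[OF c] by simp
  then have "poly P c = 0" by (simp add: order_root)
  then obtain P' where P': "P = [:- c, 1:] * P'" by (auto simp: poly_eq_0_iff_dvd elim: dvdE)
  from c obtain g' where g': "g = [:- c, 1:] * g'" by (auto simp: poly_eq_0_iff_dvd elim: dvdE)
  have nz: "g' \<noteq> 0" "P' \<noteq> 0" using Suc.prems g' P' by auto
  have "degree g = 1 + degree g'" unfolding g' using nz by (subst degree_mult_eq) auto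
  moreover have "order d g' \<le> order d P'" if "poly g' d = 0" for d
  proof -
    have "poly g d = 0" using that g' by simp
    then have "order d g \<le> order d P" using Suc.prems by blast
    moreover have "order d g = order d [:- c, 1:] + order d g'"
      unfolding g' using Suc.prems(1) g' by (intro order_mult) simp
    moreover have "order d P = order d [:- c, 1:] + order d P'"
      unfolding P' using Suc.prems(2) P' by (intro order_mult) simp
    ultimately show ?thesis by simp
  qed
  ultimately have "g' dvd P'" using Suc nz by simp
  then show ?case unfolding g' P' by (rule mult_dvd_mono[OF dvd_refl])
qed

lemma rhom_fibre: "rhom (fibre :: 'a::comm_ring_1 poly poly \<Rightarrow> _)"
  unfolding fibre_def by (rule rhom_map_poly) (simp add: rhom_def)

text \<open>The situation along the fibre \<open>t = 0\<close> of the second projection, in an affine chart in which the lines with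
  nodes are \<open>x = X i\<close>. The polynomial \<open>p i\<close> vanishes at the nodes on the \<open>i\<close>-th line, \<open>I\<close> indexes the lines
  with a node on the fibre \<open>t = 0\<close>, and \<open>f i\<close> is the equation with the origin moved to that node.\<close>

locale fibre_data = function_field_over \<iota> L for \<iota> :: "'a::alg_closed_field \<Rightarrow> 'b::field" and L +
  fixes \<gamma> :: "'a poly poly" and x t :: 'b and N I :: "'i set" and X :: "'i \<Rightarrow> 'a"
    and G p :: "'i \<Rightarrow> 'a poly" and f :: "'i \<Rightarrow> 'a poly poly"
  assumes x_in: "x \<in> L" and t_in: "t \<in> L" and zero: "ev \<iota> x t \<gamma> = 0"
    and t_trans: "\<And>q. q \<noteq> 0 \<Longrightarrow> pev \<iota> t q \<noteq> 0"
    and x_ne: "\<And>c. x \<noteq> \<iota> c"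
    and N: "finite N" "inj_on X N" and I: "I \<subseteq> N"
    and factor: "\<And>i. i \<in> N \<Longrightarrow> poly \<gamma> [:X i:] = G i * p i"
    and p_unit: "\<And>i. i \<in> N - I \<Longrightarrow> poly (p i) 0 \<noteq> 0"
    and p_simple: "\<And>i. i \<in> I \<Longrightarrow> \<exists>p'. p i = pCons 0 p' \<and> poly p' 0 \<noteq> 0"
    and node: "\<And>i. i \<in> I \<Longrightarrow> singular_origin (f i) \<and> coeff (f i) 0 = poly \<gamma> [:X i:] \<and> ev \<iota> (x - \<iota> (X i)) t (f i) = 0"
begin

definition psi :: "'i \<Rightarrow> 'b" where
  "psi i = pev \<iota> t (G i) / (x - \<iota> (X i))"

lemma psi_in: "psi i \<in> L"
  by (simp add: psi_def in_L x_in t_in)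

lemma x_diff_nz: "x - \<iota> c \<noteq> 0"
  using x_ne[of c] by simp

definition cofactor :: "'i \<Rightarrow> 'a poly poly" where
  "cofactor i = synthetic_div \<gamma> [:X i:]"

lemma cofactor_eq: "\<gamma> = [:- [:X i:], 1:] * cofactor i + [:poly \<gamma> [:X i:]:]"
  unfolding cofactor_def by (rule synthetic_div_correct'[symmetric])

text \<open>On the curve \<open>\<gamma>(X i, t) = - (x - X i) H(x, t)\<close> for the quotient \<open>H\<close> of the division of \<open>\<gamma>\<close> by \<open>x - X i\<close>.\<close>

lemma psi_cofactor:
  assumes "i \<in> N" "pev \<iota> t (p i) \<noteq> 0"
  shows "psi i = - (ev \<iota> x t (cofactor i) / pev \<iota> t (p i))"
proof -
  note e = rhom_simps[OF rhom_ev[OF hom, of x t]] and e1 = rhom_simps[OF rhom_pev[OF hom, of t]]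
  have "0 = ev \<iota> x t ([:- [:X i:], 1:] * cofactor i + [:poly \<gamma> [:X i:]:])"
    unfolding cofactor_eq[symmetric] by (simp add: zero)
  also have "\<dots> = (x - \<iota> (X i)) * ev \<iota> x t (cofactor i) + pev \<iota> t (G i) * pev \<iota> t (p i)"
    by (simp only: e) (simp add: hom e1 rhom_simps[OF hom] factor[OF assms(1)])
  finally have "pev \<iota> t (G i) * pev \<iota> t (p i) = - ((x - \<iota> (X i)) * ev \<iota> x t (cofactor i))"
    by (simp add: eq_neg_iff_add_eq_0 add.commute)
  then show ?thesis using assms(2) x_diff_nz by (simp add: psi_def field_simps)
qed

lemma psi_regular_unit:
  assumes "place \<iota> L v" and t: "vge v t 0" and i: "i \<in> N" and u: "v (pev \<iota> t (p i)) = 0" "pev \<iota> t (p i) \<noteq> 0"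
  shows "vge v (psi i) 0"
proof -
  interpret place \<iota> L v by fact
  show ?thesis
  proof (cases "vge v (x - \<iota> (X i)) 1")
    case True
    then have "vge v x 0" by (rule vge_residue[OF x_in])
    then show ?thesis unfolding psi_cofactor[OF i u(2)]
      using u t by (intro vge_minus vge_divide_unit vge_ev) (auto simp: in_L x_in t_in)
  next
    case False
    then have "v (x - \<iota> (X i)) \<le> 0" by (simp add: vge_def)
    then have "vge v (pev \<iota> t (G i) / (x - \<iota> (X i))) 0"
      by (intro vge_mono[OF vge_divide[of _ _ 0]] vge_pev) (use x_diff_nz t in \<open>auto simp: in_L x_in t_in\<close>)
    then show ?thesis by (simp add: psi_def)
  qed
qed

text \<open>At a node on the line \<open>x = X i\<close> the local equation reads \<open>t\<^sup>2 A0 + s t A1 + s\<^sup>2 R = 0\<close>, so that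
  \<open>w = t A0 / s\<close> satisfies the integral equation \<open>w\<^sup>2 + A1 w + A0 R = 0\<close>.\<close>

lemma psi_regular_node:
  assumes "place \<iota> L v" and t: "vge v t 1" and i: "i \<in> I"
  shows "vge v (psi i) 0"
proof -
  interpret place \<iota> L v by fact
  obtain p' where p': "p i = pCons 0 p'" "poly p' 0 \<noteq> 0" using p_simple[OF i] by blast
  have iN: "i \<in> N" using i I by blast
  define s where "s = x - \<iota> (X i)"
  have sL: "s \<in> L" "s \<noteq> 0" using x_diff_nz by (auto simp: s_def in_L x_in)
  have tn: "t \<noteq> 0" using t_trans[of "[:0, 1:]"] hom by (auto simp: rhom_0)
  have t0: "vge v t 0" using t by (rule vge_mono) simp
  have sing: "singular_origin (f i)" and f0: "coeff (f i) 0 = G i * p i" and evf: "ev \<iota> s t (f i) = 0"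
    using node[OF i] factor[OF iN] by (auto simp: s_def)
  obtain C0 C1 R where g: "f i = pCons C0 (pCons C1 R)" by (metis pCons_cases)
  obtain A1 where C1: "C1 = pCons 0 A1" using sing by (cases C1) (simp add: g cf_def singular_origin_def)
  have C0: "C0 = pCons 0 (G i * p')" using f0 by (simp add: g p')
  have "poly (G i * p') 0 = 0" using sing by (simp add: singular_origin_def g cf_def C0 poly_0_coeff_0)
  then have "poly (G i) 0 = 0" using p' by simp
  then obtain G' where G': "G i = pCons 0 G'" by (cases "G i") simp
  note e1 = rhom_simps[OF rhom_pev[OF hom, of t]]
  let ?A0 = "pev \<iota> t (G' * p')" and ?A1 = "pev \<iota> t A1" and ?R = "ev \<iota> s t R"
  have eq: "t * t * ?A0 + s * t * ?A1 + s * s * ?R = 0"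
    using evf unfolding g C0 C1 G' by (simp add: hom e1 rhom_0[OF hom] algebra_simps)
  have pu: "pev \<iota> t p' \<noteq> 0" "v (pev \<iota> t p') = 0"
    using pev_unit[OF t_in _ p'(2)] t by (simp_all add: rhom_0[OF hom])
  have psi: "psi i = t * pev \<iota> t G' / s"
    by (simp add: psi_def s_def G' hom rhom_0)
  have A: "vge v ?A0 0" "vge v ?A1 0" using t0 by (auto intro: vge_pev simp: t_in)
  show ?thesis
  proof (cases "vge v s 1")
    case False
    then have "v s \<le> 0" using sL by (simp add: vge_def)
    then show ?thesis unfolding psi using t0 sL
      by (intro vge_mono[OF vge_divide[of _ _ 0]] vge_mult0 vge_pev) (auto simp: in_L t_in)
  next
    case True
    then have R: "vge v ?R 0" using t0 sL by (intro vge_ev) (auto simp: t_in intro: vge_mono)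
    define w where "w = t * ?A0 / s"
    have wL: "w \<in> L" by (simp add: w_def in_L t_in sL)
    have "s * s * (w * w + ?A1 * w + ?A0 * ?R) = ?A0 * (t * t * ?A0 + s * t * ?A1 + s * s * ?R)"
      using sL by (simp add: w_def field_simps)
    then have "w * w + (?A1 * w + ?A0 * ?R) = 0" using eq sL by (simp add: add.assoc)
    then have wq: "w * w = - (?A1 * w + ?A0 * ?R)" by (rule eq_neg_iff_add_eq_0[THEN iffD2])
    have "vge v w 0"
    proof (rule ccontr)
      assume "\<not> vge v w 0"
      then have w: "w \<noteq> 0" "v w < 0" by (auto simp: vge_def)
      have "vge v (- (?A1 * w + ?A0 * ?R)) (v w)"
        using A R w wL sL by (intro vge_minus vge_add vge_mult0 vge_self)
          (auto simp: in_L t_in intro: vge_mono[of _ 0])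
      then have "vge v (w * w) (v w)" by (simp only: wq)
      then show False using w wL by (simp add: vge_def v_mult)
    qed
    moreover have "psi i = w / pev \<iota> t p'"
      using pu by (simp add: psi w_def e1)
    ultimately show ?thesis using pu wL by (simp add: vge_divide_unit in_L t_in)
  qed
qed

lemma psi_regular:
  assumes pl: "place \<iota> L v" and t: "vge v t 1" and i: "i \<in> N"
  shows "vge v (psi i) 0"
proof (cases "i \<in> I")
  case True then show ?thesis using psi_regular_node[OF pl t] by blast
next
  case False
  interpret place \<iota> L v by fact
  have "pev \<iota> t (p i) \<noteq> 0" "v (pev \<iota> t (p i)) = 0"
    using pev_unit[OF t_in _ p_unit[of i]] t i False by (simp_all add: rhom_0[OF hom])
  then show ?thesis using i t by (intro psi_regular_unit[OF pl]) (auto intro: vge_mono)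
qed

text \<open>The restriction of \<open>psi i\<close> to the fibre, for a line without a node on the fibre.\<close>

definition psi_fibre :: "'i \<Rightarrow> 'a poly" where
  "psi_fibre i = smult (- inverse (poly (p i) 0)) (fibre (cofactor i))"

text \<open>Modulo \<open>t\<close> the cofactor is a polynomial in \<open>x\<close> alone and \<open>p i\<close> is a nonzero constant.\<close>

lemma psi_mod_t:
  assumes pl: "place \<iota> L v" and t: "v t > 0" and x: "vge v x 0" and i: "i \<in> N - I"
  shows "vge v (psi i - pev \<iota> x (psi_fibre i)) (v t)"
proof -
  interpret place \<iota> L v by fact
  note t1 = vge_pos(1)[OF t] and t0 = vge_pos(2)[OF t]
  let ?c = "poly (p i) 0"
  have pu: "pev \<iota> t (p i) \<noteq> 0" "v (pev \<iota> t (p i)) = 0"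
    using pev_unit[OF t_in _ p_unit[OF i]] t1 by (simp_all add: rhom_0[OF hom])
  obtain H1 where H1: "\<And>(h :: 'a \<Rightarrow> 'b) x y. rhom h \<Longrightarrow> ev h x y (cofactor i) = pev h x (fibre (cofactor i)) + y * ev h x y H1"
    using fibre_remainder[of "cofactor i"] by metis
  define h where "h = pev \<iota> x (fibre (cofactor i))"
  define h1 where "h1 = ev \<iota> x t H1"
  obtain c q where pq: "p i = pCons c q" by (cases "p i")
  define qt where "qt = pev \<iota> t q"
  have c: "?c = c" "c \<noteq> 0" using p_unit[OF i] by (simp_all add: pq)
  have pt: "pev \<iota> t (p i) = \<iota> c + t * qt" using hom by (simp add: pq qt_def)
  have ic: "\<iota> c \<noteq> 0" using c rhom_eq_0_iff[OF hom] by blast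
  have inv: "\<iota> (inverse c) = inverse (\<iota> c)"
    using rhom_mult[OF hom, of c "inverse c"] c(2) rhom_1[OF hom] by (metis inverse_unique right_inverse)
  have "psi i = - ((h + t * h1) / (\<iota> c + t * qt))"
    using psi_cofactor[of i] i pu H1[OF hom] by (simp add: h_def h1_def pt)
  moreover have "pev \<iota> x (psi_fibre i) = - (h / \<iota> c)"
    by (simp add: psi_fibre_def pev_smult[OF hom] c rhom_minus[OF hom] rhom_minus[OF rhom_pev[OF hom]] inv h_def divide_inverse mult.commute)
  moreover have "- ((h + t * h1) / P) - (- (h / \<iota> c)) = (h * P - (h + t * h1) * \<iota> c) / (\<iota> c * P)" if "P \<noteq> 0" for P
    using ic that by (simp add: field_simps)
  moreover have "h * (\<iota> c + t * qt) - (h + t * h1) * \<iota> c = t * (qt * h - \<iota> c * h1)"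
    by (simp add: algebra_simps)
  ultimately have "psi i - pev \<iota> x (psi_fibre i) = t * (qt * h - \<iota> c * h1) / (\<iota> c * (\<iota> c + t * qt))"
    using pu(1) unfolding pt by metis
  also have "vge v \<dots> (v t)"
  proof (rule vge_divide_unit)
    show "v (\<iota> c * (\<iota> c + t * qt)) = 0" using ic pu unfolding pt[symmetric] by (simp add: v_mult v_const in_L t_in)
    show "vge v (t * (qt * h - \<iota> c * h1)) (v t)"
      unfolding mult.commute[of t] qt_def h_def h1_def using t0 x
      by (intro vge_mult0 vge_diff vge_pev vge_ev vge_const vge_self) (auto simp: in_L t_in x_in)
  qed (use ic pu in \<open>auto simp: in_L t_in x_in qt_def h_def h1_def hom rhom_0 pt\<close>)
  finally show ?thesis .
qed

text \<open>If the \<open>i\<close>-th line has a node on the fibre, \<open>psi i\<close> vanishes on the rest of the fibre, because \<open>\<gamma>(X i, t)\<close> has at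
  least a double zero at \<open>t = 0\<close> and only one factor \<open>t\<close> is removed by \<open>p i\<close>.\<close>

lemma psi_mod_t_other_node:
  assumes pl: "place \<iota> L v" and t: "v t > 0" and x: "vge v (x - \<iota> c) 1" and i: "i \<in> I" and c: "c \<noteq> X i"
  shows "vge v (psi i) (v t)"
proof -
  interpret place \<iota> L v by fact
  obtain p' where p': "p i = pCons 0 p'" "poly p' 0 \<noteq> 0" using p_simple[OF i] by blast
  have iN: "i \<in> N" using i I by blast
  have "cf (f i) 0 1 = 0" "coeff (f i) 0 = G i * p i" using node[OF i] factor[OF iN] by (auto simp: singular_origin_def)
  then have "poly (G i) 0 = 0" using p' by (simp add: cf_def poly_0_coeff_0 coeff_mult)
  then obtain G' where G': "G i = pCons 0 G'" by (cases "G i") simp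
  have "vge v ((x - \<iota> (X i)) - \<iota> (c - X i)) 1" using x by (simp add: rhom_diff[OF hom])
  then have u: "x - \<iota> (X i) \<noteq> 0" "v (x - \<iota> (X i)) = 0"
    using unit_residue[of "x - \<iota> (X i)" "c - X i"] c by (auto simp: in_L x_in)
  have "psi i = pev \<iota> t G' * t / (x - \<iota> (X i))" by (simp add: psi_def G' hom rhom_0 mult.commute)
  also have "vge v \<dots> (v t)" using u vge_pos(2)[OF t]
    by (intro vge_divide_unit vge_mult0 vge_pev vge_self) (auto simp: in_L x_in t_in)
  finally show ?thesis .
qed

text \<open>Let \<open>u\<close> be the combination and \<open>g\<close> the equation of the fibre. Modulo \<open>t\<close> and away from the nodes on the
  fibre, \<open>u\<close> is a polynomial \<open>q(x)\<close>. The branches at the nodes show that the \<open>b i\<close> of the lines with a node on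
  the fibre vanish, and then the orders of \<open>q\<close> at all points yield \<open>g dvd q * PI I\<close>, where \<open>PI M\<close> is the
  product of the \<open>x - X i\<close> over \<open>i \<in> M\<close>. Multiplied by \<open>PI J\<close>, with \<open>J\<close> the set of the other lines, \<open>q\<close> becomes
  \<open>N0 - g S\<close>, where \<open>N0\<close> has at most the degree of \<open>PI J\<close>. So \<open>g\<close> divides \<open>PI I * N0\<close>, whose degree is too
  small, and \<open>N0 = 0\<close>. Evaluation at the \<open>X j\<close> finishes the proof. If the fibre passes through \<open>x = \<infinity>\<close>, the
  degree of \<open>g\<close> is less than \<open>k\<close>; the missing estimate for \<open>N0\<close> comes from the place there.

  The inequalities between the orders of \<open>x - c\<close> and \<open>t\<close> are those provided by smooth points and nodes with
  multiplicity \<open>m\<close> in the fibre.\<close>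

lemma psi_independent:
  fixes k :: nat and b :: "'i \<Rightarrow> 'a"
  defines "g \<equiv> fibre \<gamma>"
  assumes g: "g \<noteq> 0" "degree g \<le> k" and cardN: "card N < k"
    and smooth: "\<And>c m h. g = [:- c, 1:] ^ m * h \<Longrightarrow> poly h c \<noteq> 0 \<Longrightarrow> m > 0 \<Longrightarrow> c \<notin> X ` I \<Longrightarrow>
        \<exists>v. place \<iota> L v \<and> v (x - \<iota> c) > 0 \<and> v t > 0 \<and> (int m - 1) * v (x - \<iota> c) < v t"
    and nodal: "\<And>i m h. i \<in> I \<Longrightarrow> g = [:- X i, 1:] ^ m * h \<Longrightarrow> poly h (X i) \<noteq> 0 \<Longrightarrow>
        \<exists>v1 v2 c1 c2. place \<iota> L v1 \<and> place \<iota> L v2 \<and> v1 (x - \<iota> (X i)) > 0 \<and> v1 t > 0 \<and>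
          v2 (x - \<iota> (X i)) > 0 \<and> v2 t > 0 \<and> c1 \<noteq> c2 \<and>
          vge v1 (pev \<iota> t (poly \<gamma> [:X i:]) / ((x - \<iota> (X i)) * t) - \<iota> c1) 1 \<and>
          vge v2 (pev \<iota> t (poly \<gamma> [:X i:]) / ((x - \<iota> (X i)) * t) - \<iota> c2) 1 \<and>
          (int m - 2) * v2 (x - \<iota> (X i)) < v2 t"
    and infinity: "degree g < k \<Longrightarrow>
        \<exists>v. place \<iota> L v \<and> v (1 / x) > 0 \<and> v t > 0 \<and> (int (k - degree g) - 1) * v (1 / x) < v t"
    and small: "\<And>v. place \<iota> L v \<Longrightarrow> v t > 0 \<Longrightarrow> vge v (\<iota> b0 + (\<Sum>i\<in>N. \<iota> (b i) * psi i)) (v t)"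
  shows "b0 = 0 \<and> (\<forall>i\<in>N. b i = 0)"
proof -
  define J where "J = N - I"
  have fin: "finite I" "finite J" "finite N" using N I by (auto simp: J_def intro: finite_subset)
  have NIJ: "N = I \<union> J" "I \<inter> J = {}" using I by (auto simp: J_def)
  have Xeq: "X i = X j \<longleftrightarrow> i = j" if "i \<in> N" "j \<in> N" for i j using N(2) that by (auto simp: inj_on_def)
  define u where "u = \<iota> b0 + (\<Sum>i\<in>N. \<iota> (b i) * psi i)"
  define q where "q = [:b0:] + (\<Sum>j\<in>J. smult (b j) (psi_fibre j))"
  have uL: "u \<in> L" by (auto simp: u_def in_L psi_in)
  note e = rhom_simps[OF rhom_pev[OF hom]]
  have qx: "pev \<iota> x q = \<iota> b0 + (\<Sum>j\<in>J. \<iota> (b j) * pev \<iota> x (psi_fibre j))"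
    by (simp add: q_def e hom pev_smult rhom_0)
  have part: "vge v (\<Sum>j\<in>J. \<iota> (b j) * (psi j - pev \<iota> x (psi_fibre j))) (v t)"
    if pl: "place \<iota> L v" and t: "v t > 0" and x: "v (x - \<iota> c) > 0" for v c
  proof -
    interpret place \<iota> L v by fact
    have "vge v x 0" using vge_residue[OF x_in vge_pos(1)[OF x]] .
    then show ?thesis
      by (intro vge_sum vge_mult0 psi_mod_t[OF pl t]) (auto simp: in_L psi_in x_in vge_const J_def)
  qed
  have usum: "u = pev \<iota> x q + (\<Sum>j\<in>J. \<iota> (b j) * (psi j - pev \<iota> x (psi_fibre j))) + (\<Sum>i\<in>I. \<iota> (b i) * psi i)"
    unfolding u_def qx NIJ(1) using fin NIJ(2)
    by (simp add: sum.union_disjoint algebra_simps sum_subtractf sum.distrib)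
  have bI: "b i = 0" if i: "i \<in> I" for i
  proof -
    obtain h where h: "g = [:- X i, 1:] ^ order (X i) g * h" "\<not> [:- X i, 1:] dvd h"
      using order_decomp[OF g(1), of "X i"] by blast
    then have "poly h (X i) \<noteq> 0" by (simp add: poly_eq_0_iff_dvd)
    from nodal[OF i h(1) this] obtain v1 v2 c1 c2 where vv: "place \<iota> L v1" "place \<iota> L v2" "v1 (x - \<iota> (X i)) > 0" "v1 t > 0"
          "v2 (x - \<iota> (X i)) > 0" "v2 t > 0" "c1 \<noteq> c2"
          "vge v1 (pev \<iota> t (poly \<gamma> [:X i:]) / ((x - \<iota> (X i)) * t) - \<iota> c1) 1"
          "vge v2 (pev \<iota> t (poly \<gamma> [:X i:]) / ((x - \<iota> (X i)) * t) - \<iota> c2) 1" by blast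
    obtain p' where p': "p i = pCons 0 p'" "poly p' 0 \<noteq> 0" using p_simple[OF i] by blast
    have iN: "i \<in> N" using i I by blast
    have tn: "t \<noteq> 0" using t_trans[of "[:0, 1:]"] hom by (auto simp: rhom_0)
    have w: "pev \<iota> t (poly \<gamma> [:X i:]) / ((x - \<iota> (X i)) * t) = psi i * pev \<iota> t p'"
      using tn by (simp add: factor[OF iN] p' e psi_def hom rhom_0)
    \<comment> \<open>Both branches give a linear relation between the value of \<open>q\<close> and \<open>b i\<close>.\<close>
    have rel: "poly q (X i) * poly p' 0 + b i * c = 0"
      if pl: "place \<iota> L v" and v: "v (x - \<iota> (X i)) > 0" "v t > 0"
        and c: "vge v (psi i * pev \<iota> t p' - \<iota> c) 1" for v c
    proof -
      interpret place \<iota> L v by fact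
      have oth: "vge v (\<Sum>j\<in>I-{i}. \<iota> (b j) * psi j) (v t)"
      proof (intro vge_sum vge_mult0)
        fix j assume "j \<in> I - {i}"
        then have "j \<in> I" "X i \<noteq> X j" using I Xeq[of i j] iN by auto
        then show "vge v (psi j) (v t)" by (rule psi_mod_t_other_node[OF pl v(2) vge_pos(1)[OF v(1)]])
      qed (auto simp: in_L psi_in vge_const)
      have "vge v (u - (\<Sum>j\<in>J. \<iota> (b j) * (psi j - pev \<iota> x (psi_fibre j)))
           - (\<Sum>j\<in>I-{i}. \<iota> (b j) * psi j)) (v t)"
        by (rule vge_diff[OF _ _ vge_diff[OF _ _ small[OF pl v(2), folded u_def] part[OF pl v(2) v(1)]] oth])
          (auto simp: in_L psi_in x_in uL)
      also have "u - (\<Sum>j\<in>J. \<iota> (b j) * (psi j - pev \<iota> x (psi_fibre j))) - (\<Sum>j\<in>I-{i}. \<iota> (b j) * psi j)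
          = pev \<iota> x q + \<iota> (b i) * psi i"
        unfolding usum using fin i by (simp add: sum.remove[of I i])
      finally have 1: "vge v (pev \<iota> x q + \<iota> (b i) * psi i) 1" using v(2) by (auto intro: vge_mono)
      have 2: "vge v (pev \<iota> x q - \<iota> (poly q (X i))) 1"
        by (rule pev_residue[OF x_in vge_pos(1)[OF v(1)]])
      have 3: "vge v (pev \<iota> t p' - \<iota> (poly p' 0)) 1"
        using pev_residue[OF t_in, of 0 p'] vge_pos(1)[OF v(2)] by (simp add: rhom_0[OF hom])
      have "\<iota> (poly q (X i) * poly p' 0 + b i * c)
        = (pev \<iota> x q + \<iota> (b i) * psi i) * pev \<iota> t p' - \<iota> (b i) * (psi i * pev \<iota> t p' - \<iota> c)
          - (pev \<iota> x q - \<iota> (poly q (X i))) * pev \<iota> t p' - \<iota> (poly q (X i)) * (pev \<iota> t p' - \<iota> (poly p' 0))"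
        by (simp add: rhom_simps[OF hom] algebra_simps)
      also have "vge v \<dots> 1"
      proof -
        have A: "vge v (pev \<iota> t p') 0" using vge_pos(2)[OF v(2)] by (intro vge_pev t_in)
        have T1: "vge v ((pev \<iota> x q + \<iota> (b i) * psi i) * pev \<iota> t p') 1"
          using vge_mult0[OF _ _ A 1] by (simp add: mult.commute in_L psi_in x_in t_in)
        have T2: "vge v ((pev \<iota> x q - \<iota> (poly q (X i))) * pev \<iota> t p') 1"
          using vge_mult0[OF _ _ A 2] by (simp add: mult.commute in_L psi_in x_in t_in)
        have T3: "vge v (\<iota> (b i) * (psi i * pev \<iota> t p' - \<iota> c)) 1" "vge v (\<iota> (poly q (X i)) * (pev \<iota> t p' - \<iota> (poly p' 0))) 1"
          by (auto intro!: vge_mult0 3 c vge_const simp: in_L psi_in x_in t_in)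
        show ?thesis
          by (intro vge_diff T1 T2 T3) (auto simp: in_L psi_in x_in t_in)
      qed
      finally show ?thesis by (rule vge_const_pos)
    qed
    have "b i * (c1 - c2) = (poly q (X i) * poly p' 0 + b i * c1) - (poly q (X i) * poly p' 0 + b i * c2)"
      by (simp add: algebra_simps)
    also have "\<dots> = 0" using rel[OF vv(1,3,4) vv(8)[unfolded w]] rel[OF vv(2,5,6) vv(9)[unfolded w]] by simp
    finally show ?thesis using vv(7) by simp
  qed
  have qsmall: "vge v (pev \<iota> x q) (v t)"
    if pl: "place \<iota> L v" and v: "v (x - \<iota> c) > 0" "v t > 0" for v c
  proof -
    interpret place \<iota> L v by fact
    have "vge v (u - (\<Sum>j\<in>J. \<iota> (b j) * (psi j - pev \<iota> x (psi_fibre j)))) (v t)"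
      using small[OF pl v(2), folded u_def] part[OF pl v(2) v(1)]
      by (intro vge_diff) (auto simp: in_L psi_in x_in uL)
    also have "u - (\<Sum>j\<in>J. \<iota> (b j) * (psi j - pev \<iota> x (psi_fibre j))) = pev \<iota> x q"
      unfolding usum using bI rhom_0[OF hom] by simp
    finally show ?thesis .
  qed
  define PI where "PI S = (\<Prod>i\<in>S. [:- X i, 1:])" for S
  have PI0: "PI S \<noteq> 0" for S by (cases "finite S") (auto simp: PI_def)
  have PIroot: "poly (PI S) (X i) = 0 \<longleftrightarrow> i \<in> S" if "S \<subseteq> N" "i \<in> N" for S i
    using that fin by (auto simp: PI_def poly_prod Xeq finite_subset[of S N] subset_iff)
  have PIdeg: "degree (PI S) = card S" for S
    unfolding PI_def by (subst degree_prod_eq_sum_degree) auto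
  \<comment> \<open>At a node the order of \<open>q\<close> may fall short of the multiplicity by one, which the factor of \<open>PI I\<close> makes up for.\<close>
  have dvd: "g dvd q * PI I"
  proof (cases "q = 0")
    case False
    show ?thesis
    proof (rule dvd_if_order_le)
      show "g \<noteq> 0" "q * PI I \<noteq> 0" using g False PI0 by auto
      fix c assume c: "poly g c = 0"
      obtain h where h: "g = [:- c, 1:] ^ order c g * h" "\<not> [:- c, 1:] dvd h"
        using order_decomp[OF g(1), of c] by blast
      have hc: "poly h c \<noteq> 0" using h(2) by (simp add: poly_eq_0_iff_dvd)
      have m: "order c g > 0" using c g by (simp add: order_root)
      have ord: "order c (q * PI I) = order c q + order c (PI I)" using False PI0 by (intro order_mult) auto
      show "order c g \<le> order c (q * PI I)"
      proof (cases "c \<in> X ` I")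
        case False
        from smooth[OF h(1) hc m False] obtain v where v: "place \<iota> L v" "v (x - \<iota> c) > 0" "v t > 0"
          "(int (order c g) - 1) * v (x - \<iota> c) < v t" by blast
        have "vge v (pev \<iota> x q) (v t)" using qsmall[OF v(1-3)] .
        then have "int (order c q) * v (x - \<iota> c) \<ge> v t"
          using place.pev_order[OF v(1) x_in v(2) \<open>q \<noteq> 0\<close>] by (simp add: vge_def)
        then have "(int (order c g) - 1) * v (x - \<iota> c) < int (order c q) * v (x - \<iota> c)" using v(4) by simp
        then have "int (order c g) - 1 < int (order c q)" using v(2) mult_less_cancel_right_pos by blast
        then show ?thesis unfolding ord by simp
      next
        case True
        then obtain i where i: "i \<in> I" "c = X i" by auto
        from nodal[OF i(1) h(1)[unfolded i(2)] hc[unfolded i(2)]] obtain v where v: "place \<iota> L v" "v (x - \<iota> c) > 0" "v t > 0"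
          "(int (order c g) - 2) * v (x - \<iota> c) < v t" unfolding i(2) by blast
        have "vge v (pev \<iota> x q) (v t)" using qsmall[OF v(1-3)] .
        then have "int (order c q) * v (x - \<iota> c) \<ge> v t"
          using place.pev_order[OF v(1) x_in v(2) \<open>q \<noteq> 0\<close>] by (simp add: vge_def)
        then have "(int (order c g) - 2) * v (x - \<iota> c) < int (order c q) * v (x - \<iota> c)" using v(4) by simp
        then have "int (order c g) - 2 < int (order c q)" using v(2) mult_less_cancel_right_pos by blast
        moreover have "poly (PI I) c = 0" using PIroot[of I i] I i by auto
        then have "order c (PI I) > 0" using PI0 by (simp add: order_root)
        ultimately show ?thesis unfolding ord by simp
      qed
    qed
  qed simp
  define be where "be j = b j / poly (p j) 0" for j
  define N0 where "N0 = smult b0 (PI J) + (\<Sum>j\<in>J. smult (be j * poly g (X j)) (PI (J - {j})))"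
  define S where "S = (\<Sum>j\<in>J. smult (be j) (PI (J - {j})))"
  have PJ: "PI J = [:- X j, 1:] * PI (J - {j})" if "j \<in> J" for j
    using that fin by (simp add: PI_def prod.remove[of J j])
  have gX: "g = [:- X j, 1:] * fibre (cofactor j) + [:poly g (X j):]" "poly g (X j) = poly (poly \<gamma> [:X j:]) 0" for j
  proof -
    have "fibre \<gamma> = fibre ([:- [:X j:], 1:] * cofactor j + [:poly \<gamma> [:X j:]:])" using cofactor_eq[of j] by (rule arg_cong)
    also have "\<dots> = [:- X j, 1:] * fibre (cofactor j) + [:poly (poly \<gamma> [:X j:]) 0:]"
      by (simp only: rhom_simps[OF rhom_fibre]) simp
    finally have *: "g = [:- X j, 1:] * fibre (cofactor j) + [:poly (poly \<gamma> [:X j:]) 0:]" unfolding g_def .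
    from arg_cong[OF this, of "\<lambda>P. poly P (X j)"] show "poly g (X j) = poly (poly \<gamma> [:X j:]) 0" by simp
    then show "g = [:- X j, 1:] * fibre (cofactor j) + [:poly g (X j):]" using * by simp
  qed
  have psiJ: "smult (b j) (psi_fibre j) * PI J = smult (be j * poly g (X j)) (PI (J - {j})) - g * smult (be j) (PI (J - {j}))"
    if j: "j \<in> J" for j
  proof -
    have "g = [:- X j, 1:] * fibre (cofactor j) + [:poly g (X j):]" by (rule gX(1))
    then have gA: "g - [:poly g (X j):] = [:- X j, 1:] * fibre (cofactor j)" by (rule diff_eq_eq[THEN iffD2])
    have "smult (b j) (psi_fibre j) = - smult (be j) (fibre (cofactor j))"
      by (simp add: psi_fibre_def be_def divide_inverse)
    then have "smult (b j) (psi_fibre j) * PI J = - smult (be j) (([:- X j, 1:] * fibre (cofactor j)) * PI (J - {j}))"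
    proof -
      have "(- smult b F) * (A * P) = - smult b ((A * F) * P)" for A F P :: "'a poly" and b by (simp add: mult_ac)
      then show ?thesis unfolding PJ[OF j] \<open>smult (b j) (psi_fibre j) = _\<close> .
    qed
    also have "\<dots> = smult (be j * poly g (X j)) (PI (J - {j})) - g * smult (be j) (PI (J - {j}))"
      unfolding gA[symmetric] by (simp add: left_diff_distrib smult_diff_right)
    finally show ?thesis .
  qed
  have qPJ: "q * PI J = N0 - g * S"
  proof -
    have "(\<Sum>j\<in>J. smult (b j) (psi_fibre j)) * PI J
        = (\<Sum>j\<in>J. smult (be j * poly g (X j)) (PI (J - {j})) - g * smult (be j) (PI (J - {j})))"
      unfolding sum_distrib_right by (intro sum.cong refl psiJ)
    moreover have "[:b0:] * PI J = smult b0 (PI J)" by simp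
    ultimately show ?thesis
      unfolding q_def N0_def S_def distrib_right sum_distrib_left sum_subtractf by simp
  qed
  have gN0: "g dvd PI I * N0"
  proof -
    have "N0 = q * PI J + g * S" using qPJ by simp
    then have "PI I * N0 = q * PI I * PI J + g * (S * PI I)" by (simp only: distrib_left mult_ac)
    then show ?thesis using dvd by (metis dvd_add dvd_mult2 dvd_triv_left)
  qed
  \<comment> \<open>The degree of \<open>PI I * N0\<close> is less than that of \<open>g\<close>.\<close>
  have "N0 = 0"
  proof (rule ccontr)
    assume N00: "N0 \<noteq> 0"
    have "degree g \<le> degree (PI I * N0)" using gN0 N00 PI0 by (intro dvd_imp_degree_le) auto
    also have "degree (PI I * N0) = card I + degree N0" using N00 PI0 by (simp add: degree_mult_eq PIdeg)
    finally have le: "degree g \<le> card I + degree N0" .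
    have cardIJ: "card I + card J < k" using cardN NIJ fin by (simp add: card_Un_disjoint)
    have degN0: "degree N0 \<le> card J"
      unfolding N0_def
    proof (intro degree_add_le degree_sum_le)
      show "degree (smult b0 (PI J)) \<le> card J" using degree_smult_le[of b0 "PI J"] by (simp add: PIdeg)
      show "degree (smult (be j * poly g (X j)) (PI (J - {j}))) \<le> card J" if "j \<in> J" for j
        using degree_smult_le[of "be j * poly g (X j)" "PI (J - {j})"] fin that by (simp add: PIdeg)
    qed (rule fin)
    show False
    proof (cases "degree g < k")
      case False
      then show ?thesis using le cardIJ degN0 by simp
    next
      case True
      from infinity[OF this] obtain v where pl: "place \<iota> L v" and v: "v (1 / x) > 0" "v t > 0"
        "(int (k - degree g) - 1) * v (1 / x) < v t" by blast
      interpret place \<iota> L v by fact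
      have xn: "x \<noteq> 0" using x_ne[of 0] by (simp add: rhom_0[OF hom])
      have vx: "v (1 / x) = - v x" using x_in xn by (simp add: v_divide in_L v_1)
      have vxneg: "v x < 0" using v(1) vx by simp
      \<comment> \<open>Modulo \<open>t\<close> and near \<open>x = \<infinity>\<close>, the combination is \<open>N0 / PI J\<close>.\<close>
      define z where "z = \<iota> b0 + (\<Sum>j\<in>J. \<iota> (be j * poly g (X j)) / (x - \<iota> (X j)))"
      have vxj: "v (x - \<iota> c) = v x" for c
        using pev_pole[OF x_in vxneg, of "[:- c, 1:]"] by (simp add: hom rhom_simps[OF hom])
      have close: "vge v (psi j - \<iota> (poly g (X j) / poly (p j) 0) / (x - \<iota> (X j))) (v t)" if j: "j \<in> J" for j
      proof -
        have jN: "j \<in> N" "poly (p j) 0 \<noteq> 0" using j p_unit[of j] by (auto simp: J_def)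
        obtain c G' where G': "G j = pCons c G'" by (cases "G j")
        have "poly g (X j) / poly (p j) 0 = c" using jN gX(2)[of j] by (simp add: factor G')
        then have "psi j - \<iota> (poly g (X j) / poly (p j) 0) / (x - \<iota> (X j)) = pev \<iota> t G' * t / (x - \<iota> (X j))"
          by (simp add: psi_def G' hom diff_divide_distrib[symmetric] mult.commute)
        also have "vge v \<dots> (v t - v (x - \<iota> (X j)))" using vge_pos(2)[OF v(2)] x_diff_nz
          by (intro vge_divide vge_mult0 vge_pev vge_self) (auto simp: in_L x_in t_in)
        finally show ?thesis using vxneg by (auto intro: vge_mono simp: vxj)
      qed
      have uz: "u - z = (\<Sum>j\<in>J. \<iota> (b j) * (psi j - \<iota> (poly g (X j) / poly (p j) 0) / (x - \<iota> (X j))))"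
      proof -
        have "u = \<iota> b0 + (\<Sum>j\<in>J. \<iota> (b j) * psi j)"
          unfolding u_def NIJ(1) using fin NIJ(2) bI by (simp add: sum.union_disjoint rhom_0[OF hom])
        then show ?thesis
          by (simp add: z_def be_def sum_subtractf right_diff_distrib mult.assoc divide_inverse rhom_simps[OF hom] mult_ac)
      qed
      have duz: "vge v (u - z) (v t)" unfolding uz
        by (intro vge_sum vge_mult0 close) (auto simp: in_L psi_in x_in vge_const)
      have zL: "z \<in> L" by (auto simp: z_def in_L x_in)
      have "vge v (u - (u - z)) (v t)"
        by (rule vge_diff[OF uL diff_in[OF uL zL] small[OF pl v(2), folded u_def] duz])
      moreover have "u - (u - z) = z" by simp
      ultimately have vz: "vge v z (v t)" by metis
      have zN0: "z * pev \<iota> x (PI J) = pev \<iota> x N0"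
      proof -
        have "\<iota> (be j * poly g (X j)) / (x - \<iota> (X j)) * pev \<iota> x (PI J)
            = pev \<iota> x (smult (be j * poly g (X j)) (PI (J - {j})))" if "j \<in> J" for j
          unfolding PJ[OF that] e using x_diff_nz[of "X j"] by (simp add: hom pev_smult rhom_simps[OF hom])
        then show ?thesis by (simp add: z_def N0_def distrib_right sum_distrib_right e pev_smult[OF hom])
      qed
      have P: "pev \<iota> x (PI J) \<noteq> 0" "v (pev \<iota> x (PI J)) = int (card J) * v x"
        using pev_pole[OF x_in vxneg PI0[of J]] by (simp_all add: PIdeg)
      have Q: "pev \<iota> x N0 \<noteq> 0" "v (pev \<iota> x N0) = int (degree N0) * v x"
        using pev_pole[OF x_in vxneg N00] by simp_all
      have zn: "z \<noteq> 0" using zN0 Q by auto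
      have "v z + v (pev \<iota> x (PI J)) = v (pev \<iota> x N0)"
        unfolding zN0[symmetric] using zn P(1) by (intro v_mult[symmetric]) (auto simp: in_L x_in z_def)
      then have "v z = int (degree N0) * v x - int (card J) * v x" using P Q by simp
      also have "\<dots> = (int (card J) - int (degree N0)) * v (1 / x)" unfolding vx by (simp add: algebra_simps)
      finally have "(int (k - degree g) - 1) * v (1 / x) < (int (card J) - int (degree N0)) * v (1 / x)"
        using vz zn v(3) by (simp add: vge_def)
      then have "int (k - degree g) - 1 < int (card J) - int (degree N0)"
        using v(1) mult_less_cancel_right_pos by blast
      then show False using le cardIJ True by simp
    qed
  qed
  have JN: "J \<subseteq> N" by (auto simp: J_def)
  have sumX: "poly (\<Sum>j\<in>J. smult (a j) (PI (J - {j}))) (X i) = a i * poly (PI (J - {i})) (X i)" if i: "i \<in> J" for a i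
  proof -
    have "poly (\<Sum>j\<in>J. smult (a j) (PI (J - {j}))) (X i) = (\<Sum>j\<in>J. if j = i then a i * poly (PI (J - {i})) (X i) else 0)"
      unfolding poly_sum using i JN PIroot[of "J - {_}" i] by (intro sum.cong) auto
    then show ?thesis using i fin by simp
  qed
  have PIi: "poly (PI (J - {i})) (X i) \<noteq> 0" if "i \<in> J" for i using PIroot[of "J - {i}" i] that JN by auto
  have z: "be j * poly g (X j) = 0" if j: "j \<in> J" for j
  proof -
    have "poly N0 (X j) = be j * poly g (X j) * poly (PI (J - {j})) (X j)"
      unfolding N0_def using PIroot[of J j] JN j sumX[OF j, of "\<lambda>j. be j * poly g (X j)"] by auto
    then show ?thesis using \<open>N0 = 0\<close> PIi[OF j] by simp
  qed
  have "N0 = smult b0 (PI J)" unfolding N0_def using z by (auto intro!: sum.neutral)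
  then have b0: "b0 = 0" using \<open>N0 = 0\<close> PI0 by simp
  obtain q' where q': "q * PI I = g * q'" using dvd by (auto elim: dvdE)
  have "g * (q' * PI J) = g * (- (PI I * S))"
  proof -
    have "g * (q' * PI J) = (q * PI J) * PI I" using q' by (simp add: mult_ac)
    also have "\<dots> = g * (- (PI I * S))" unfolding qPJ \<open>N0 = 0\<close> by (simp add: mult_ac)
    finally show ?thesis .
  qed
  then have q'S: "q' * PI J = - (PI I * S)" using g(1) mult_left_cancel by blast
  have "b j = 0" if j: "j \<in> J" for j
  proof -
    have "poly (PI I) (X j) * (be j * poly (PI (J - {j})) (X j)) = 0"
      using arg_cong[OF q'S, of "\<lambda>P. poly P (X j)"] PIroot[of J j] JN j sumX[OF j, of be] by (auto simp: S_def)
    moreover have "poly (PI I) (X j) \<noteq> 0" using PIroot[of I j] I j by (auto simp: J_def)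
    ultimately have "be j = 0" using PIi[OF j] by simp
    then show ?thesis using p_unit[of j] j by (simp add: be_def J_def)
  qed
  then show ?thesis using b0 bI NIJ(1) by blast
qed

end

section \<open>The nodal curve along the fibres of the second projection\<close>

lemma generic_point_linear:
  fixes \<iota> :: "'a::alg_closed_field \<Rightarrow> 'b::field"
  assumes hom: "rhom \<iota>" and gp: "generic_point \<iota> k a \<Gamma> \<xi> \<eta>" and ka: "k > 0" "a > 0" and e: "(e0, e1) \<noteq> (0, 0)"
  shows "fst (rep_P1 \<xi>) * \<iota> e1 - snd (rep_P1 \<xi>) * \<iota> e0 \<noteq> 0"
    and "fst (rep_P1 \<eta>) * \<iota> e1 - snd (rep_P1 \<eta>) * \<iota> e0 \<noteq> 0"
proof -
  have ge: "eval_form \<iota> m n G (rep_P1 \<xi>) (rep_P1 \<eta>) \<noteq> 0" if "biform m n G" "G \<noteq> 0" "m < k \<or> n < a" for m n G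
    using gp that ka by (auto simp: generic_point_def form_dvd_def)
  have "eval_form \<iota> 1 0 [:[:e1:], [:- e0:]:] (rep_P1 \<xi>) (rep_P1 \<eta>) \<noteq> 0"
    by (rule ge) (use e ka in \<open>auto simp: biform_def coeff_pCons split: nat.splits\<close>)
  then show "fst (rep_P1 \<xi>) * \<iota> e1 - snd (rep_P1 \<xi>) * \<iota> e0 \<noteq> 0"
    by (simp add: eval_form_def rhom_minus[OF hom] mult.commute)
  have "eval_form \<iota> 0 1 [:[:e1, - e0:]:] (rep_P1 \<xi>) (rep_P1 \<eta>) \<noteq> 0"
    by (rule ge) (use e ka in \<open>auto simp: biform_def coeff_pCons split: nat.splits\<close>)
  then show "fst (rep_P1 \<eta>) * \<iota> e1 - snd (rep_P1 \<eta>) * \<iota> e0 \<noteq> 0"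
    by (simp add: eval_form_def rhom_minus[OF hom] mult.commute)
qed

lemma poly_eq_if_cofinite:
  fixes p q :: "'a::alg_closed_field poly"
  assumes "finite S" "\<And>x. x \<notin> S \<Longrightarrow> poly p x = poly q x"
  shows "p = q"
  using poly_zero_if_cofinite[of S "p - q"] assms by simp

lemma poly_frame_line:
  fixes \<Gamma> :: "'a::field poly poly"
  assumes "rhom h"
  shows "pev h y (poly (frame_equation k a \<Gamma> A B) [:c:]) = eval_form h k a \<Gamma> (frm h A (h c)) (frm h B y)"
  using ev_conv_poly[OF assms, of c y "frame_equation k a \<Gamma> A B"] ev_frame_equation[OF assms, of "h c" y k a \<Gamma> A B] by simp

lemma poly_fibre_frame:
  fixes \<Gamma> :: "'a::field poly poly"
  shows "poly (fibre (frame_equation k a \<Gamma> A B)) c = eval_form id k a \<Gamma> (frm id A c) (fst B)"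
proof -
  have "poly (fibre G) c = ev id c 0 G" for G :: "'a poly poly"
    by (induction G) (simp_all add: rhom_id pev_id)
  then show ?thesis by (simp add: ev_frame_equation[OF rhom_id(1)] frm_def)
qed

context plane_model
begin

lemma x_not_const: "x \<noteq> \<iota> c"
proof
  assume "x = \<iota> c"
  have bi: "biform 1 0 ([:- [:c:], 1:] :: 'a poly poly)" by (auto simp: biform_def coeff_pCons split: nat.splits)
  have "ev \<iota> x y [:- [:c:], 1:] \<noteq> 0" using indep[OF bi] apos by auto
  then show False using \<open>x = \<iota> c\<close> hom by (simp add: rhom_simps rhom_simps[OF rhom_pev[OF hom]])
qed

text \<open>Neither the fibre \<open>y = 0\<close> nor a line \<open>x = c\<close> is a component: the cofactor would be an equation of
  smaller bidegree.\<close>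

lemma fibre_nonzero: "fibre \<gamma> \<noteq> 0"
proof
  assume 0: "fibre \<gamma> = 0"
  define d where "d = map_poly (poly_shift 1) \<gamma>"
  have cd: "coeff (coeff d i) j = coeff (coeff \<gamma> i) (Suc j)" for i j
    by (simp add: d_def coeff_map_poly poly_shift_0 coeff_poly_shift)
  have eq: "\<gamma> = smult [:0, 1:] d"
  proof (intro poly_eqI)
    fix i j
    have "coeff (coeff \<gamma> i) 0 = 0" using arg_cong[OF 0, of "\<lambda>p. coeff p i"] by (simp add: coeff_fibre cf_def)
    then show "coeff (coeff \<gamma> i) j = coeff (coeff (smult [:0, 1:] d) i) j"
      by (simp add: coeff_pCons cd split: nat.splits)
  qed
  have "biform k (a - 1) d" unfolding biform_def
  proof (intro conjI allI degree_le impI)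
    show "coeff d i = 0" if "k < i" for i
      using that biform by (intro poly_eqI) (simp add: cd biform_def coeff_eq_0)
    show "coeff (coeff d i) j = 0" if "a - 1 < j" for i j
    proof -
      have "degree (coeff \<gamma> i) < Suc j" using that biform by (auto simp: biform_def intro: le_less_trans)
      then show ?thesis by (simp add: cd coeff_eq_0)
    qed
  qed
  moreover have "ev \<iota> x y d = 0"
  proof -
    have "y * ev \<iota> x y d = ev \<iota> x y \<gamma>" by (subst eq) (simp add: ev_smult[OF hom] hom rhom_simps[OF hom])
    then show ?thesis using zero y_nonzero by simp
  qed
  ultimately have "d = 0" using indep[of k "a - 1" d] apos by auto
  then show False using eq nz by simp
qed

lemma line_nonzero: "poly \<gamma> [:c:] \<noteq> 0"
proof
  assume 0: "poly \<gamma> [:c:] = 0"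
  define q where "q = synthetic_div \<gamma> [:c:]"
  have eq: "\<gamma> = [:- [:c:], 1:] * q" using synthetic_div_correct'[of "[:c:]" \<gamma>] 0 by (simp add: q_def)
  have "q \<noteq> 0" using eq nz by auto
  have "degree q = degree \<gamma> - 1" unfolding q_def by (rule degree_synthetic_div)
  moreover have "degree \<gamma> \<le> k" using biform by (simp add: biform_def)
  ultimately have "degree q < k" using kpos by linarith
  then have "ev \<iota> x y q \<noteq> 0" using \<open>q \<noteq> 0\<close> by (rule ev_low_degree_nonzero)
  moreover have "(x - \<iota> c) * ev \<iota> x y q = 0"
  proof -
    have "ev \<iota> x y [:- [:c:], 1:] = x - \<iota> c" using hom by (simp add: rhom_simps rhom_simps[OF rhom_pev[OF hom]])
    then show ?thesis using zero eq rhom_mult[OF rhom_ev[OF hom], of x y "[:- [:c:], 1:]" q] by simp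
  qed
  ultimately show False using x_not_const by simp
qed

end

locale nodal_setup =
  fixes \<iota> :: "'a::alg_closed_field \<Rightarrow> 'b::field" and k a :: nat and \<Gamma> :: "'a poly poly"
    and \<xi> \<eta> :: "'b P1" and N :: "nat set" and P :: "nat \<Rightarrow> 'a P1" and S :: "nat \<Rightarrow> 'a P1 set" and eps :: 'a
  assumes hom: "rhom \<iota>" and k: "k \<ge> 2" and a: "a \<ge> 1" and curve: "curve_of_type k a \<Gamma>"
    and nodal: "nodal_curve k a \<Gamma>" and generic: "generic_point \<iota> k a \<Gamma> \<xi> \<eta>"
    and N: "finite N" "card N = k - 1" "inj_on P N" and S: "\<And>i. i \<in> N \<Longrightarrow> finite (S i)"
    and nodes: "nodes k a \<Gamma> = (\<Union>i\<in>N. {P i} \<times> S i)"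
    and eps: "\<And>i. i \<in> N \<Longrightarrow> snd (rep_P1 (P i)) \<noteq> eps * fst (rep_P1 (P i))"
begin

abbreviation "K \<equiv> function_field \<iota> \<xi> \<eta>"

text \<open>The coordinate on the first factor has its pole at the point \<open>(1 : eps)\<close>, which is none of the \<open>P i\<close>; so
  the lines with nodes lie in the affine chart.\<close>

definition A :: "'a \<Rightarrow> 'a frame" where
  "A c = ((c, 1 + c * eps), (1, eps))"

definition Ainf :: "'a frame" where
  "Ainf = ((1, eps), (0, 1))"

definition X :: "nat \<Rightarrow> 'a" where
  "X i = fst (rep_P1 (P i)) / (snd (rep_P1 (P i)) - eps * fst (rep_P1 (P i)))"

lemma fdet_A: "fdet (A c) \<noteq> 0" "fdet Ainf \<noteq> 0"
  by (simp_all add: fdet_def A_def Ainf_def)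

lemma frm_A: "frm h (A c) z = frm h (A 0) (h c + z)" if "rhom h" for h :: "'a \<Rightarrow> 'c::comm_ring_1"
  using that by (simp add: frm_def A_def rhom_simps algebra_simps)

lemma X_point: assumes "i \<in> N" shows "proportional (fst (A (X i))) (rep_P1 (P i))"
proof -
  let ?p = "fst (rep_P1 (P i))" and ?q = "snd (rep_P1 (P i))"
  have "?q - eps * ?p \<noteq> 0" using eps[OF assms] by simp
  then show ?thesis unfolding proportional_def
    by (intro exI[of _ "1 / (?q - eps * ?p)"]) (simp add: A_def X_def field_simps)
qed

lemma point_X:
  assumes i: "i \<in> N" and c: "proportional (fst (A c)) (rep_P1 (P i))" shows "c = X i"
proof -
  let ?p = "fst (rep_P1 (P i))" and ?q = "snd (rep_P1 (P i))"
  obtain l where l: "l \<noteq> 0" "c = l * ?p" "1 + c * eps = l * ?q" using c by (auto simp: proportional_def A_def)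
  have "?q - eps * ?p \<noteq> 0" using eps[OF i] by simp
  moreover have "l * (?q - eps * ?p) = 1" using l by (simp add: algebra_simps)
  ultimately have "l = 1 / (?q - eps * ?p)" by (simp add: field_simps)
  then show ?thesis using l(2) by (simp add: X_def)
qed

lemma proportional_same_point:
  assumes "proportional u (rep_P1 R)" "proportional u (rep_P1 R')" shows "R = R'"
proof (rule rep_P1_inject_prop)
  obtain c where "c \<noteq> 0" "u = (c * fst (rep_P1 R), c * snd (rep_P1 R))"
    using assms(1) unfolding proportional_def by blast
  moreover obtain c' where "c' \<noteq> 0" "u = (c' * fst (rep_P1 R'), c' * snd (rep_P1 R'))"
    using assms(2) unfolding proportional_def by blast
  ultimately have "c * fst (rep_P1 R) = c' * fst (rep_P1 R')" "c * snd (rep_P1 R) = c' * snd (rep_P1 R')" "c' \<noteq> 0" "c \<noteq> 0" by simp_all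
  then have "c * c' * (fst (rep_P1 R) * snd (rep_P1 R')) = c * c' * (snd (rep_P1 R) * fst (rep_P1 R'))" by algebra
  then show "fst (rep_P1 R) * snd (rep_P1 R') = snd (rep_P1 R) * fst (rep_P1 R')" using \<open>c \<noteq> 0\<close> \<open>c' \<noteq> 0\<close> by simp
qed

lemma proportional_ex: "u \<noteq> (0, 0) \<Longrightarrow> \<exists>R. proportional u (rep_P1 R)"
  using rep_P1_surj[of u] unfolding proportional_def by metis

lemma inj_X: "inj_on X N"
proof (rule inj_onI)
  fix i j assume ij: "i \<in> N" "j \<in> N" "X i = X j"
  have "P i = P j" using proportional_same_point[OF X_point[OF ij(1)]] X_point[OF ij(2)] ij(3) by simp
  then show "i = j" using N ij by (auto simp: inj_on_def)
qed

lemma x_ex: "\<exists>x. proportional (rep_P1 \<xi>) (frm \<iota> (A 0) x)"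
proof -
  have "fst (rep_P1 \<xi>) * \<iota> eps - snd (rep_P1 \<xi>) * \<iota> 1 \<noteq> 0"
    by (rule generic_point_linear(1)[OF hom generic]) (use k a in auto)
  then show ?thesis using frm_param[OF fdet_A(1)[of 0] hom, of "rep_P1 \<xi>"] by (auto simp: A_def)
qed

definition x :: 'b where "x = (SOME x. proportional (rep_P1 \<xi>) (frm \<iota> (A 0) x))"

lemma x: "proportional (rep_P1 \<xi>) (frm \<iota> (A 0) x)"
  unfolding x_def by (rule someI_ex[OF x_ex])

lemma x_shift: "proportional (rep_P1 \<xi>) (frm \<iota> (A c) (x - \<iota> c))"
  unfolding frm_A[OF hom, of c] using x by simp

definition coord :: "'a frame \<Rightarrow> 'b \<Rightarrow> bool" where
  "coord B t \<longleftrightarrow> fdet B \<noteq> 0 \<and> proportional (rep_P1 \<eta>) (frm \<iota> B t)"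

lemma coord_ex: assumes "fdet B \<noteq> 0" obtains t where "coord B t"
proof -
  have "(fst (snd B), snd (snd B)) \<noteq> (0, 0)" using assms by (auto simp: fdet_def)
  then have "fst (rep_P1 \<eta>) * \<iota> (snd (snd B)) - snd (rep_P1 \<eta>) * \<iota> (fst (snd B)) \<noteq> 0"
    by (rule generic_point_linear(2)[OF hom generic, rotated -1]) (use k a in auto)
  then obtain t where "proportional (rep_P1 \<eta>) (frm \<iota> B t)" by (rule frm_param[OF assms hom])
  then have "coord B t" using assms by (simp add: coord_def)
  then show thesis by (rule that)
qed

abbreviation gam :: "'a frame \<Rightarrow> 'a poly poly" where
  "gam B \<equiv> frame_equation k a \<Gamma> (A 0) B"

lemma model: assumes "coord B t" shows "plane_model \<iota> K k a (frame_equation k a \<Gamma> (A c) B) (x - \<iota> c) t"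
  by (rule generic_point_plane_model[OF hom generic curve _ _ fdet_A(1) _ x_shift])
    (use assms k a in \<open>auto simp: coord_def\<close>)

lemma model0: assumes "coord B t" shows "plane_model \<iota> K k a (gam B) x t"
  using model[OF assms, of 0] by (simp add: rhom_0[OF hom])

lemma model_inf: assumes B: "coord B t" shows "plane_model \<iota> K k a (frame_equation k a \<Gamma> Ainf B) (1 / x) t"
proof -
  interpret plane_model \<iota> K k a "gam B" x t by (rule model0[OF B])
  have "frm \<iota> (A 0) x = (x * fst (frm \<iota> Ainf (1 / x)), x * snd (frm \<iota> Ainf (1 / x)))"
    using x_nonzero by (simp add: frm_def A_def Ainf_def rhom_simps[OF hom] field_simps)
  then have "proportional (rep_P1 \<xi>) (frm \<iota> Ainf (1 / x))"
  proof -
    obtain l where "l \<noteq> 0" "rep_P1 \<xi> = (l * fst (frm \<iota> (A 0) x), l * snd (frm \<iota> (A 0) x))"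
      using x unfolding proportional_def by blast
    then show ?thesis using x_nonzero \<open>frm \<iota> (A 0) x = _\<close> unfolding proportional_def
      by (intro exI[of _ "l * x"]) (simp add: mult.assoc)
  qed
  then show ?thesis
    by (rule generic_point_plane_model[OF hom generic curve _ _ fdet_A(2), rotated -2])
      (use B k a in \<open>auto simp: coord_def\<close>)
qed

text \<open>The linear form vanishing at \<open>R\<close>, in the frame \<open>B\<close>.\<close>

definition lin :: "'a frame \<Rightarrow> 'a P1 \<Rightarrow> 'a poly" where
  "lin B R = [: fst (rep_P1 R) * snd (fst B) - snd (rep_P1 R) * fst (fst B),
                fst (rep_P1 R) * snd (snd B) - snd (rep_P1 R) * fst (snd B) :]"

lemma pev_lin:
  assumes "rhom h"
  shows "pev h t (lin B R) = h (fst (rep_P1 R)) * snd (frm h B t) - h (snd (rep_P1 R)) * fst (frm h B t)"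
  using assms by (simp add: lin_def frm_def rhom_simps algebra_simps)

lemma frm_nonzero: assumes "fdet B \<noteq> 0" shows "frm id B (c::'a) \<noteq> (0, 0)"
proof
  assume "frm id B c = (0, 0)"
  then have 0: "fst (fst B) + c * fst (snd B) = 0" "snd (fst B) + c * snd (snd B) = 0" by (auto simp: frm_def)
  have "fdet B = (fst (fst B) + c * fst (snd B)) * snd (snd B) - (snd (fst B) + c * snd (snd B)) * fst (snd B)"
    by (simp add: fdet_def algebra_simps)
  then show False using assms 0 by simp
qed

lemma lin_root: assumes "fdet B \<noteq> 0" shows "poly (lin B R) c = 0 \<longleftrightarrow> proportional (frm id B c) (rep_P1 R)"
proof -
  have *: "poly (lin B R) c = fst (rep_P1 R) * snd (frm id B c) - snd (rep_P1 R) * fst (frm id B c)"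
    using pev_lin[OF rhom_id(1), of c B R] by (simp add: pev_id)
  obtain R' where R': "proportional (frm id B c) (rep_P1 R')" using proportional_ex frm_nonzero[OF assms] by blast
  then obtain l where l: "l \<noteq> 0" "frm id B c = (l * fst (rep_P1 R'), l * snd (rep_P1 R'))" by (auto simp: proportional_def)
  have "poly (lin B R) c = l * (fst (rep_P1 R) * snd (rep_P1 R') - snd (rep_P1 R) * fst (rep_P1 R'))"
    unfolding * l by (simp add: algebra_simps)
  then have "poly (lin B R) c = 0 \<Longrightarrow> R = R'" using l(1) by (intro rep_P1_inject_prop) auto
  moreover have "proportional (frm id B c) (rep_P1 R) \<Longrightarrow> poly (lin B R) c = 0"
    unfolding * by (auto simp: proportional_def)
  ultimately show ?thesis using R' by blast
qed

lemma lin_nonzero: assumes "fdet B \<noteq> 0" shows "lin B R \<noteq> 0"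
proof
  assume 0: "lin B R = 0"
  have "poly (lin B R) 0 = 0" "poly (lin B R) 1 = 0" using 0 by simp_all
  then have "proportional (frm id B 0) (rep_P1 R)" "proportional (frm id B 1) (rep_P1 R)" by (simp_all add: lin_root[OF assms])
  then obtain l l' where fl: "frm id B 0 = (l * fst (rep_P1 R), l * snd (rep_P1 R))"
    "frm id B 1 = (l' * fst (rep_P1 R), l' * snd (rep_P1 R))"
    unfolding proportional_def by blast
  then have l: "fst B = (l * fst (rep_P1 R), l * snd (rep_P1 R))"
    "fst (fst B) + fst (snd B) = l' * fst (rep_P1 R)" "snd (fst B) + snd (snd B) = l' * snd (rep_P1 R)"
    by (simp_all add: frm_def prod_eq_iff)
  have "fdet B = fst (fst B) * (snd (fst B) + snd (snd B)) - snd (fst B) * (fst (fst B) + fst (snd B))"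
    by (simp add: fdet_def algebra_simps)
  also have "\<dots> = 0" unfolding l(2,3) by (simp add: l(1))
  finally show False using assms by simp
qed

definition nodepoly :: "'a frame \<Rightarrow> nat \<Rightarrow> 'a poly" where
  "nodepoly B i = (\<Prod>R\<in>S i. lin B R)"

definition quot :: "'a frame \<Rightarrow> nat \<Rightarrow> 'a poly" where
  "quot B i = poly (gam B) [:X i:] div nodepoly B i"

lemma nodepoly_nonzero: "fdet B \<noteq> 0 \<Longrightarrow> nodepoly B i \<noteq> 0"
  by (cases "finite (S i)") (auto simp: nodepoly_def lin_nonzero)

lemma nodepoly_root:
  assumes B: "fdet B \<noteq> 0" and i: "i \<in> N" and c: "poly (nodepoly B i) c = 0"
  obtains R q where "R \<in> S i" "proportional (frm id B c) (rep_P1 R)" "nodepoly B i = lin B R * q" "poly q c \<noteq> 0"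
proof -
  obtain R where R: "R \<in> S i" "poly (lin B R) c = 0" using c S[OF i] by (auto simp: nodepoly_def poly_prod)
  have "poly (\<Prod>R\<in>S i - {R}. lin B R) c \<noteq> 0"
  proof
    assume "poly (\<Prod>R\<in>S i - {R}. lin B R) c = 0"
    then obtain R' where "R' \<in> S i - {R}" "poly (lin B R') c = 0" using S[OF i] by (auto simp: poly_prod)
    then have "R' = R" using R(2) unfolding lin_root[OF B] by (intro proportional_same_point)
    then show False using \<open>R' \<in> S i - {R}\<close> by simp
  qed
  moreover have "nodepoly B i = lin B R * (\<Prod>R\<in>S i - {R}. lin B R)"
    unfolding nodepoly_def using S[OF i] R(1) by (rule prod.remove)
  moreover have "proportional (frm id B c) (rep_P1 R)" using R(2) by (simp add: lin_root[OF B])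
  ultimately show thesis using that[OF R(1)] by blast
qed

text \<open>Moving the origin to the point with coordinate \<open>c\<close> substitutes \<open>c + X\<close> for \<open>X\<close>.\<close>

lemma coeff_0_frame: "coeff (frame_equation k a \<Gamma> (A c) B) 0 = poly (gam B) [:c:]"
proof (rule poly_eq_if_cofinite[of "{}"])
  fix t
  have "poly (coeff G 0) t = ev id 0 t G" for G :: "'a poly poly" by (cases G) (simp add: rhom_id pev_id)
  then have "poly (coeff (frame_equation k a \<Gamma> (A c) B) 0) t = eval_form id k a \<Gamma> (frm id (A c) 0) (frm id B t)"
    by (simp add: ev_frame_equation[OF rhom_id(1)])
  also have "\<dots> = poly (poly (gam B) [:c:]) t"
    using poly_frame_line[OF rhom_id(1), of t k a \<Gamma> "A 0" B c] by (simp add: pev_id frm_A[OF rhom_id(1), of c])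
  finally show "poly (coeff (frame_equation k a \<Gamma> (A c) B) 0) t = poly (poly (gam B) [:c:]) t" .
qed simp

lemma fibre_shift: "fibre (frame_equation k a \<Gamma> (A c) B) = pcompose (fibre (gam B)) [:c, 1:]"
  by (rule poly_eq_if_cofinite[of "{}"])
    (simp_all add: poly_fibre_frame poly_pcompose frm_A[OF rhom_id(1), of c])

lemma node_frame:
  assumes B: "fdet B \<noteq> 0" and i: "i \<in> N" and R: "R \<in> S i" "proportional (fst B) (rep_P1 R)"
  shows "node_origin (frame_equation k a \<Gamma> (A (X i)) B)"
  by (rule point_in_frame(2)[OF fdet_A(1) B k a nodal X_point[OF i] R(2) refl]) (use nodes i R in auto)

text \<open>A line through a singular point meets the curve there with multiplicity at least two.\<close>

lemma double_root:
  assumes B: "fdet B \<noteq> 0" and i: "i \<in> N" and R: "R \<in> S i" "proportional (frm id B c) (rep_P1 R)"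
  shows "[:- c, 1:] ^ 2 dvd poly (gam B) [:X i:]"
proof -
  define B' where "B' = (frm id B c, snd B)"
  have B': "fdet B' \<noteq> 0" using B by (simp add: fdet_def B'_def frm_def algebra_simps)
  have "node_origin (frame_equation k a \<Gamma> (A (X i)) B')"
    by (rule node_frame[OF B' i R(1)]) (simp add: B'_def R)
  then have "coeff (poly (gam B') [:X i:]) 0 = 0" "coeff (poly (gam B') [:X i:]) 1 = 0"
    by (auto simp: node_origin_def singular_origin_def cf_def coeff_0_frame)
  moreover obtain c0 q0 where 1: "poly (gam B') [:X i:] = pCons c0 q0" by (cases "poly (gam B') [:X i:]")
  moreover obtain c1 q where 2: "q0 = pCons c1 q" by (cases q0)
  ultimately have q: "poly (gam B') [:X i:] = pCons 0 (pCons 0 q)" by simp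
  have "poly (gam B) [:X i:] = pcompose (poly (gam B') [:X i:]) [:- c, 1:]"
  proof (rule poly_eq_if_cofinite[of "{}"])
    fix t
    have "frm id B t = frm id B' (t - c)" by (simp add: frm_def B'_def algebra_simps)
    then show "poly (poly (gam B) [:X i:]) t = poly (pcompose (poly (gam B') [:X i:]) [:- c, 1:]) t"
      using poly_frame_line[OF rhom_id(1), of t k a \<Gamma> "A 0" B "X i"] poly_frame_line[OF rhom_id(1), of "t - c" k a \<Gamma> "A 0" B' "X i"]
      by (simp add: pev_id poly_pcompose)
  qed simp
  also have "\<dots> = [:- c, 1:] ^ 2 * pcompose q [:- c, 1:]"
    unfolding q pcompose_pCons by (simp only: pCons_0_0 add_0_left power2_eq_square mult.assoc)
  finally show ?thesis by (metis dvd_triv_left)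
qed

text \<open>The linear factors of \<open>nodepoly\<close> belong to different points, so its roots are simple, whereas they are
  double roots of the equation on the line.\<close>

lemma nodepoly_dvd: assumes B: "fdet B \<noteq> 0" and i: "i \<in> N" shows "nodepoly B i dvd poly (gam B) [:X i:]"
proof (cases "poly (gam B) [:X i:] = 0")
  case False
  show ?thesis
  proof (rule dvd_if_order_le[OF nodepoly_nonzero[OF B] False])
    fix c assume "poly (nodepoly B i) c = 0"
    then obtain R q where R: "R \<in> S i" "proportional (frm id B c) (rep_P1 R)" "nodepoly B i = lin B R * q" "poly q c \<noteq> 0"
      by (rule nodepoly_root[OF B i])
    have "order c (nodepoly B i) = order c (lin B R) + order c q"
      unfolding R(3) using nodepoly_nonzero[OF B, of i] R(3) by (intro order_mult) simp
    also have "order c q = 0" using R(4) by (rule order_0I)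
    also have "order c (lin B R) \<le> degree (lin B R)" by (rule order_degree[OF lin_nonzero[OF B]])
    also have "\<dots> \<le> 1" by (simp add: lin_def)
    finally have "order c (nodepoly B i) \<le> 1" by simp
    moreover have "2 \<le> order c (poly (gam B) [:X i:])"
      using double_root[OF B i R(1,2)] False by (simp add: order_divides)
    ultimately show "order c (nodepoly B i) \<le> order c (poly (gam B) [:X i:])" by simp
  qed
qed simp

lemma quot_eq: "fdet B \<noteq> 0 \<Longrightarrow> i \<in> N \<Longrightarrow> poly (gam B) [:X i:] = quot B i * nodepoly B i"
  unfolding quot_def by (rule dvd_div_mult_self[symmetric, OF nodepoly_dvd])

definition nodal_lines :: "'a P1 \<Rightarrow> nat set" where
  "nodal_lines Q = {i \<in> N. Q \<in> S i}"

lemma fibre_data: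
  assumes B: "coord B t" and Q: "proportional (fst B) (rep_P1 Q)"
  shows "fibre_data \<iota> K (gam B) x t N (nodal_lines Q) X (quot B) (nodepoly B)
           (\<lambda>i. frame_equation k a \<Gamma> (A (X i)) B)"
proof -
  have det: "fdet B \<noteq> 0" using B by (simp add: coord_def)
  interpret m: plane_model \<iota> K k a "gam B" x t by (rule model0[OF B])
  interpret ff: function_field_over \<iota> K by (rule m.function_field_over)
  have base: "frm id B 0 = fst B" by (simp add: frm_def)
  show ?thesis
  proof
    show "x \<in> K" "t \<in> K" by (rule m.x_in m.y_in)+
    show "ev \<iota> x t (gam B) = 0" by (rule m.zero)
    show "pev \<iota> t q \<noteq> 0" if "q \<noteq> 0" for q using m.pev_nonzero[OF that] .
    show "x \<noteq> \<iota> c" for c by (rule m.x_not_const)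
    show "finite N" "inj_on X N" using N inj_X by auto
    show "nodal_lines Q \<subseteq> N" by (auto simp: nodal_lines_def)
    show "poly (gam B) [:X i:] = quot B i * nodepoly B i" if "i \<in> N" for i using quot_eq[OF det that] .
    show "poly (nodepoly B i) 0 \<noteq> 0" if i: "i \<in> N - nodal_lines Q" for i
    proof
      assume "poly (nodepoly B i) 0 = 0"
      moreover have iN: "i \<in> N" using i by simp
      ultimately obtain R where R: "R \<in> S i" "proportional (frm id B 0) (rep_P1 R)" by (metis nodepoly_root[OF det iN])
      have "R = Q" by (rule proportional_same_point[OF R(2)[unfolded base] Q])
      then show False using i R(1) by (simp add: nodal_lines_def)
    qed
    fix i assume i: "i \<in> nodal_lines Q"
    then have iN: "i \<in> N" and QS: "Q \<in> S i" by (auto simp: nodal_lines_def)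
    have r: "poly (lin B Q) 0 = 0" using Q by (simp add: lin_root[OF det] base)
    then have "poly (nodepoly B i) 0 = 0" using S[OF iN] QS by (auto simp: nodepoly_def poly_prod)
    then obtain R q where R: "R \<in> S i" "proportional (frm id B 0) (rep_P1 R)" "nodepoly B i = lin B R * q" "poly q 0 \<noteq> 0"
      by (rule nodepoly_root[OF det iN])
    have "R = Q" using R(2)[unfolded base] Q by (rule proportional_same_point)
    obtain s where s: "lin B Q = [:0, s:]" using r by (simp add: lin_def)
    have "s \<noteq> 0" using lin_nonzero[OF det, of Q] s by auto
    then show "\<exists>p'. nodepoly B i = pCons 0 p' \<and> poly p' 0 \<noteq> 0"
      using R by (intro exI[of _ "smult s q"]) (simp add: \<open>R = Q\<close> s)
    interpret mi: plane_model \<iota> K k a "frame_equation k a \<Gamma> (A (X i)) B" "x - \<iota> (X i)" t by (rule model[OF B])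
    show "singular_origin (frame_equation k a \<Gamma> (A (X i)) B) \<and>
         coeff (frame_equation k a \<Gamma> (A (X i)) B) 0 = poly (gam B) [:X i:] \<and>
         ev \<iota> (x - \<iota> (X i)) t (frame_equation k a \<Gamma> (A (X i)) B) = 0"
      using node_frame[OF det iN QS Q] mi.zero by (simp add: node_origin_def coeff_0_frame)
  qed
qed

definition psi :: "'a frame \<Rightarrow> 'b \<Rightarrow> nat \<Rightarrow> 'b" where
  "psi B t i = pev \<iota> t (quot B i) / (x - \<iota> (X i))"

text \<open>The places required along a fibre exist: at each point of the fibre one passes to the frame centred at
  that point. The fibre meets the line at infinity of the \<open>x\<close>-chart where the degree of its equation
  drops.\<close>

lemma psi_independent:
  assumes B: "coord B t" and Q: "proportional (fst B) (rep_P1 Q)"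
    and small: "\<And>v. place \<iota> K v \<Longrightarrow> v t > 0 \<Longrightarrow> vge v (\<iota> b0 + (\<Sum>i\<in>N. \<iota> (b i) * psi B t i)) (v t)"
  shows "b0 = 0 \<and> (\<forall>i\<in>N. b i = 0)"
proof -
  have det: "fdet B \<noteq> 0" using B by (simp add: coord_def)
  interpret m: plane_model \<iota> K k a "gam B" x t by (rule model0[OF B])
  interpret ff: function_field_over \<iota> K by (rule m.function_field_over)
  interpret fd: fibre_data \<iota> K "gam B" x t N "nodal_lines Q" X "quot B" "nodepoly B"
    "\<lambda>i. frame_equation k a \<Gamma> (A (X i)) B" by (rule fibre_data[OF B Q])
  have pl: "place \<iota> K v" if "v \<in> curve_points \<iota> K" for v by unfold_locales (rule that)
  have psi: "psi B t = fd.psi" by (rule ext) (simp add: psi_def fd.psi_def)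
  let ?g = "fibre (gam B)"
  have degg: "degree ?g \<le> k"
    using biform_frame_equation[of k a \<Gamma> "A 0" B] by (intro degree_le) (simp add: coeff_fibre cf_def biform_def coeff_eq_0)
  have nodesI: "(R, Q) \<in> nodes k a \<Gamma> \<Longrightarrow> \<exists>i\<in>nodal_lines Q. R = P i" for R
    unfolding nodes by (auto simp: nodal_lines_def)
  have on_curve: "cf f 0 0 = 0" if "fibre f = [:0, 1:] ^ m * h" "m > 0" for f :: "'a poly poly" and m h
  proof -
    have "coeff (fibre f) 0 = 0" unfolding that(1) using that(2) by (simp add: coeff_mult coeff_0_power)
    then show ?thesis by (simp add: coeff_fibre)
  qed
  have shift: "fibre (frame_equation k a \<Gamma> (A c) B) = [:0, 1:] ^ m * pcompose h [:c, 1:]"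
    "poly (pcompose h [:c, 1:]) 0 = poly h c" if "?g = [:- c, 1:] ^ m * h" for c m h
  proof -
    show "poly (pcompose h [:c, 1:]) 0 = poly h c" by (simp add: poly_pcompose)
    show "fibre (frame_equation k a \<Gamma> (A c) B) = [:0, 1:] ^ m * pcompose h [:c, 1:]"
    proof (rule poly_eq_if_cofinite[of "{}"])
      fix s
      have "poly (fibre (frame_equation k a \<Gamma> (A c) B)) s = poly ?g (c + s)"
        unfolding fibre_shift[of c B] by (simp add: poly_pcompose)
      then show "poly (fibre (frame_equation k a \<Gamma> (A c) B)) s = poly ([:0, 1:] ^ m * pcompose h [:c, 1:]) s"
        unfolding that by (simp add: poly_pcompose)
    qed simp
  qed
  show ?thesis
  proof (rule fd.psi_independent[OF m.fibre_nonzero degg])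
    show "card N < k" using N k by simp
    show "\<exists>v. place \<iota> K v \<and> v (x - \<iota> c) > 0 \<and> v t > 0 \<and> (int m - 1) * v (x - \<iota> c) < v t"
      if h: "?g = [:- c, 1:] ^ m * h" "poly h c \<noteq> 0" "m > 0" and c: "c \<notin> X ` nodal_lines Q" for c m h
    proof -
      interpret mc: plane_model \<iota> K k a "frame_equation k a \<Gamma> (A c) B" "x - \<iota> c" t by (rule model[OF B])
      obtain R where R: "proportional (fst (A c)) (rep_P1 R)" using proportional_ex[of "fst (A c)"] by (auto simp: A_def)
      have "(R, Q) \<notin> nodes k a \<Gamma>"
      proof
        assume "(R, Q) \<in> nodes k a \<Gamma>"
        then obtain i where i: "i \<in> nodal_lines Q" "R = P i" using nodesI by blast
        then have "c = X i" using R by (intro point_X) (auto simp: nodal_lines_def)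
        then show False using c i by blast
      qed
      note f = shift[OF h(1)]
      have on: "cf (frame_equation k a \<Gamma> (A c) B) 0 0 = 0" by (rule on_curve[OF f(1) h(3)])
      have sm: "\<not> singular_origin (frame_equation k a \<Gamma> (A c) B)"
        by (rule point_in_frame(1)[OF fdet_A(1) det k a nodal R Q refl on]) fact
      obtain v where "v \<in> curve_points \<iota> K" "v (x - \<iota> c) > 0" "v t > 0" "(int m - 1) * v (x - \<iota> c) < v t"
        by (rule mc.smooth_place[OF on sm f(1)]) (use f(2) h(2) in simp)
      then show ?thesis using pl by blast
    qed
    show "\<exists>v1 v2 c1 c2. place \<iota> K v1 \<and> place \<iota> K v2 \<and> v1 (x - \<iota> (X i)) > 0 \<and> v1 t > 0 \<and>
          v2 (x - \<iota> (X i)) > 0 \<and> v2 t > 0 \<and> c1 \<noteq> c2 \<and>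
          vge v1 (pev \<iota> t (poly (gam B) [:X i:]) / ((x - \<iota> (X i)) * t) - \<iota> c1) 1 \<and>
          vge v2 (pev \<iota> t (poly (gam B) [:X i:]) / ((x - \<iota> (X i)) * t) - \<iota> c2) 1 \<and>
          (int m - 2) * v2 (x - \<iota> (X i)) < v2 t"
      if i: "i \<in> nodal_lines Q" and h: "?g = [:- X i, 1:] ^ m * h" "poly h (X i) \<noteq> 0" for i m h
    proof -
      interpret mc: plane_model \<iota> K k a "frame_equation k a \<Gamma> (A (X i)) B" "x - \<iota> (X i)" t by (rule model[OF B])
      have "node_origin (frame_equation k a \<Gamma> (A (X i)) B)"
        using i by (intro node_frame[OF det _ _ Q]) (auto simp: nodal_lines_def)
      then obtain v1 v2 c1 c2 where "mc.node_branch v1 c1" "mc.node_branch v2 c2" "c1 \<noteq> c2"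
        "(int m - 2) * v2 (x - \<iota> (X i)) < v2 t"
        by (rule mc.node_places[OF _ shift(1)[OF h(1)]]) (use shift(2)[OF h(1)] h(2) in simp)
      then show ?thesis unfolding mc.node_branch_def coeff_0_frame using pl by blast
    qed
    show "\<exists>v. place \<iota> K v \<and> v (1 / x) > 0 \<and> v t > 0 \<and> (int (k - degree ?g) - 1) * v (1 / x) < v t"
      if lt: "degree ?g < k"
    proof -
      interpret mi: plane_model \<iota> K k a "frame_equation k a \<Gamma> Ainf B" "1 / x" t by (rule model_inf[OF B])
      have f: "fibre (frame_equation k a \<Gamma> Ainf B) = [:0, 1:] ^ (k - degree ?g) * reflect_poly ?g"
      proof (rule poly_eq_if_cofinite[of "{0}"])
        fix s :: 'a assume "s \<notin> {0}"
        then have s: "s \<noteq> 0" by simp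
        obtain B0 B1 where Bb: "fst B = (B0, B1)" by (cases "fst B")
        have "frm id Ainf s = (s * fst (frm id (A 0) (inverse s)), s * snd (frm id (A 0) (inverse s)))"
          using s by (simp add: frm_def A_def Ainf_def field_simps)
        then have "poly (fibre (frame_equation k a \<Gamma> Ainf B)) s = s ^ k * poly ?g (inverse s)"
          using eval_form_scale[of id k a \<Gamma> s _ _ 1 B0 B1] by (simp add: poly_fibre_frame Bb)
        also have "\<dots> = poly ([:0, 1:] ^ (k - degree ?g) * reflect_poly ?g) s"
          using s degg by (simp add: poly_reflect_poly_nz power_add[symmetric])
        finally show "poly (fibre (frame_equation k a \<Gamma> Ainf B)) s = poly ([:0, 1:] ^ (k - degree ?g) * reflect_poly ?g) s" .
      qed simp
      have on: "cf (frame_equation k a \<Gamma> Ainf B) 0 0 = 0" by (rule on_curve[OF f]) (use lt in simp)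
      obtain R where R: "proportional (fst Ainf) (rep_P1 R)" using proportional_ex[of "fst Ainf"] by (auto simp: Ainf_def)
      have "(R, Q) \<notin> nodes k a \<Gamma>"
      proof
        assume "(R, Q) \<in> nodes k a \<Gamma>"
        then obtain i where i: "i \<in> N" "R = P i" using nodesI by (auto simp: nodal_lines_def)
        then obtain l where "1 = l * fst (rep_P1 (P i))" "eps = l * snd (rep_P1 (P i))" "l \<noteq> 0"
          using R by (auto simp: proportional_def Ainf_def)
        then have "l * snd (rep_P1 (P i)) = l * (eps * fst (rep_P1 (P i)))" by algebra
        then show False using eps[OF i(1)] \<open>l \<noteq> 0\<close> by simp
      qed
      then have sm: "\<not> singular_origin (frame_equation k a \<Gamma> Ainf B)"
        by (rule point_in_frame(1)[OF fdet_A(2) det k a nodal R Q refl on])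
      obtain v where "v \<in> curve_points \<iota> K" "v (1 / x) > 0" "v t > 0" "(int (k - degree ?g) - 1) * v (1 / x) < v t"
        by (rule mi.smooth_place[OF on sm f]) (use m.fibre_nonzero in simp)
      then show ?thesis using pl by blast
    qed
    show "vge v (\<iota> b0 + (\<Sum>i\<in>N. \<iota> (b i) * fd.psi i)) (v t)" if "place \<iota> K v" "v t > 0" for v
      using small[OF that] unfolding psi .
  qed
qed

end

section \<open>Sections of the multiples of the pencil\<close>

lemma prod_linear_dvd:
  fixes W :: "'c::idom poly"
  assumes "finite N" "inj_on c N" "\<And>i. i \<in> N \<Longrightarrow> poly W (c i) = 0"
  shows "(\<Prod>i\<in>N. [:- c i, 1:]) dvd W"
  using assms
proof (induction N arbitrary: W rule: finite_induct)
  case (insert i N)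
  have "poly W (c i) = 0" using insert by simp
  then have "[:- c i, 1:] dvd W" unfolding poly_eq_0_iff_dvd .
  then obtain q where q: "W = [:- c i, 1:] * q" by (rule dvdE)
  have "poly q (c j) = 0" if "j \<in> N" for j
  proof -
    have "c j \<noteq> c i" using insert that by (auto simp: inj_on_def)
    moreover have "poly W (c j) = 0" using insert that by auto
    ultimately show ?thesis unfolding q by simp
  qed
  then have "(\<Prod>i\<in>N. [:- c i, 1:]) dvd q" using insert by (intro insert.IH) (auto simp: inj_on_def)
  then show ?case unfolding q using insert by (simp del: mult_pCons_left)
qed simp

lemma smult_sum_right: "smult c (sum f A) = (\<Sum>i\<in>A. smult c (f i))"
  by (induction A rule: infinite_finite_induct) (simp_all add: smult_add_right)

context plane_model
begin

text \<open>The function field is generated over \<open>K(y)\<close> by the powers of \<open>x\<close> below \<open>k\<close>; inverses exist by elimination.\<close>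

lemma common_denominator:
  assumes "z \<in> L" obtains C r where "C \<noteq> 0" "degree r < k" "pev \<iota> y C * z = ev \<iota> x y r"
proof -
  note e = rhom_simps[OF rhom_ev[OF hom, of x y]] and e1 = rhom_simps[OF rhom_pev[OF hom, of y]]
  obtain G H where z: "z = ev \<iota> x y G / ev \<iota> x y H" "ev \<iota> x y H \<noteq> 0" using assms unfolding in_L_iff by blast
  obtain U V C where C: "C \<noteq> 0" "U * H + V * \<gamma> = [:C:]" by (rule elimination[OF z(2)])
  have UH: "ev \<iota> x y U * ev \<iota> x y H = pev \<iota> y C"
    using arg_cong[OF C(2), of "ev \<iota> x y"] zero by (simp add: e hom)
  obtain A q r where r: "A \<noteq> 0" "smult A (G * U) = \<gamma> * q + r" "degree r < k" by (rule reduce)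
  have "pev \<iota> y A * (ev \<iota> x y G * ev \<iota> x y U) = ev \<iota> x y r"
    using arg_cong[OF r(2), of "ev \<iota> x y"] zero by (simp add: e ev_smult[OF hom])
  moreover have "ev \<iota> x y G = z * ev \<iota> x y H" using z by simp
  ultimately have "pev \<iota> y (A * C) * z = ev \<iota> x y r" unfolding e1 UH[symmetric] by (simp add: mult_ac)
  then show thesis using that[of "A * C" r] r C by simp
qed

end

locale nodal_pencil = nodal_setup \<iota> k a \<Gamma> \<xi> \<eta> N P S eps
  for \<iota> :: "'a::alg_closed_field \<Rightarrow> 'b::field" and k a \<Gamma> \<xi> \<eta> N P S eps +
  fixes Q0 :: "'a P1"
  assumes N0: "0 \<notin> N" and card_S: "\<And>i. i \<in> N \<Longrightarrow> card (S i) \<le> a"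
begin

text \<open>Frames on the second factor whose point at infinity is \<open>Q0\<close>, and the opposite frame.\<close>

definition u0 :: "'a \<times> 'a" where
  "u0 = (if fst (rep_P1 Q0) \<noteq> 0 then (0, 1) else (1, 0))"

definition B :: "'a \<Rightarrow> 'a frame" where
  "B c = ((fst u0 + c * fst (rep_P1 Q0), snd u0 + c * snd (rep_P1 Q0)), rep_P1 Q0)"

definition Binf :: "'a frame" where
  "Binf = (rep_P1 Q0, u0)"

lemma fdet_B: "fdet (B c) \<noteq> 0" "fdet Binf \<noteq> 0"
  using rep_P1_nonzero[of Q0] by (cases "rep_P1 Q0"; auto simp: fdet_def B_def Binf_def u0_def algebra_simps)+

definition y :: 'b where "y = (SOME y. coord (B 0) y)"

lemma coord_y: "coord (B 0) y"
  unfolding y_def by (rule someI_ex) (use coord_ex[OF fdet_B(1)] in blast)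

sublocale model: plane_model \<iota> K k a "gam (B 0)" x y
  by (rule model0[OF coord_y])

sublocale ff: function_field_over \<iota> K
  by (rule model.function_field_over)

lemma frm_B: "frm \<iota> (B c) (y - \<iota> c) = frm \<iota> (B 0) y"
  by (simp add: frm_def B_def rhom_simps[OF hom] algebra_simps)

lemma frm_Binf: "frm \<iota> Binf (1 / y) = (1 / y * fst (frm \<iota> (B 0) y), 1 / y * snd (frm \<iota> (B 0) y))"
  using model.y_nonzero by (simp add: frm_def B_def Binf_def rhom_simps[OF hom] field_simps)

lemma coord_B: "coord (B c) (y - \<iota> c)"
  using coord_y fdet_B unfolding coord_def frm_B by simp

lemma coord_Binf: "coord Binf (1 / y)"
proof -
  obtain l where "l \<noteq> 0" "rep_P1 \<eta> = (l * fst (frm \<iota> (B 0) y), l * snd (frm \<iota> (B 0) y))"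
    using coord_y unfolding coord_def proportional_def by blast
  then show ?thesis unfolding coord_def proportional_def
    using fdet_B model.y_nonzero by (auto simp: frm_Binf intro!: exI[of _ "l * y"])
qed

lemma base_point: assumes "fdet B' \<noteq> 0" obtains Q where "proportional (fst B') (rep_P1 Q)"
proof -
  have "fst B' \<noteq> (0, 0)" using assms by (auto simp: fdet_def)
  then show thesis using proportional_ex that by blast
qed

definition node_form :: "nat \<Rightarrow> 'b \<times> 'b \<Rightarrow> 'b" where
  "node_form i z = (\<Prod>R\<in>S i. \<iota> (fst (rep_P1 R)) * snd z - \<iota> (snd (rep_P1 R)) * fst z)"

text \<open>In terms of homogeneous coordinates \<open>psi\<close> is a quotient of forms of degrees \<open>a\<close> and \<open>card (S i)\<close> in \<open>y\<close>. This gives its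
  behaviour under a change of the frame on the second factor: no change under a translation of \<open>y\<close>, and a
  factor \<open>(1 / y)\<close> to the power \<open>a - card (S i)\<close> on passing to the coordinate \<open>1 / y\<close>.\<close>

lemma psi_value:
  assumes t: "coord B' t" and i: "i \<in> N"
  shows "psi B' t i = eval_form \<iota> k a \<Gamma> (frm \<iota> (A 0) (\<iota> (X i))) (frm \<iota> B' t) / node_form i (frm \<iota> B' t) / (x - \<iota> (X i))"
proof -
  have det: "fdet B' \<noteq> 0" using t by (simp add: coord_def)
  interpret m: plane_model \<iota> K k a "gam B'" x t by (rule model0[OF t])
  have n: "pev \<iota> t (nodepoly B' i) = node_form i (frm \<iota> B' t)"
    by (simp add: nodepoly_def node_form_def rhom_prod[OF rhom_pev[OF hom]] pev_lin[OF hom])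
  have "pev \<iota> t (nodepoly B' i) \<noteq> 0" by (rule m.pev_nonzero[OF nodepoly_nonzero[OF det]])
  moreover have "eval_form \<iota> k a \<Gamma> (frm \<iota> (A 0) (\<iota> (X i))) (frm \<iota> B' t) = pev \<iota> t (quot B' i) * pev \<iota> t (nodepoly B' i)"
    unfolding poly_frame_line[OF hom, symmetric] quot_eq[OF det i] by (rule rhom_mult[OF rhom_pev[OF hom]])
  ultimately show ?thesis by (simp add: psi_def n)
qed

definition d :: "nat \<Rightarrow> nat" where
  "d i = (if i \<in> N then a - card (S i) else 0)"

definition phi :: "nat \<Rightarrow> 'b" where
  "phi i = (if i \<in> N then psi (B 0) y i else 1)"

lemma psi_B: "i \<in> N \<Longrightarrow> psi (B c) (y - \<iota> c) i = phi i"
  unfolding phi_def by (simp add: psi_value[OF coord_B] psi_value[OF coord_y] frm_B)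

lemma psi_Binf: assumes i: "i \<in> N" shows "psi Binf (1 / y) i = (1 / y) ^ d i * phi i"
proof -
  obtain z0 z1 where z: "frm \<iota> (B 0) y = (z0, z1)" by (cases "frm \<iota> (B 0) y")
  obtain w0 w1 where w: "frm \<iota> (A 0) (\<iota> (X i)) = (w0, w1)" by (cases "frm \<iota> (A 0) (\<iota> (X i))")
  define t where "t = 1 / y"
  have tn: "t \<noteq> 0" using model.y_nonzero by (simp add: t_def)
  have zt: "frm \<iota> Binf t = (t * z0, t * z1)" using frm_Binf by (simp only: t_def z fst_conv snd_conv)
  have "node_form i (t * z0, t * z1) = (\<Prod>R\<in>S i. t * (\<iota> (fst (rep_P1 R)) * z1 - \<iota> (snd (rep_P1 R)) * z0))"
    unfolding node_form_def by (intro prod.cong) (simp_all add: algebra_simps)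
  also have "\<dots> = t ^ card (S i) * node_form i (z0, z1)"
    by (simp only: node_form_def prod.distrib prod_constant fst_conv snd_conv)
  finally have n: "node_form i (t * z0, t * z1) = t ^ card (S i) * node_form i (z0, z1)" .
  have ta: "t ^ a = t ^ d i * t ^ card (S i)"
    using i card_S[OF i] by (simp add: d_def flip: power_add)
  have e: "eval_form \<iota> k a \<Gamma> (w0, w1) (t * z0, t * z1) = t ^ a * eval_form \<iota> k a \<Gamma> (w0, w1) (z0, z1)"
    using eval_form_scale[of \<iota> k a \<Gamma> 1 w0 w1 t z0 z1] by simp
  have "psi Binf t i = t ^ d i * phi i"
    using i tn psi_value[OF coord_Binf i] by (simp add: phi_def psi_value[OF coord_y] zt z w n e ta flip: t_def)
  then show ?thesis by (simp only: t_def)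
qed

lemma phi_in: "phi i \<in> K"
  by (simp add: phi_def psi_def ff.in_L model.x_in model.y_in)

lemma placeI: "v \<in> curve_points \<iota> K \<Longrightarrow> place \<iota> K v"
  by unfold_locales

lemma psi_regular:
  assumes t: "coord B' t" and v: "place \<iota> K v" "vge v t 1" and i: "i \<in> N" shows "vge v (psi B' t i) 0"
proof -
  have "fdet B' \<noteq> 0" using t by (simp add: coord_def)
  then obtain Q where Q: "proportional (fst B') (rep_P1 Q)" by (rule base_point)
  interpret fd: fibre_data \<iota> K "gam B'" x t N "nodal_lines Q" X "quot B'" "nodepoly B'"
    "\<lambda>i. frame_equation k a \<Gamma> (A (X i)) B'" by (rule fibre_data[OF t Q])
  show ?thesis using fd.psi_regular[OF v i] by (simp add: psi_def fd.psi_def)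
qed

text \<open>If the residue of \<open>y\<close> is a root \<open>c\<close> of \<open>nodepoly\<close>, this is regularity along the fibre over \<open>c\<close>. Otherwise
  \<open>nodepoly\<close> is a unit at the place.\<close>

lemma phi_regular:
  assumes v: "place \<iota> K v" and y0: "vge v y 0" shows "vge v (phi i) 0"
proof -
  interpret place \<iota> K v by fact
  show ?thesis
  proof (cases "i \<in> N \<and> (\<forall>c. poly (nodepoly (B 0) i) c = 0 \<longrightarrow> \<not> vge v (y - \<iota> c) 1)")
    case True
    then have i: "i \<in> N" by simp
    have "pev \<iota> y (nodepoly (B 0) i) \<noteq> 0 \<and> v (pev \<iota> y (nodepoly (B 0) i)) = 0"
      using True by (intro pev_unit_no_centre[OF model.y_in y0 nodepoly_nonzero[OF fdet_B(1)]]) auto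
    moreover obtain Q where Q: "proportional (fst (B 0)) (rep_P1 Q)" using base_point[OF fdet_B(1)] by blast
    interpret fd: fibre_data \<iota> K "gam (B 0)" x y N "nodal_lines Q" X "quot (B 0)" "nodepoly (B 0)"
      "\<lambda>i. frame_equation k a \<Gamma> (A (X i)) (B 0)" by (rule fibre_data[OF coord_y Q])
    show ?thesis using fd.psi_regular_unit[OF v y0 i] calculation i by (simp add: phi_def psi_def fd.psi_def)
  next
    case False
    then consider "i \<notin> N" | c where "i \<in> N" "vge v (y - \<iota> c) 1" by blast
    then show ?thesis
    proof cases
      case 1
      then show ?thesis by (simp add: phi_def vge_def v_1)
    next
      case 2
      then show ?thesis using psi_regular[OF coord_B v 2(2) 2(1)] by (simp add: psi_B)
    qed
  qed
qed

lemma phi_infinity: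
  assumes v: "place \<iota> K v" and y: "v (1 / y) > 0" shows "vge v ((1 / y) ^ d i * phi i) 0"
proof -
  interpret place \<iota> K v by fact
  show ?thesis
  proof (cases "i \<in> N")
    case True
    then show ?thesis using psi_regular[OF coord_Binf v vge_pos(1)[OF y] True] by (simp add: psi_Binf)
  next
    case False
    then show ?thesis by (simp add: phi_def d_def vge_def v_1)
  qed
qed

text \<open>The fibre over \<open>Q0\<close> is the polar divisor of \<open>y\<close>, as \<open>Q0\<close> is the point at infinity of its frame.\<close>

lemma line_pullback_pole:
  assumes "place \<iota> K v" shows "line_pullback \<iota> \<eta> Q0 v = - min 0 (v y)"
proof -
  interpret place \<iota> K v by fact
  obtain r0 r1 where r: "rep_P1 Q0 = (r0, r1)" by (cases "rep_P1 Q0")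
  obtain l where l: "l \<noteq> 0" "rep_P1 \<eta> = (l * fst (frm \<iota> (B 0) y), l * snd (frm \<iota> (B 0) y))"
    using coord_y unfolding coord_def proportional_def by blast
  note yL = model.y_in and yn = model.y_nonzero
  have vc: "v (- \<iota> c) = 0" for c using v_const[of "- c"] by (simp add: rhom_simps[OF hom])
  show ?thesis
  proof (cases "r0 = 0")
    case True
    then have r1: "r1 \<noteq> 0" using rep_P1_nonzero[of Q0] r by simp
    then have ir: "\<iota> r1 \<noteq> 0" by (simp add: rhom_eq_0_iff[OF hom])
    have "rep_P1 \<eta> = (l, l * (y * \<iota> r1))" using l by (simp add: frm_def B_def u0_def r True rhom_simps[OF hom])
    then have "snd (rep_P1 \<eta>) / fst (rep_P1 \<eta>) = y * \<iota> r1" using l by simp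
    moreover have "v (y * \<iota> r1) = v y" using ir yL yn by (simp add: v_mult v_const ff.in_L)
    ultimately show ?thesis by (simp add: line_pullback_def r True rhom_0[OF hom] vc)
  next
    case False
    then have ir: "\<iota> r0 \<noteq> 0" by (simp add: rhom_eq_0_iff[OF hom])
    define s where "s = 1 + y * \<iota> r1"
    define Y where "Y = s / (y * \<iota> r0)"
    have "rep_P1 \<eta> = (l * (y * \<iota> r0), l * s)" using l False by (simp add: frm_def B_def u0_def r s_def rhom_simps[OF hom])
    then have Y: "snd (rep_P1 \<eta>) / fst (rep_P1 \<eta>) = Y" using l by (simp add: Y_def)
    have sL: "s \<in> K" by (simp add: s_def ff.in_L yL)
    have "s = pev \<iota> y [:1, r1:]" by (simp add: hom rhom_simps[OF hom] s_def)
    then have sn: "s \<noteq> 0" using model.pev_nonzero[of "[:1, r1:]"] by simp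
    have vY: "v Y = v s - v y" using sn ir yL yn sL by (simp add: Y_def v_divide v_mult v_const ff.in_L)
    have "\<iota> r0 * Y - \<iota> r1 = 1 / y" using ir yn by (simp add: Y_def s_def field_simps)
    then have v1: "v (\<iota> r0 * Y - \<iota> r1) = - v y" using yL yn by (simp add: v_divide v_1 ff.in_L)
    have pull: "line_pullback \<iota> \<eta> Q0 v = - v y - min 0 (v Y)"
      unfolding line_pullback_def Y Let_def by (simp add: r v1)
    show ?thesis
    proof (cases "v y > 0")
      case True
      have "vge v (s - \<iota> 1) 1"
        using vge_mult0[OF ff.const_in yL vge_const vge_pos(1)[OF True], of r1]
        by (simp add: s_def rhom_1[OF hom] mult.commute)
      then have "v s = 0" using unit_residue[OF sL, of 1] by simp
      then show ?thesis using True by (simp add: pull vY)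
    next
      case False
      have "vge v s (v y)"
        unfolding s_def by (intro vge_add vge_mult0[of "\<iota> r1", unfolded mult.commute[of "\<iota> r1"]])
          (use False yL in \<open>auto simp: ff.in_L vge_const vge_def v_1 v_const\<close>)
      then show ?thesis using False sn by (simp add: pull vY vge_def)
    qed
  qed
qed

abbreviation "idx \<equiv> insert 0 N"

lemma sum_idx: "(\<Sum>i\<in>idx. f i) = f 0 + (\<Sum>i\<in>N. f i)"
  using N N0 by simp

lemma phi_0: "phi 0 = 1" and d_0: "d 0 = 0"
  using N0 by (simp_all add: phi_def d_def)

definition comb :: "(nat \<Rightarrow> 'a poly) \<Rightarrow> 'b" where
  "comb p = (\<Sum>i\<in>idx. pev \<iota> y (p i) * phi i)"

text \<open>After multiplication by \<open>line_poly N\<close>, combinations of the \<open>phi i\<close> become polynomials in \<open>x\<close> of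
  degree less than \<open>k\<close>, in the form of Lagrange interpolation at the \<open>X i\<close>.\<close>

definition line_poly :: "nat set \<Rightarrow> 'a poly poly" where
  "line_poly M = (\<Prod>i\<in>M. [:- [:X i:], 1:])"

lemma line_poly_degree: "degree (line_poly M) = card M"
  unfolding line_poly_def by (subst degree_prod_eq_sum_degree) auto

lemma line_poly_value: "poly (line_poly M) [:X j:] = [:\<Prod>i\<in>M. X j - X i:]"
proof -
  have "poly (line_poly M) [:X j:] = (\<Prod>i\<in>M. [:X j - X i:])"
    unfolding line_poly_def poly_prod by (intro prod.cong) (auto simp: one_pCons)
  also have "\<dots> = [:\<Prod>i\<in>M. X j - X i:]"
    by (rule rhom_prod[OF rhom_const_poly, symmetric])
  finally show ?thesis .
qed

lemma line_poly_value_nz: "j \<in> N \<Longrightarrow> (\<Prod>i\<in>N - {j}. X j - X i) \<noteq> 0"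
  using N(1) inj_X by (auto simp: inj_on_def)

lemma line_poly_remove: "i \<in> N \<Longrightarrow> line_poly N = [:- [:X i:], 1:] * line_poly (N - {i})"
  unfolding line_poly_def using N by (intro prod.remove) auto

lemma line_poly_nonzero: "ev \<iota> x y (line_poly N) \<noteq> 0"
proof (rule model.ev_low_degree_nonzero)
  show "degree (line_poly N) < k" using N k by (simp add: line_poly_degree)
  show "line_poly N \<noteq> 0" by (simp add: line_poly_def N)
qed

definition interp :: "'a poly \<Rightarrow> (nat \<Rightarrow> 'a poly) \<Rightarrow> 'a poly poly" where
  "interp p0 p = smult p0 (line_poly N) + (\<Sum>i\<in>N. smult (p i) (line_poly (N - {i})))"

lemma interp_value: assumes j: "j \<in> N" shows "poly (interp p0 p) [:X j:] = p j * [:\<Prod>i\<in>N - {j}. X j - X i:]"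
proof -
  have "(\<Sum>i\<in>N. p i * poly (line_poly (N - {i})) [:X j:])
     = (\<Sum>i\<in>N. if i = j then p j * [:\<Prod>i\<in>N - {j}. X j - X i:] else 0)"
  proof (intro sum.cong refl)
    fix i assume i: "i \<in> N"
    show "p i * poly (line_poly (N - {i})) [:X j:] = (if i = j then p j * [:\<Prod>i\<in>N - {j}. X j - X i:] else 0)"
    proof (cases "i = j")
      case False
      then have "(\<Prod>l\<in>N - {i}. X j - X l) = 0" using j N by (intro prod_zero) auto
      then show ?thesis using False by (simp add: line_poly_value)
    qed (simp add: line_poly_value)
  qed
  moreover have "(\<Prod>i\<in>N. X j - X i) = 0" using j N by (intro prod_zero) auto
  ultimately show ?thesis using j N by (simp add: interp_def poly_sum line_poly_value)
qed

lemma interp_degree: "degree (interp p0 p) < k"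
proof -
  have kN: "k = Suc (card N)" using N k by simp
  have "degree (interp p0 p) \<le> card N" unfolding interp_def
  proof (intro degree_add_le degree_sum_le)
    show "degree (smult p0 (line_poly N)) \<le> card N"
      using degree_smult_le[of p0 "line_poly N"] by (simp add: line_poly_degree)
    show "degree (smult (p i) (line_poly (N - {i}))) \<le> card N" if "i \<in> N" for i
      using degree_smult_le[of "p i" "line_poly (N - {i})"] N that by (simp add: line_poly_degree)
  qed (rule N)
  then show ?thesis by (simp add: kN)
qed

lemma comb_interp:
  "comb p * ev \<iota> x y (line_poly N) = ev \<iota> x y (interp (p 0) (\<lambda>i. p i * quot (B 0) i))"
proof -
  note e = rhom_simps[OF rhom_ev[OF hom, of x y]] and e1 = rhom_simps[OF rhom_pev[OF hom, of y]]
  have 1: "phi i * ev \<iota> x y (line_poly N) = pev \<iota> y (quot (B 0) i) * ev \<iota> x y (line_poly (N - {i}))" if i: "i \<in> N" for i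
  proof -
    have "ev \<iota> x y [:- [:X i:], 1:] = x - \<iota> (X i)" by (simp add: hom e1 rhom_simps[OF hom])
    then have "ev \<iota> x y (line_poly N) = (x - \<iota> (X i)) * ev \<iota> x y (line_poly (N - {i}))"
      unfolding line_poly_remove[OF i] e by simp
    moreover have "x - \<iota> (X i) \<noteq> 0" using model.x_not_const by simp
    ultimately show ?thesis using i by (simp add: phi_def psi_def)
  qed
  have "comb p * ev \<iota> x y (line_poly N) = pev \<iota> y (p 0) * ev \<iota> x y (line_poly N)
     + (\<Sum>i\<in>N. pev \<iota> y (p i) * (phi i * ev \<iota> x y (line_poly N)))"
    by (simp add: comb_def sum_idx phi_0 distrib_right sum_distrib_right mult.assoc)
  also have "\<dots> = ev \<iota> x y (interp (p 0) (\<lambda>i. p i * quot (B 0) i))"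
    by (simp add: 1 interp_def e e1 ev_smult[OF hom] mult.assoc)
  finally show ?thesis .
qed

lemma quot_nonzero: "i \<in> N \<Longrightarrow> quot (B 0) i \<noteq> 0"
  using quot_eq[OF fdet_B(1)[of 0], of i] model.line_nonzero[of "X i"] by auto

text \<open>A relation would be a polynomial in \<open>x\<close> of degree less than \<open>k\<close> that vanishes on the curve, hence the
  zero polynomial; its values at the \<open>X i\<close> are the coefficients up to nonzero factors.\<close>

lemma comb_independent:
  assumes "comb p = 0" "i \<in> idx" shows "p i = 0"
proof -
  let ?W = "interp (p 0) (\<lambda>i. p i * quot (B 0) i)"
  have "ev \<iota> x y ?W = 0" using comb_interp[of p] assms by simp
  then have W: "?W = 0" using model.ev_low_degree_nonzero[OF interp_degree] by blast
  have pN: "p j = 0" if j: "j \<in> N" for j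
  proof -
    have "p j * quot (B 0) j * [:\<Prod>i\<in>N - {j}. X j - X i:] = 0"
      using interp_value[OF j, of "p 0" "\<lambda>i. p i * quot (B 0) i"] by (simp only: W poly_0)
    then show ?thesis using quot_nonzero[OF j] line_poly_value_nz[OF j] by simp
  qed
  then have "?W = smult (p 0) (line_poly N)" by (simp add: interp_def)
  moreover have "line_poly N \<noteq> 0" using line_poly_nonzero hom by auto
  ultimately have "p 0 = 0" using W by simp
  then show ?thesis using assms pN by auto
qed

lemma comb_spans:
  assumes z: "z \<in> K" obtains C p where "C \<noteq> 0" "pev \<iota> y C * z = comb p"
proof -
  note e = rhom_simps[OF rhom_ev[OF hom, of x y]] and e1 = rhom_simps[OF rhom_pev[OF hom, of y]]
  have "z * ev \<iota> x y (line_poly N) \<in> K" using z by (simp add: ff.in_L model.x_in model.y_in)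
  then obtain C r where C: "C \<noteq> 0" "degree r < k" "pev \<iota> y C * (z * ev \<iota> x y (line_poly N)) = ev \<iota> x y r"
    by (rule model.common_denominator)
  define w where "w j = [:inverse (\<Prod>i\<in>N - {j}. X j - X i):]" for j
  have w: "w j * [:\<Prod>i\<in>N - {j}. X j - X i:] = 1" if "j \<in> N" for j
    using line_poly_value_nz[OF that] by (simp add: w_def one_pCons)
  define s where "s j = poly r [:X j:] * w j" for j
  define W where "W = r - interp 0 s"
  have "line_poly N dvd W" unfolding line_poly_def
  proof (rule prod_linear_dvd)
    show "finite N" by (rule N)
    show "inj_on (\<lambda>i. [:X i:]) N" using inj_X by (auto simp: inj_on_def)
    show "poly W [:X j:] = 0" if "j \<in> N" for j
      using w[OF that] by (simp add: W_def interp_value[OF that] s_def mult.assoc del: mult_pCons_left mult_pCons_right)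
  qed
  then obtain q where q: "W = line_poly N * q" by (rule dvdE)
  have "degree q = 0"
  proof (cases "q = 0")
    case False
    have "line_poly N \<noteq> 0" using line_poly_nonzero hom by auto
    then have "degree W = card N + degree q" using False by (simp add: q degree_mult_eq line_poly_degree)
    moreover have "degree W < k" unfolding W_def using C(2) interp_degree[of 0 s] degree_diff_le_max[of r "interp 0 s"] by simp
    ultimately show ?thesis using N k by simp
  qed simp
  then obtain p0 where p0: "q = [:p0:]" by (rule degree_eq_zeroE)
  have r: "r = interp p0 s"
  proof -
    have "r = W + interp 0 s" by (simp add: W_def)
    also have "\<dots> = interp p0 s" unfolding q p0 by (simp add: interp_def)
    finally show ?thesis .
  qed
  define C2 where "C2 = (\<Prod>i\<in>N. quot (B 0) i)"
  have C2: "C2 \<noteq> 0" using N quot_nonzero by (simp add: C2_def)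
  define p where "p i = (if i \<in> N then s i * (\<Prod>j\<in>N - {i}. quot (B 0) j) else p0 * C2)" for i
  have pq: "p i * quot (B 0) i = C2 * s i" if "i \<in> N" for i
    using that N by (simp add: p_def C2_def prod.remove[of N i] mult_ac)
  have "(\<Sum>i\<in>N. smult (p i * quot (B 0) i) (line_poly (N - {i}))) = (\<Sum>i\<in>N. smult (C2 * s i) (line_poly (N - {i})))"
    by (intro sum.cong refl) (simp only: pq)
  moreover have "p 0 = C2 * p0" using N0 by (simp add: p_def mult.commute)
  ultimately have "interp (p 0) (\<lambda>i. p i * quot (B 0) i) = smult C2 r"
    by (simp add: r interp_def smult_add_right smult_sum_right)
  then have "comb p * ev \<iota> x y (line_poly N) = pev \<iota> y C2 * (pev \<iota> y C * (z * ev \<iota> x y (line_poly N)))"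
    unfolding comb_interp C(3) by (simp add: ev_smult[OF hom])
  then have "comb p * ev \<iota> x y (line_poly N) = (pev \<iota> y (C2 * C) * z) * ev \<iota> x y (line_poly N)"
    by (simp add: e1 mult_ac)
  then have "pev \<iota> y (C2 * C) * z = comb p" using line_poly_nonzero by simp
  then show thesis using that[of "C2 * C" p] C C2 by simp
qed

text \<open>The form in which \<open>psi_independent\<close> is applied: \<open>w\<close> is the expression of the basis in the coordinate \<open>t\<close>.\<close>

lemma comb_small:
  assumes t: "coord B' t" and psi: "\<And>i. i \<in> N \<Longrightarrow> psi B' t i = w i"
    and small: "\<And>v. place \<iota> K v \<Longrightarrow> v t > 0 \<Longrightarrow> vge v (\<iota> (b 0) + (\<Sum>i\<in>N. \<iota> (b i) * w i)) (v t)"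
    and i: "i \<in> idx"
  shows "b i = 0"
proof -
  have "fdet B' \<noteq> 0" using t by (simp add: coord_def)
  then obtain Q where Q: "proportional (fst B') (rep_P1 Q)" by (rule base_point)
  have "b 0 = 0 \<and> (\<forall>i\<in>N. b i = 0)"
    by (rule psi_independent[OF t Q]) (use small psi in \<open>simp cong: sum.cong\<close>)
  then show ?thesis using i by auto
qed

abbreviation sect :: "int \<Rightarrow> 'b set" where
  "sect n \<equiv> sections \<iota> K (\<lambda>v. n * line_pullback \<iota> \<eta> Q0 v)"

lemma sect_iff: "z \<in> sect n \<longleftrightarrow> z \<in> K \<and> (\<forall>v. place \<iota> K v \<longrightarrow> vge v z (n * min 0 (v y)))"
proof -
  have "0 \<le> v z + n * line_pullback \<iota> \<eta> Q0 v \<longleftrightarrow> n * min 0 (v y) \<le> v z" if "place \<iota> K v" for v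
    by (simp add: line_pullback_pole[OF that])
  then show ?thesis unfolding sections_def vge_def
    using placeI place.point by blast
qed

lemma basis_in_sect:
  assumes "int j + int (d i) \<le> n" shows "y ^ j * phi i \<in> sect n"
  unfolding sect_iff
proof (intro conjI allI impI)
  show "y ^ j * phi i \<in> K" by (simp add: ff.in_L model.y_in phi_in)
  fix v assume pl: "place \<iota> K v"
  then interpret place \<iota> K v .
  note yL = model.y_in and yn = model.y_nonzero
  show "vge v (y ^ j * phi i) (n * min 0 (v y))"
  proof (cases "v y \<ge> 0")
    case True
    then have "vge v (y ^ j) 0" using yL yn by (simp add: vge_def v_power)
    then have "vge v (y ^ j * phi i) 0"
      using phi_regular[OF pl, of i] True by (intro vge_mult0) (auto simp: ff.in_L yL phi_in vge_def)
    then show ?thesis using True by simp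
  next
    case False
    have v1: "v (1 / y) = - v y" using yL yn by (simp add: v_divide v_1 ff.in_L)
    then have "vge v ((1 / y) ^ d i * phi i) 0" using False by (intro phi_infinity[OF pl]) simp
    moreover have "vge v (y ^ (j + d i)) (int (j + d i) * v y)" using yL yn by (simp add: vge_def v_power)
    ultimately have "vge v (y ^ (j + d i) * ((1 / y) ^ d i * phi i)) (int (j + d i) * v y + 0)"
      by (intro vge_mult) (auto simp: ff.in_L yL phi_in)
    also have "y ^ (j + d i) * ((1 / y) ^ d i * phi i) = y ^ j * phi i"
      using yn by (simp add: power_add field_simps)
    finally show ?thesis
    proof (rule vge_mono)
      have "n * v y \<le> int (j + d i) * v y" using assms False by (intro mult_right_mono_neg) auto
      then show "n * min 0 (v y) \<le> int (j + d i) * v y + 0" using False by simp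
    qed
  qed
qed

lemma pole_expansion:
  assumes pl: "place \<iota> K v" and t: "v (1 / y) > 0" and "degree p \<le> e"
  shows "vge v ((1 / y) ^ e * pev \<iota> y p - \<iota> (coeff p e)) (v (1 / y))"
  using assms(3)
proof (induction p arbitrary: e)
  case 0
  then show ?case by (simp add: vge_def hom rhom_0)
next
  case (pCons c p)
  interpret place \<iota> K v by fact
  have tL: "1 / y \<in> K" by (simp add: ff.in_L model.y_in)
  show ?case
  proof (cases e)
    case 0
    then have "p = 0" using pCons by (metis degree_pCons_eq_if le_zero_eq nat.distinct(1))
    then show ?thesis using 0 hom by (simp add: vge_def rhom_0)
  next
    case (Suc e')
    have "degree p \<le> e'" using pCons.prems Suc by (cases "p = 0") auto
    then have IH: "vge v ((1 / y) ^ e' * pev \<iota> y p - \<iota> (coeff p e')) (v (1 / y))" by (rule pCons.IH)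
    have "vge v (1 / y) 0" using t by (simp add: vge_def)
    then have p0: "vge v (\<iota> c * (1 / y) ^ e') 0"
    proof -
      have "vge v ((1 / y) ^ e') 0"
        using tL t v_power[OF tL, of e'] model.y_nonzero by (simp add: vge_def del: power_one_over)
      then show ?thesis using tL by (intro vge_mult0 vge_const) (auto simp: ff.in_L simp del: power_one_over)
    qed
    have "vge v (\<iota> c * (1 / y) ^ e' * (1 / y)) (v (1 / y))"
      using tL by (intro vge_mult0[OF _ _ p0] vge_self) (auto simp: ff.in_L simp del: power_one_over)
    then have "vge v (\<iota> c * (1 / y) ^ e' * (1 / y) + ((1 / y) ^ e' * pev \<iota> y p - \<iota> (coeff p e'))) (v (1 / y))"
      using IH tL by (intro vge_add) (auto simp: ff.in_L model.y_in simp del: power_one_over)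
    also have "\<iota> c * (1 / y) ^ e' * (1 / y) + ((1 / y) ^ e' * pev \<iota> y p - \<iota> (coeff p e'))
        = (1 / y) ^ e * pev \<iota> y (pCons c p) - \<iota> (coeff (pCons c p) e)"
      using model.y_nonzero hom by (simp add: Suc field_simps)
    finally show ?thesis .
  qed
qed

text \<open>Both steps have the same pattern: constants that are the values (or leading coefficients) of the
  coefficient polynomials at a point of the second factor give a combination that vanishes on the whole fibre
  over that point, so they are zero.\<close>

lemma sect_expansion:
  assumes z: "z \<in> sect n"
  obtains p where "z = comb p" "\<And>i. i \<in> idx \<Longrightarrow> p i \<noteq> 0 \<Longrightarrow> int (degree (p i)) + int (d i) \<le> n"
proof -
  note e1 = rhom_simps[OF rhom_pev[OF hom, of y]]
  note yL = model.y_in and yn = model.y_nonzero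
  have zK: "z \<in> K" and zv: "\<And>v. place \<iota> K v \<Longrightarrow> vge v z (n * min 0 (v y))" using z unfolding sect_iff by auto
  define good where "good = (\<lambda>C. C \<noteq> 0 \<and> (\<exists>p. pev \<iota> y C * z = comb p))"
  obtain C0 where "good C0" using comb_spans[OF zK] unfolding good_def by metis
  then obtain C where C: "good C" "\<And>C'. good C' \<Longrightarrow> degree C \<le> degree C'"
    using arg_min_nat_lemma[of good C0 degree] by blast
  then obtain p where p: "pev \<iota> y C * z = comb p" and C0: "C \<noteq> 0" by (auto simp: good_def)
  \<comment> \<open>A denominator of least degree has no roots.\<close>
  have "degree C = 0"
  proof (rule ccontr)
    assume "degree C \<noteq> 0"
    then obtain c where "poly C c = 0" using alg_closed_imp_poly_has_root[of C] by auto
    then obtain C' where C': "C = [:- c, 1:] * C'" by (auto simp: poly_eq_0_iff_dvd elim: dvdE)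
    define q where "q i = synthetic_div (p i) c" for i
    have pq: "p i = [:- c, 1:] * q i + [:poly (p i) c:]" for i
      unfolding q_def by (rule synthetic_div_correct'[symmetric])
    have lin: "pev \<iota> y [:- c, 1:] = y - \<iota> c" by (simp add: hom rhom_simps[OF hom])
    have pqv: "pev \<iota> y (p i) = (y - \<iota> c) * pev \<iota> y (q i) + \<iota> (poly (p i) c)" for i
      by (subst pq) (simp only: e1 lin, simp add: hom rhom_0)
    have split: "(\<iota> (poly (p 0) c) + (\<Sum>i\<in>N. \<iota> (poly (p i) c) * phi i)) = (y - \<iota> c) * (pev \<iota> y C' * z - comb q)"
    proof -
      have "comb p = (y - \<iota> c) * comb q + (\<Sum>i\<in>idx. \<iota> (poly (p i) c) * phi i)"
        unfolding comb_def by (simp add: pqv distrib_right sum.distrib sum_distrib_left mult.assoc)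
      moreover have "comb p = (y - \<iota> c) * (pev \<iota> y C' * z)" unfolding p[symmetric] C' e1 lin by simp
      ultimately show ?thesis unfolding sum_idx phi_0 by (simp add: right_diff_distrib)
    qed
    have zero: "poly (p i) c = 0" if "i \<in> idx" for i
    proof (rule comb_small[OF coord_B[of c] psi_B, where b = "\<lambda>i. poly (p i) c"])
      fix v assume pl: "place \<iota> K v" and t: "v (y - \<iota> c) > 0"
      then interpret place \<iota> K v by simp
      have y0: "vge v y 0" by (rule vge_residue[OF yL vge_pos(1)[OF t]])
      then have "vge v z 0" using zv[OF pl] yn by (simp add: vge_def)
      moreover have combL: "comb q \<in> K" by (simp add: comb_def ff.in_L yL phi_in)
      moreover have "vge v (comb q) 0" unfolding comb_def
        by (intro vge_sum vge_mult0 vge_pev phi_regular[OF pl] y0) (auto simp: ff.in_L yL phi_in)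
      ultimately have "vge v (pev \<iota> y C' * z - comb q) 0"
        by (intro vge_diff vge_mult0 vge_pev y0) (auto simp: ff.in_L yL zK)
      then have "vge v ((pev \<iota> y C' * z - comb q) * (y - \<iota> c)) (v (y - \<iota> c))"
        by (intro vge_mult0 vge_self) (auto simp: ff.in_L yL zK combL)
      then show "vge v (\<iota> (poly (p 0) c) + (\<Sum>i\<in>N. \<iota> (poly (p i) c) * phi i)) (v (y - \<iota> c))"
        unfolding split by (simp add: mult.commute)
    qed (use that in auto)
    then have "\<iota> (poly (p 0) c) + (\<Sum>i\<in>N. \<iota> (poly (p i) c) * phi i) = 0" by (simp add: rhom_0[OF hom])
    moreover have "y - \<iota> c \<noteq> 0" using model.pev_nonzero[of "[:- c, 1:]"] lin by simp
    ultimately have "pev \<iota> y C' * z = comb q" using split by simp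
    moreover have "C' \<noteq> 0" using C' C0 by auto
    ultimately have "good C'" by (auto simp: good_def)
    then have "degree C \<le> degree C'" by (rule C(2))
    moreover have "degree C = 1 + degree C'" unfolding C' using \<open>C' \<noteq> 0\<close> by (subst degree_mult_eq) auto
    ultimately show False by simp
  qed
  then obtain c where c: "C = [:c:]" by (rule degree_eq_zeroE)
  have c0: "c \<noteq> 0" using C0 c by simp
  define q where "q i = smult (inverse c) (p i)" for i
  have ic: "\<iota> (inverse c) * \<iota> c = 1" using c0 by (simp add: rhom_1[OF hom] flip: rhom_mult[OF hom])
  have zq: "z = comb q"
  proof -
    have "comb q = \<iota> (inverse c) * comb p"
      by (simp add: comb_def q_def pev_smult[OF hom] sum_distrib_left mult.assoc)
    also have "\<dots> = (\<iota> (inverse c) * \<iota> c) * z" unfolding p[symmetric] c by (simp add: hom rhom_0)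
    finally show ?thesis by (simp add: ic)
  qed
  \<comment> \<open>The leading terms at infinity cannot cancel.\<close>
  have "int (degree (q i)) + int (d i) \<le> n" if i: "i \<in> idx" "q i \<noteq> 0" for i
  proof (rule ccontr)
    assume neg: "\<not> int (degree (q i)) + int (d i) \<le> n"
    define I where "I = {i \<in> idx. q i \<noteq> 0}"
    have fin: "finite I" "i \<in> I" using N i by (auto simp: I_def)
    define M where "M = Max ((\<lambda>i. degree (q i) + d i) ` I)"
    have Mi: "degree (q j) + d j \<le> M" if "j \<in> I" for j unfolding M_def using fin that by (intro Max_ge) auto
    have "M \<in> (\<lambda>i. degree (q i) + d i) ` I" unfolding M_def using fin by (intro Max_in) auto
    then obtain m where m: "m \<in> I" "M = degree (q m) + d m" by auto
    have Mn: "int M > n" using Mi[OF fin(2)] neg by simp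
    define b where "b j = (if j \<in> I then coeff (q j) (M - d j) else 0)" for j
    have "b m = 0"
    proof (rule comb_small[OF coord_Binf psi_Binf, where b = b])
      fix v assume pl: "place \<iota> K v" and t: "v (1 / y) > 0"
      then interpret place \<iota> K v by simp
      have tL: "1 / y \<in> K" by (simp add: ff.in_L yL)
      have vy: "v y = - v (1 / y)" using yL yn by (simp add: v_divide v_1 ff.in_L)
      define r where "r j = (if j \<in> I then (1 / y) ^ (M - d j) * pev \<iota> y (q j) - \<iota> (b j) else 0)" for j
      have tp: "(1 / y) ^ e \<in> K" for e using tL by (rule ff.power_in)
      have rL: "r j \<in> K" for j using tp by (simp add: r_def ff.in_L yL del: power_one_over)
      have rv: "vge v (r j) (v (1 / y))" for j
      proof (cases "j \<in> I")
        case True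
        then have "degree (q j) \<le> M - d j" using Mi[OF True] by simp
        then show ?thesis using pole_expansion[OF pl t] True by (simp add: r_def b_def del: power_one_over)
      qed (simp add: r_def)
      have zM: "(1 / y) ^ M * z = (\<Sum>j\<in>idx. (r j + \<iota> (b j)) * ((1 / y) ^ d j * phi j))"
        unfolding zq comb_def sum_distrib_left
      proof (intro sum.cong refl)
        fix j assume j: "j \<in> idx"
        show "(1 / y) ^ M * (pev \<iota> y (q j) * phi j) = (r j + \<iota> (b j)) * ((1 / y) ^ d j * phi j)"
        proof (cases "j \<in> I")
          case True
          then have "(1 / y) ^ M = (1 / y) ^ (M - d j) * (1 / y) ^ d j" using Mi[OF True] by (simp flip: power_add)
          then show ?thesis using True by (simp add: r_def mult_ac del: power_one_over)
        next
          case False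
          then have "q j = 0" using j unfolding I_def by blast
          then show ?thesis using False by (simp add: r_def b_def hom rhom_0)
        qed
      qed
      define R where "R = (\<Sum>j\<in>idx. r j * ((1 / y) ^ d j * phi j))"
      have RL: "R \<in> K" using rL tp phi_in by (simp add: R_def ff.in_L del: power_one_over)
      have "vge v R (v (1 / y))" unfolding R_def
      proof (rule vge_sum)
        fix j
        show "r j * ((1 / y) ^ d j * phi j) \<in> K" using rL tp phi_in by (simp add: ff.in_L del: power_one_over)
        have "vge v (((1 / y) ^ d j * phi j) * r j) (v (1 / y))"
          using rL tp phi_in by (intro vge_mult0 phi_infinity[OF pl t] rv) (auto simp: ff.in_L simp del: power_one_over)
        then show "vge v (r j * ((1 / y) ^ d j * phi j)) (v (1 / y))" by (simp only: mult.commute)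
      qed
      moreover have "vge v ((1 / y) ^ M * z) (v (1 / y))"
      proof -
        have "1 / y \<noteq> 0" using yn by simp
        then have "vge v ((1 / y) ^ M) (int M * v (1 / y))" using tL by (simp add: vge_def v_power del: power_one_over)
        moreover have "vge v z (n * v y)" using zv[OF pl] t vy by simp
        ultimately have "vge v ((1 / y) ^ M * z) (int M * v (1 / y) + n * v y)" using tp zK by (intro vge_mult)
        then show ?thesis
        proof (rule vge_mono)
          have "int M * v (1 / y) + n * v y = (int M - n) * v (1 / y)" unfolding vy by (simp add: algebra_simps)
          moreover have "1 * v (1 / y) \<le> (int M - n) * v (1 / y)" using Mn t by (intro mult_right_mono) auto
          ultimately show "v (1 / y) \<le> int M * v (1 / y) + n * v y" by simp
        qed
      qed
      ultimately have "vge v ((1 / y) ^ M * z - R) (v (1 / y))" using tp zK RL by (intro vge_diff ff.mult_in)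
      also have "(1 / y) ^ M * z - R = (\<Sum>j\<in>idx. \<iota> (b j) * ((1 / y) ^ d j * phi j))"
        unfolding zM R_def by (simp only: distrib_right sum.distrib add_diff_cancel_left')
      finally show "vge v (\<iota> (b 0) + (\<Sum>j\<in>N. \<iota> (b j) * ((1 / y) ^ d j * phi j))) (v (1 / y))"
        unfolding sum_idx by (simp add: phi_0 d_0)
    qed (use m in \<open>auto simp: I_def\<close>)
    then have "coeff (q m) (degree (q m)) = 0" using m by (simp add: b_def)
    then show False using m by (simp add: I_def)
  qed
  then show thesis using that[of q] zq by blast
qed

interpretation vs: vector_space "\<lambda>c z. \<iota> c * z"
  by unfold_locales (simp_all add: rhom_simps[OF hom] algebra_simps)

lemma finite_bounded: "finite {j. int j + int e \<le> n}" "card {j. int j + int e \<le> n} = nat (n - int e + 1)"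
proof -
  have "{j. int j + int e \<le> n} = {..<nat (n - int e + 1)}" by auto
  then show "finite {j. int j + int e \<le> n}" "card {j. int j + int e \<le> n} = nat (n - int e + 1)" by simp_all
qed

text \<open>The functions \<open>y\<^sup>j \<phi>\<^sub>i\<close> with \<open>j + d\<^sub>i \<le> n\<close> are a basis of the sections of \<open>n F\<close>.\<close>

lemma h0_multiple:
  "h0 \<iota> K (\<lambda>v. n * line_pullback \<iota> \<eta> Q0 v) = (\<Sum>i\<in>idx. nat (n - int (d i) + 1))"
proof -
  define J where "J i = {j. int j + int (d i) \<le> n}" for i
  define T where "T = Sigma idx J"
  define f where "f = (\<lambda>(i, j). y ^ j * phi i)"
  have finJ: "finite (J i)" for i unfolding J_def by (rule finite_bounded)
  have finT: "finite T" using N finJ by (simp add: T_def)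
  have comb_f: "(\<Sum>ij\<in>T. \<iota> (u ij) * f ij) = comb (\<lambda>i. \<Sum>j\<in>J i. monom (u (i, j)) j)" for u
  proof -
    have mon: "pev \<iota> y (monom c j) = \<iota> c * y ^ j" for c j
      by (induction j) (simp_all add: monom_0 monom_Suc hom rhom_0 mult_ac)
    have "(\<Sum>ij\<in>T. \<iota> (u ij) * f ij) = (\<Sum>i\<in>idx. \<Sum>j\<in>J i. \<iota> (u (i, j)) * (y ^ j * phi i))"
    proof -
      have "(\<Sum>i\<in>idx. \<Sum>j\<in>J i. \<iota> (u (i, j)) * (y ^ j * phi i))
          = (\<Sum>(i, j)\<in>Sigma idx J. \<iota> (u (i, j)) * (y ^ j * phi i))"
        by (rule sum.Sigma) (use N finJ in auto)
      also have "\<dots> = (\<Sum>ij\<in>T. \<iota> (u ij) * f ij)"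
        unfolding T_def f_def by (rule sum.cong) auto
      finally show ?thesis ..
    qed
    also have "\<dots> = comb (\<lambda>i. \<Sum>j\<in>J i. monom (u (i, j)) j)"
      by (simp add: comb_def rhom_sum[OF rhom_pev[OF hom]] mon sum_distrib_right mult.assoc)
    finally show ?thesis .
  qed
  have indep: "u ij = 0" if "(\<Sum>ij\<in>T. \<iota> (u ij) * f ij) = 0" "ij \<in> T" for u ij
  proof -
    obtain i j where ij: "ij = (i, j)" "i \<in> idx" "j \<in> J i" using \<open>ij \<in> T\<close> by (auto simp: T_def)
    have "(\<Sum>j\<in>J i. monom (u (i, j)) j) = 0" using comb_independent[OF _ ij(2)] that(1) unfolding comb_f by blast
    then have "coeff (\<Sum>j\<in>J i. monom (u (i, j)) j) j = 0" by simp
    then show ?thesis using ij finJ by (simp add: coeff_sum)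
  qed
  have inj: "inj_on f T"
  proof (rule inj_onI, rule ccontr)
    fix s t assume st: "s \<in> T" "t \<in> T" "f s = f t" "s \<noteq> t"
    define u :: "nat \<times> nat \<Rightarrow> 'a" where "u = (\<lambda>r. if r = s then 1 else if r = t then - 1 else 0)"
    have "(\<Sum>ij\<in>T. \<iota> (u ij) * f ij) = (\<Sum>ij\<in>{s, t}. \<iota> (u ij) * f ij)"
      using st finT by (intro sum.mono_neutral_right) (auto simp: u_def rhom_0[OF hom])
    also have "\<dots> = 0" using st by (simp add: u_def rhom_simps[OF hom])
    finally have "u s = 0" using st indep by blast
    then show False by (simp add: u_def)
  qed
  have "vs.dim (sect n) = card T"
  proof (rule vs.dim_unique[of "f ` T"])
    show "f ` T \<subseteq> sect n"
    proof (rule image_subsetI)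
      fix s assume "s \<in> T"
      then obtain i j where "s = (i, j)" "int j + int (d i) \<le> n" by (auto simp: T_def J_def)
      then show "f s \<in> sect n" using basis_in_sect by (simp add: f_def)
    qed
    show "card (f ` T) = card T" using inj by (rule card_image)
    show "vs.independent (f ` T)"
    proof (rule vs.independent_if_scalars_zero)
      show "finite (f ` T)" using finT by simp
      fix u z assume 0: "(\<Sum>z\<in>f ` T. \<iota> (u z) * z) = 0" and "z \<in> f ` T"
      then obtain s where s: "s \<in> T" "z = f s" by auto
      have "(\<Sum>s\<in>T. \<iota> (u (f s)) * f s) = 0" using 0 inj by (simp add: sum.reindex)
      then show "u z = 0" using indep[of "u \<circ> f" s] s by simp
    qed
    show "sect n \<subseteq> vs.span (f ` T)"
    proof
      fix z assume "z \<in> sect n"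
      then obtain p where z: "z = comb p" and p: "\<And>i. i \<in> idx \<Longrightarrow> p i \<noteq> 0 \<Longrightarrow> int (degree (p i)) + int (d i) \<le> n"
        by (rule sect_expansion) blast
      have "p i = (\<Sum>j\<in>J i. monom (coeff (p i) j) j)" if i: "i \<in> idx" for i
      proof (rule poly_eqI)
        fix l
        have "coeff (p i) l = 0" if "l \<notin> J i"
        proof (rule ccontr)
          assume nz: "coeff (p i) l \<noteq> 0"
          then have "l \<le> degree (p i)" "p i \<noteq> 0" by (auto intro: le_degree)
          then show False using p[OF i] that by (simp add: J_def)
        qed
        then show "coeff (p i) l = coeff (\<Sum>j\<in>J i. monom (coeff (p i) j) j) l"
          using finJ by (auto simp: coeff_sum)
      qed
      then have "comb p = comb (\<lambda>i. \<Sum>j\<in>J i. monom (coeff (p i) j) j)"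
        unfolding comb_def by (intro sum.cong refl) simp
      also have "\<dots> = (\<Sum>s\<in>T. \<iota> (coeff (p (fst s)) (snd s)) * f s)" by (simp add: comb_f)
      also have "\<dots> \<in> vs.span (f ` T)"
        by (intro vs.span_sum vs.span_scale vs.span_base) auto
      finally show "z \<in> vs.span (f ` T)" by (simp add: z)
    qed
  qed
  also have "card T = (\<Sum>i\<in>idx. card (J i))" unfolding T_def using N finJ by (intro card_SigmaI) auto
  also have "\<dots> = (\<Sum>i\<in>idx. nat (n - int (d i) + 1))" by (simp add: J_def finite_bounded)
  finally show ?thesis by (simp add: h0_def)
qed

end

section \<open>The scrollar invariants\<close>

context nodal_pencil
begin

lemma h0_jump:
  "int (h0 \<iota> K (\<lambda>v. n * line_pullback \<iota> \<eta> Q0 v)) - int (h0 \<iota> K (\<lambda>v. (n - 1) * line_pullback \<iota> \<eta> Q0 v))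
     = int (card {i \<in> idx. int (d i) \<le> n})"
proof -
  have "int (\<Sum>i\<in>idx. nat (n - int (d i) + 1)) - int (\<Sum>i\<in>idx. nat (n - 1 - int (d i) + 1))
      = (\<Sum>i\<in>idx. int (nat (n - int (d i) + 1)) - int (nat (n - 1 - int (d i) + 1)))"
    by (simp only: of_nat_sum sum_subtractf)
  also have "\<dots> = (\<Sum>i\<in>idx. if int (d i) \<le> n then 1 else 0)" by (intro sum.cong) auto
  also have "\<dots> = int (card {i \<in> idx. int (d i) \<le> n})"
    using N(1) by (simp add: sum.If_cases Int_def)
  finally show ?thesis by (simp only: h0_multiple)
qed

end

theorem theorem1:
  fixes \<iota> :: "'a::alg_closed_field \<Rightarrow> 'b::field"
    and k a :: nat
    and L D :: "nat \<Rightarrow> ('a P1 \<times> 'a P1) set"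
    and y :: "nat \<Rightarrow> nat"
    and \<Gamma> :: "'a poly poly"
    and \<xi> \<eta> :: "'b P1"
    and F :: "'b divisor"
  assumes "k \<ge> 2" and "a \<ge> 1"
    and "\<And>i. i \<in> {1..k-1} \<Longrightarrow> L i \<in> lines_10"
    and "inj_on L {1..k-1}"
    and "\<And>i. i \<in> {1..k-1} \<Longrightarrow> D i \<subseteq> L i \<and> finite (D i) \<and> card (D i) = y i"
    and "\<And>i. i \<in> {1..k-1} \<Longrightarrow> y i \<le> a"
    and "\<And>i j. i \<in> {1..k-1} \<Longrightarrow> j \<in> {1..k-1} \<Longrightarrow> i \<le> j \<Longrightarrow> y j \<le> y i"
    and "curve_of_type k a \<Gamma>"
    and "irreducible_curve k a \<Gamma>"
    and "nodal_curve k a \<Gamma>"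
    and "nodes k a \<Gamma> = (\<Union>i\<in>{1..k-1}. D i)"
    and "field_embedding \<iota>"
    and "generic_point \<iota> k a \<Gamma> \<xi> \<eta>"
    and "F \<in> induced_pencil \<iota> \<eta>"
  shows "\<forall>i\<in>{1..k-1}.
    is_scrollar_invariant \<iota> (function_field \<iota> \<xi> \<eta>) F i (int a - int (y i) - 2)"
proof -
  let ?N = "{1..k-1}"
  have "\<exists>Q. L i = fst -` {Q}" if "i \<in> ?N" for i using assms(3)[OF that] by (auto simp: lines_10_def)
  then obtain P where P: "\<And>i. i \<in> ?N \<Longrightarrow> L i = fst -` {P i}" by metis
  define S where "S i = {R. (P i, R) \<in> D i}" for i
  have DS: "D i = {P i} \<times> S i" if "i \<in> ?N" for i
    using assms(5)[OF that] P[OF that] by (auto simp: S_def)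
  have SS: "finite (S i)" "card (S i) = y i" if "i \<in> ?N" for i
  proof -
    have "S i = snd ` D i" unfolding DS[OF that] by force
    then show "finite (S i)" using assms(5)[OF that] by simp
    have "card (D i) = card (S i)" unfolding DS[OF that] by (simp add: card_cartesian_product)
    then show "card (S i) = y i" using assms(5)[OF that] by simp
  qed
  \<comment> \<open>The field is infinite, so some point \<open>(1 : eps)\<close> differs from all \<open>P i\<close>.\<close>
  obtain eps where eps: "eps \<notin> (\<lambda>i. snd (rep_P1 (P i)) / fst (rep_P1 (P i))) ` ?N"
    using alg_closed_infinite ex_new_if_finite[of "(\<lambda>i. snd (rep_P1 (P i)) / fst (rep_P1 (P i))) ` ?N"] by auto
  obtain Q0 where F: "F = line_pullback \<iota> \<eta> Q0" using assms(14) by (auto simp: induced_pencil_def)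
  interpret nodal_pencil \<iota> k a \<Gamma> \<xi> \<eta> ?N P S eps Q0
  proof
    show "rhom \<iota>" using assms(12) by (simp add: field_embedding_def rhom_def)
    show "inj_on P ?N"
    proof (rule inj_onI)
      fix i j assume "i \<in> ?N" "j \<in> ?N" "P i = P j"
      then have "L i = L j" using P by simp
      then show "i = j" using assms(4) \<open>i \<in> ?N\<close> \<open>j \<in> ?N\<close> by (auto simp: inj_on_def)
    qed
    show "nodes k a \<Gamma> = (\<Union>i\<in>?N. {P i} \<times> S i)" unfolding assms(11) using DS by auto
    show "snd (rep_P1 (P i)) \<noteq> eps * fst (rep_P1 (P i))" if "i \<in> ?N" for i
    proof
      assume eq: "snd (rep_P1 (P i)) = eps * fst (rep_P1 (P i))"
      then have "fst (rep_P1 (P i)) \<noteq> 0" using rep_P1_nonzero[of "P i"] by (metis mult_zero_right prod.collapse)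
      then have "eps = snd (rep_P1 (P i)) / fst (rep_P1 (P i))" using eq by simp
      then show False using eps that by blast
    qed
  qed (use assms SS in auto)
  have di: "d i = a - y i" if "i \<in> ?N" for i unfolding d_def using that SS(2)[OF that] by simp
  show ?thesis
  proof
    fix i assume i: "i \<in> ?N"
    have ai: "int a - int (y i) - 2 + 2 = int (d i)" unfolding di[OF i] using assms(6)[OF i] by simp
    have mono: "d l \<le> d j" if "l \<in> idx" "j \<in> idx" "l \<le> j" for l j
    proof (cases "l = 0")
      case False
      then have lj: "l \<in> ?N" "j \<in> ?N" using that by auto
      then show ?thesis unfolding di[OF lj(1)] di[OF lj(2)] using assms(7)[OF lj that(3)] by simp
    next
      case True
      show ?thesis unfolding True d_0 by simp
    qed
    have jump: "int (card {l \<in> idx. int (d l) \<le> n}) > int i \<longleftrightarrow> int (d i) \<le> n" for n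
    proof
      assume le: "int (d i) \<le> n"
      have "{0..i} \<subseteq> {l \<in> idx. int (d l) \<le> n}"
      proof
        fix l assume l: "l \<in> {0..i}"
        then have lx: "l \<in> idx" using i by auto
        then have "d l \<le> d i" using l i by (intro mono) auto
        then show "l \<in> {l \<in> idx. int (d l) \<le> n}" using le lx by auto
      qed
      then have "card {0..i} \<le> card {l \<in> idx. int (d l) \<le> n}" by (intro card_mono) auto
      then show "int (card {l \<in> idx. int (d l) \<le> n}) > int i" by simp
    next
      assume gt: "int (card {l \<in> idx. int (d l) \<le> n}) > int i"
      show "int (d i) \<le> n"
      proof (rule ccontr)
        assume "\<not> int (d i) \<le> n"
        then have small: "n < int (d i)" by simp
        have "{l \<in> idx. int (d l) \<le> n} \<subseteq> {..<i}"
        proof (rule subsetI, rule ccontr)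
          fix l assume l: "l \<in> {l \<in> idx. int (d l) \<le> n}" "l \<notin> {..<i}"
          have "d i \<le> d l" by (rule mono) (use i l in auto)
          then show False using l(1) small by simp
        qed
        then have "card {l \<in> idx. int (d l) \<le> n} \<le> card {..<i}" by (intro card_mono) auto
        then show False using gt by simp
      qed
    qed
    show "is_scrollar_invariant \<iota> (function_field \<iota> \<xi> \<eta>) F i (int a - int (y i) - 2)"
      unfolding is_scrollar_invariant_def Let_def F h0_jump ai jump by auto
  qed
qed

end
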